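(* Let $K$ be an algebraically closed field of characteristic $0$. The syzygy bundle $$\operatorname{Syz}(X^2-Y^2,\;X^2-Z^2,\;XY,\;XZ,\;YZ)$$ is stable on $\mathbb{P}^2=\operatorname{Proj}K[X,Y,Z]$. Moreover, the syzygy bundle of five generic quadrics in $K[X,Y,Z]$ is stable on the projective plane; that is, there is a non-empty Zariski open subset $U$ of the affine space $(K[X,Y,Z]_2)^5$ such that for all $(f_1,\dots,f_5)\in U$ the ideal $(f_1,\dots,f_5)$ has radical $(X,Y,Z)$ and $\operatorname{Syz}(f_1,\dots,f_5)$ is stable.
   Context: For homogeneous $f_1,\dots,f_n\in K[X,Y,Z]$ of degrees $d_i$ whose ideal has radical $(X,Y,Z)$, the syzygy bundle $\operatorname{Syz}(f_1,\dots,f_n)$ is the kernel of the surjection $\bigoplus_{i=1}^n\mathcal{O}_{\mathbb{P}^2}(-d_i)\xrightarrow{f_1,\dots,f_n}\mathcal{O}_{\mathbb{P}^2}$. Slope: $\mu=\deg/\operatorname{rk}$ with $\deg=c_1$. A vector bundle $\mathcal{E}$ is stable if $\mu(\mathcal{F})<\mu(\mathcal{E})$ for every coherent subsheaf $\mathcal{F}$ with $0<\operatorname{rk}(\mathcal{F})<\operatorname{rk}(\mathcal{E})$. $K[X,Y,Z]_2$ is the space of homogeneous polynomials of degree $2$. *)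

theory Defs
  imports
    "HOL-Computational_Algebra.Computational_Algebra"
    "HOL-Algebra.Algebraic_Closure_Type"
    "Jordan_Normal_Form.Determinant"
begin

section \<open>The graded ring \<open>K[X,Y,Z]\<close>\<close>

text \<open>\<open>K[X,Y,Z]\<close> is the iterated polynomial ring \<open>K[X][Y][Z]\<close>, with \<open>X\<close> the innermost variable.\<close>

type_synonym 'k poly3 = "'k poly poly poly"

definition vX :: "'k::field poly3" where "vX = [:[:[:0, 1:]:]:]"
definition vY :: "'k::field poly3" where "vY = [:[:0, 1:]:]"
definition vZ :: "'k::field poly3" where "vZ = [:0, 1:]"

definition coeff3 :: "'k::field poly3 \<Rightarrow> nat \<Rightarrow> nat \<Rightarrow> nat \<Rightarrow> 'k" where
  "coeff3 f i j k = Polynomial.coeff (Polynomial.coeff (Polynomial.coeff f k) j) i"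

definition homogeneous :: "nat \<Rightarrow> 'k::field poly3 \<Rightarrow> bool" where
  "homogeneous d f \<longleftrightarrow> (\<forall>i j k. coeff3 f i j k \<noteq> 0 \<longrightarrow> i + j + k = d)"

definition ideal_of :: "'k::field poly3 set \<Rightarrow> 'k poly3 set" where
  "ideal_of A = genideal ring_of_type_algebra A"

definition radical :: "'k::field poly3 set \<Rightarrow> 'k poly3 set" where
  "radical I = {g. \<exists>m. g ^ m \<in> I}"


section \<open>The scheme \<open>Proj K[X,Y,Z]\<close>\<close>

type_synonym 'k point = "'k poly3 set"

definition homogeneous_ideal :: "'k::field poly3 set \<Rightarrow> bool" where
  "homogeneous_ideal I \<longleftrightarrow> ideal I ring_of_type_algebra \<and>
     (\<forall>f\<in>I. \<exists>gs. set gs \<subseteq> I \<and> (\<forall>g\<in>set gs. \<exists>d. homogeneous d g) \<and> f = sum_list gs)"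

definition Proj :: "'k::field point set" where
  "Proj = {P. primeideal P ring_of_type_algebra \<and> homogeneous_ideal P \<and> \<not> {vX, vY, vZ} \<subseteq> P}"

text \<open>\<open>Proj K[X,Y,Z]\<close> is integral with generic point \<open>{0}\<close>. Hence its nonempty open sets are
  closed under finite intersection and all contain \<open>{0}\<close>, and sections of torsion-free sheaves
  over a nonempty open set may be identified with their germs at \<open>{0}\<close>.
  The empty set is left out throughout; the sections over it carry no information.\<close>

definition nonempty_open :: "'k::field point set \<Rightarrow> bool" where
  "nonempty_open U \<longleftrightarrow> U \<noteq> {} \<and> (\<exists>A. U = {P \<in> Proj. \<not> A \<subseteq> P})"

definition basic_open :: "'k::field poly3 \<Rightarrow> 'k point set" where
  "basic_open h = {P \<in> Proj. h \<notin> P}"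

definition generic_point :: "'k::field point" where
  "generic_point = {0}"

text \<open>The stalk at \<open>P\<close> and the sections over \<open>U\<close> of the twisting sheaf \<open>O(d)\<close>, inside the
  field of fractions of \<open>K[X,Y,Z]\<close>. For \<open>d = 0\<close> these are the local ring at \<open>P\<close> and the
  ring of regular functions on \<open>U\<close>; the stalk at the generic point is then the function field.\<close>

definition twist_stalk :: "int \<Rightarrow> 'k::field point \<Rightarrow> 'k poly3 fract set" where
  "twist_stalk d P = {Fract a b | a b m n.
     homogeneous m a \<and> homogeneous n b \<and> b \<notin> P \<and> int m - int n = d}"

definition twist :: "int \<Rightarrow> 'k::field point set \<Rightarrow> 'k poly3 fract set" where
  "twist d U = (\<Inter>P\<in>U. twist_stalk d P)"

abbreviation local_ring :: "'k::field point \<Rightarrow> 'k poly3 fract set" where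
  "local_ring \<equiv> twist_stalk 0"

abbreviation regular_functions :: "'k::field point set \<Rightarrow> 'k poly3 fract set" where
  "regular_functions \<equiv> twist 0"


section \<open>Torsion-free sheaves of modules\<close>

text \<open>A sheaf is represented by its sections over nonempty open sets, which are vectors of
  length \<open>n\<close> over the field of fractions of \<open>K[X,Y,Z]\<close>; restriction maps are inclusions.
  Every subsheaf of a direct sum of \<open>n\<close> twisting sheaves is of this form.\<close>

type_synonym 'k sheaf = "'k point set \<Rightarrow> 'k poly3 fract vec set"

definition lin_comb :: "nat \<Rightarrow> (nat \<Rightarrow> 'a::field) \<Rightarrow> 'a vec list \<Rightarrow> 'a vec" where
  "lin_comb n c vs = vec n (\<lambda>j. \<Sum>i<length vs. c i * (vs ! i) $ j)"

definition lin_span :: "nat \<Rightarrow> 'a::field set \<Rightarrow> 'a vec list \<Rightarrow> 'a vec set" where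
  "lin_span n R vs = {lin_comb n c vs | c. \<forall>i<length vs. c i \<in> R}"

definition is_basis :: "nat \<Rightarrow> 'a::field set \<Rightarrow> 'a vec set \<Rightarrow> 'a vec list \<Rightarrow> bool" where
  "is_basis n R M vs \<longleftrightarrow> set vs \<subseteq> carrier_vec n \<and> M = lin_span n R vs \<and>
     (\<forall>c. (\<forall>i<length vs. c i \<in> R) \<and> lin_comb n c vs = 0\<^sub>v n \<longrightarrow> (\<forall>i<length vs. c i = 0))"

text \<open>In the gluing condition, compatibility of sections over a family of open sets means
  equality, since any two of these open sets meet.\<close>

definition module_sheaf :: "nat \<Rightarrow> 'k::field sheaf \<Rightarrow> bool" where
  "module_sheaf n F \<longleftrightarrow>
     (\<forall>U. nonempty_open U \<longrightarrow>
        F U \<subseteq> carrier_vec n \<and> 0\<^sub>v n \<in> F U \<and>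
        (\<forall>v\<in>F U. \<forall>w\<in>F U. v + w \<in> F U) \<and>
        (\<forall>a\<in>regular_functions U. \<forall>v\<in>F U. a \<cdot>\<^sub>v v \<in> F U)) \<and>
     (\<forall>U V. nonempty_open U \<and> nonempty_open V \<and> V \<subseteq> U \<longrightarrow> F U \<subseteq> F V) \<and>
     (\<forall>\<U>. \<U> \<noteq> {} \<and> (\<forall>U\<in>\<U>. nonempty_open U) \<longrightarrow> (\<Inter>U\<in>\<U>. F U) \<subseteq> F (\<Union>\<U>))"

definition subsheaf :: "'k::field sheaf \<Rightarrow> 'k sheaf \<Rightarrow> bool" where
  "subsheaf F G \<longleftrightarrow> (\<forall>U. nonempty_open U \<longrightarrow> F U \<subseteq> G U)"

definition stalk :: "'k::field sheaf \<Rightarrow> 'k point \<Rightarrow> 'k poly3 fract vec set" where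
  "stalk F P = \<Union>{F U | U. nonempty_open U \<and> P \<in> U}"

text \<open>Coherent: on the members \<open>D\<^sub>+(h)\<close>, \<open>deg h > 0\<close>, of an affine open cover, the sheaf is the
  one associated with a finitely generated module \<open>M\<close>. With generators \<open>vs\<close> of \<open>M\<close>, the stalk of
  the associated sheaf at \<open>Q\<close> is the span of \<open>vs\<close> over the local ring at \<open>Q\<close>.\<close>

definition coherent :: "nat \<Rightarrow> 'k::field sheaf \<Rightarrow> bool" where
  "coherent n F \<longleftrightarrow> module_sheaf n F \<and>
     (\<forall>P\<in>Proj. \<exists>h m vs. homogeneous m h \<and> m > 0 \<and> P \<in> basic_open h \<and>
        set vs \<subseteq> F (basic_open h) \<and>
        (\<forall>V. nonempty_open V \<and> V \<subseteq> basic_open h \<longrightarrow>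
           F V = (\<Inter>Q\<in>V. lin_span n (local_ring Q) vs)))"

definition vector_bundle :: "nat \<Rightarrow> 'k::field sheaf \<Rightarrow> bool" where
  "vector_bundle n F \<longleftrightarrow> module_sheaf n F \<and>
     (\<forall>P\<in>Proj. \<exists>U vs. nonempty_open U \<and> P \<in> U \<and>
        (\<forall>V. nonempty_open V \<and> V \<subseteq> U \<longrightarrow> is_basis n (regular_functions V) (F V) vs))"


section \<open>Rank, degree, slope and stability\<close>

definition stalk_basis :: "nat \<Rightarrow> 'k::field sheaf \<Rightarrow> 'k point \<Rightarrow> 'k poly3 fract vec list \<Rightarrow> bool" where
  "stalk_basis n F P vs \<longleftrightarrow> is_basis n (local_ring P) (stalk F P) vs"

definition rk :: "nat \<Rightarrow> 'k::field sheaf \<Rightarrow> nat" where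
  "rk n F = (THE r. \<exists>vs. stalk_basis n F generic_point vs \<and> length vs = r)"

text \<open>The points of codimension one are the integral plane curves, that is, the nonzero
  homogeneous principal prime ideals.\<close>

definition curves :: "'k::field point set" where
  "curves = {P \<in> Proj. P \<noteq> {0} \<and> (\<exists>p d. homogeneous d p \<and> P = ideal_of {p})}"

definition curve_eq :: "'k::field point \<Rightarrow> 'k poly3" where
  "curve_eq P = (SOME p. P = ideal_of {p})"

definition curve_degree :: "'k::field point \<Rightarrow> nat" where
  "curve_degree P = (THE d. homogeneous d (curve_eq P))"

definition valuation :: "'k::field point \<Rightarrow> 'k poly3 fract \<Rightarrow> int" where
  "valuation P h = (THE v. \<exists>a b. a \<notin> P \<and> b \<notin> P \<and>
     h = power_int (Fract (curve_eq P) 1) v * Fract a b)"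

text \<open>The first Chern class of a torsion-free coherent sheaf \<open>F\<close> of rank \<open>r\<close> is that of the line
  bundle \<open>det F\<close>, the reflexive hull of the \<open>r\<close>-th exterior power of \<open>F\<close>, and it is the degree of
  the divisor of any nonzero rational section of \<open>det F\<close>. We take the section \<open>s\<^sub>1 \<and> \<dots> \<and> s\<^sub>r\<close> for a
  basis \<open>ss\<close> of the generic stalk. At the generic point \<open>P\<close> of a curve the local ring is a
  discrete valuation ring, the stalk of \<open>F\<close> is free with some basis \<open>vs\<close>, and
  \<open>v\<^sub>1 \<and> \<dots> \<and> v\<^sub>r\<close> generates the stalk of \<open>det F\<close>; so the section vanishes there to the order of
  the determinant of the matrix that expresses \<open>ss\<close> in terms of \<open>vs\<close>.\<close>

definition det_order ::
    "nat \<Rightarrow> 'k::field sheaf \<Rightarrow> 'k poly3 fract vec list \<Rightarrow> 'k point \<Rightarrow> int" where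
  "det_order n F ss P = (THE v. \<exists>vs A. stalk_basis n F P vs \<and>
     A \<in> carrier_mat (length ss) (length vs) \<and> length vs = length ss \<and>
     (\<forall>i<length ss. \<forall>j<length vs. A $$ (i, j) \<in> local_ring generic_point) \<and>
     (\<forall>i<length ss. ss ! i = lin_comb n (\<lambda>j. A $$ (i, j)) vs) \<and>
     v = valuation P (det A))"

definition c1 :: "nat \<Rightarrow> 'k::field sheaf \<Rightarrow> int" where
  "c1 n F = (THE d. \<exists>ss. stalk_basis n F generic_point ss \<and>
     d = (\<Sum>P\<in>{P \<in> curves. det_order n F ss P \<noteq> 0}. int (curve_degree P) * det_order n F ss P))"

definition slope :: "nat \<Rightarrow> 'k::field sheaf \<Rightarrow> rat" where
  "slope n F = of_int (c1 n F) / of_nat (rk n F)"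

definition stable :: "nat \<Rightarrow> 'k::field sheaf \<Rightarrow> bool" where
  "stable n E \<longleftrightarrow> vector_bundle n E \<and>
     (\<forall>F. coherent n F \<and> subsheaf F E \<and> 0 < rk n F \<and> rk n F < rk n E \<longrightarrow> slope n F < slope n E)"


section \<open>Syzygy bundles\<close>

text \<open>The kernel of \<open>O(-d\<^sub>1) \<oplus> \<dots> \<oplus> O(-d\<^sub>n) \<rightarrow> O\<close> given by \<open>f\<^sub>1, \<dots>, f\<^sub>n\<close>, where \<open>f\<^sub>i\<close> is
  homogeneous of degree \<open>d\<^sub>i\<close>.\<close>

definition Syz :: "nat list \<Rightarrow> 'k::field poly3 list \<Rightarrow> 'k sheaf" where
  "Syz ds fs U = {v \<in> carrier_vec (length fs).
     (\<forall>i<length fs. v $ i \<in> twist (- int (ds ! i)) U) \<and>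
     (\<Sum>i<length fs. Fract (fs ! i) 1 * v $ i) = 0}"


section \<open>The Zariski topology on \<open>(K[X,Y,Z]\<^sub>d)\<^sup>n\<close>\<close>

definition form_tuples :: "nat \<Rightarrow> nat \<Rightarrow> 'k::field poly3 list set" where
  "form_tuples n d = {fs. length fs = n \<and> (\<forall>f\<in>set fs. homogeneous d f)}"

inductive_set polynomial_functions :: "nat \<Rightarrow> nat \<Rightarrow> ('k::field poly3 list \<Rightarrow> 'k) set"
  for n d :: nat where
  const: "(\<lambda>_. a) \<in> polynomial_functions n d"
| coordinate: "m < n \<Longrightarrow> i + j + k = d \<Longrightarrow> (\<lambda>fs. coeff3 (fs ! m) i j k) \<in> polynomial_functions n d"
| add: "\<phi> \<in> polynomial_functions n d \<Longrightarrow> \<psi> \<in> polynomial_functions n d \<Longrightarrow>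
    (\<lambda>fs. \<phi> fs + \<psi> fs) \<in> polynomial_functions n d"
| mult: "\<phi> \<in> polynomial_functions n d \<Longrightarrow> \<psi> \<in> polynomial_functions n d \<Longrightarrow>
    (\<lambda>fs. \<phi> fs * \<psi> fs) \<in> polynomial_functions n d"

definition zariski_open :: "nat \<Rightarrow> nat \<Rightarrow> 'k::field poly3 list set \<Rightarrow> bool" where
  "zariski_open n d U \<longleftrightarrow> (\<exists>\<Phi> \<subseteq> polynomial_functions n d.
     U = {fs \<in> form_tuples n d. \<exists>\<phi>\<in>\<Phi>. \<phi> fs \<noteq> 0})"

end

(* A subsheaf F of rank r of E = Syz(f_1,...,f_5) has a generic basis, whose r-by-r minors are
   proportional to a vector W of forms of some degree e without common factor, and
   c_1(F) <= -2 r - e. Since E has slope -5/2, it suffices that e >= 1 for r = 1 and e >= 2 for r = 2, 3.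
   The minors are killed by contraction with (f_1,...,f_5). Hence e = 0 contradicts the linear independence
   of the f_i. For e = 1 the vector W is a skew tensor of linear syzygies. Orthogonalizing the
   symmetric bilinear form on linear forms given by the linear form on quadrics that vanishes on the f_i,
   which is possible on a nonempty open set, turns the span of the f_i into the span of
   q x^2 - p y^2, s x^2 - p z^2, xy, xz, yz. There the skew matrices of linear syzygies are the multiples of
   one matrix of rank 4; the Pluecker relations exclude r = 2, and skew symmetry excludes r = 3. *)

theory Submission
  imports Defs "Berlekamp_Zassenhaus.Unique_Factorization_Poly"
begin

section \<open>Homogeneous polynomials\<close>

text \<open>The bound on the first Chern class is local. At each curve the minors of the generic
  basis and those of a basis of the stalk differ by the determinant whose order enters
  \<open>c1\<close>; the latter minors are regular of degree -2r, and some entry of W does not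
  vanish on the curve. Since a fraction of degree d has a divisor of degree d, summation gives the
  bound, and the slope is below -5/2 as soon as 2e > r. Rank and degree involve only stalks at the
  generic point and at curves, which are free over fields or discrete valuation rings. Exterior
  powers are replaced by minors with arbitrary index functions, so contraction is a Laplace
  expansion. Five independent quadrics span a hyperplane of the 6-dimensional space of quadrics, so
  the linear form \<theta> vanishing on them is unique up to a scalar. If x, y, z are orthogonal for
  (u, v) |-> \<theta>(uv) and \<theta> takes the values p, q, s at their squares, then the normal
  form in the overview spans the kernel of \<theta>. Leaving p, q, s unnormalized avoids square
  roots and makes their nonvanishing one polynomial condition.\<close>

lemma poly3_eqI: "(\<And>i j k. coeff3 f i j k = coeff3 g i j k) \<Longrightarrow> f = g"
  unfolding coeff3_def by (intro poly_eqI) auto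

lemma coeff3_0 [simp]: "coeff3 0 i j k = 0"
  by (simp add: coeff3_def)

lemma coeff3_add [simp]: "coeff3 (f + g) i j k = coeff3 f i j k + coeff3 g i j k"
  by (simp add: coeff3_def)

lemma coeff3_uminus [simp]: "coeff3 (- f) i j k = - coeff3 f i j k"
  by (simp add: coeff3_def)

lemma coeff3_diff [simp]: "coeff3 (f - g) i j k = coeff3 f i j k - coeff3 g i j k"
  by (simp add: coeff3_def)

lemma coeff3_sum: "coeff3 (\<Sum>a\<in>A. f a) i j k = (\<Sum>a\<in>A. coeff3 (f a) i j k)"
  by (induction A rule: infinite_finite_induct) auto

lemma coeff3_monom:
  "coeff3 (Polynomial.monom (Polynomial.monom (Polynomial.monom c a) b) e) i j k =
     (if a = i \<and> b = j \<and> e = k then c else 0)"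
  by (auto simp: coeff3_def)

lemma coeff3_mult:
  "coeff3 (f * g) i j k = (\<Sum>k1\<le>k. \<Sum>j1\<le>j. \<Sum>i1\<le>i.
     coeff3 f i1 j1 k1 * coeff3 g (i - i1) (j - j1) (k - k1))"
  by (simp add: coeff3_def Polynomial.coeff_mult Polynomial.coeff_sum)

lemma coeff3_1: "coeff3 1 i j k = (if i = 0 \<and> j = 0 \<and> k = 0 then 1 else 0)"
  by (auto simp: coeff3_def coeff_1)

lemma nonzero_coeff3: "f \<noteq> 0 \<Longrightarrow> \<exists>i j k. coeff3 f i j k \<noteq> 0"
  using poly3_eqI[of f 0] by auto

lemma homogeneousD: "homogeneous d f \<Longrightarrow> coeff3 f i j k \<noteq> 0 \<Longrightarrow> i + j + k = d"
  unfolding homogeneous_def by blast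

lemma homogeneous_0 [simp]: "homogeneous d 0"
  by (simp add: homogeneous_def)

lemma homogeneous_1 [simp]: "homogeneous 0 1"
  by (auto simp: homogeneous_def coeff3_1)

lemma homogeneous_add: "homogeneous d f \<Longrightarrow> homogeneous d g \<Longrightarrow> homogeneous d (f + g)"
  by (auto simp: homogeneous_def) (metis add_0)

lemma homogeneous_uminus [simp]: "homogeneous d (- f) \<longleftrightarrow> homogeneous d f"
  by (auto simp: homogeneous_def)

lemma homogeneous_diff: "homogeneous d f \<Longrightarrow> homogeneous d g \<Longrightarrow> homogeneous d (f - g)"
  using homogeneous_add[of d f "- g"] by simp

lemma homogeneous_sum: "(\<And>a. a \<in> A \<Longrightarrow> homogeneous d (f a)) \<Longrightarrow> homogeneous d (\<Sum>a\<in>A. f a)"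
  by (induction A rule: infinite_finite_induct) (auto intro: homogeneous_add)

lemma homogeneous_mult:
  assumes "homogeneous d f" "homogeneous e g"
  shows "homogeneous (d + e) (f * g)"
  unfolding homogeneous_def
proof (intro allI impI)
  fix i j k assume "coeff3 (f * g) i j k \<noteq> 0"
  then obtain k1 where k1: "k1 \<le> k" "(\<Sum>j1\<le>j. \<Sum>i1\<le>i.
     coeff3 f i1 j1 k1 * coeff3 g (i - i1) (j - j1) (k - k1)) \<noteq> 0"
    unfolding coeff3_mult by (metis (no_types, lifting) sum.neutral atMost_iff)
  then obtain j1 where j1: "j1 \<le> j" "(\<Sum>i1\<le>i.
     coeff3 f i1 j1 k1 * coeff3 g (i - i1) (j - j1) (k - k1)) \<noteq> 0"
    by (metis (no_types, lifting) sum.neutral atMost_iff)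
  then obtain i1 where i1: "i1 \<le> i" "coeff3 f i1 j1 k1 * coeff3 g (i - i1) (j - j1) (k - k1) \<noteq> 0"
    by (metis (no_types, lifting) sum.neutral atMost_iff)
  hence "coeff3 f i1 j1 k1 \<noteq> 0" "coeff3 g (i - i1) (j - j1) (k - k1) \<noteq> 0" by auto
  hence "i1 + j1 + k1 = d" "(i - i1) + (j - j1) + (k - k1) = e"
    using assms unfolding homogeneous_def by blast+
  with i1(1) j1(1) k1(1) show "i + j + k = d + e" by linarith
qed

lemma homogeneous_power: "homogeneous d f \<Longrightarrow> homogeneous (n * d) (f ^ n)"
  by (induction n) (auto intro: homogeneous_mult)

lemma homogeneous_unique:
  assumes "homogeneous d f" "homogeneous e f" "f \<noteq> 0"
  shows "d = e"
proof -
  obtain i j k where "coeff3 f i j k \<noteq> 0" using nonzero_coeff3[OF assms(3)] by blast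
  with assms(1,2) show ?thesis unfolding homogeneous_def by metis
qed

section \<open>Homogeneous parts; factors of forms are forms\<close>

definition homog_part :: "nat \<Rightarrow> 'k::field poly3 \<Rightarrow> 'k poly3" where
  "homog_part d f = (\<Sum>k\<le>d. \<Sum>j\<le>d - k. Polynomial.monom (Polynomial.monom
     (Polynomial.monom (coeff3 f (d - k - j) j k) (d - k - j)) j) k)"

lemma coeff3_homog_part: "coeff3 (homog_part d f) i j k = (if i + j + k = d then coeff3 f i j k else 0)"
proof -
  have "coeff3 (homog_part d f) i j k =
      (\<Sum>k'\<le>d. \<Sum>j'\<le>d - k'. if d - k' - j' = i \<and> j' = j \<and> k' = k then coeff3 f (d - k' - j') j' k' else 0)"
    unfolding homog_part_def coeff3_sum coeff3_monom ..
  also have "\<dots> = (\<Sum>k'\<le>d. if k' = k then \<Sum>j'\<le>d - k.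
      if d - k - j' = i \<and> j' = j then coeff3 f (d - k - j') j' k else 0 else 0)"
    by (intro sum.cong refl) auto
  also have "(\<Sum>j'\<le>d - k. if d - k - j' = i \<and> j' = j then coeff3 f (d - k - j') j' k else 0) =
      (\<Sum>j'\<le>d - k. if j' = j then if d - k - j = i then coeff3 f i j k else 0 else 0)"
    by (rule sum.cong) auto
  also have "(\<Sum>k'\<le>d. if k' = k then \<dots> else 0) = (if i + j + k = d then coeff3 f i j k else 0)"
    by (auto simp: sum.delta)
  finally show ?thesis .
qed

definition total_degrees :: "'k::field poly3 \<Rightarrow> nat set" where
  "total_degrees f = {i + j + k | i j k. coeff3 f i j k \<noteq> 0}"

lemma total_degreesI: "coeff3 f i j k \<noteq> 0 \<Longrightarrow> i + j + k \<in> total_degrees f"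
  unfolding total_degrees_def by blast

lemma finite_total_degrees: "finite (total_degrees f)"
proof -
  let ?S = "SIGMA k:{..Polynomial.degree f}. SIGMA j:{..Polynomial.degree (Polynomial.coeff f k)}.
    {..Polynomial.degree (Polynomial.coeff (Polynomial.coeff f k) j)}"
  have "total_degrees f \<subseteq> (\<lambda>(k, j, i). i + j + k) ` ?S"
  proof
    fix d assume "d \<in> total_degrees f"
    then obtain i j k where d: "d = i + j + k" and c: "coeff3 f i j k \<noteq> 0"
      unfolding total_degrees_def by blast
    have "(k, j, i) \<in> ?S" using c unfolding coeff3_def
      by (auto intro!: le_degree)
    with d show "d \<in> (\<lambda>(k, j, i). i + j + k) ` ?S" by force
  qed
  moreover have "finite ?S" by (intro finite_SigmaI) auto
  ultimately show ?thesis using finite_surj by blast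
qed

lemma total_degrees_nonempty: "f \<noteq> 0 \<Longrightarrow> total_degrees f \<noteq> {}"
  using nonzero_coeff3 unfolding total_degrees_def by blast

lemma homogeneous_iff_total_degrees: "homogeneous d f \<longleftrightarrow> total_degrees f \<subseteq> {d}"
  unfolding homogeneous_def total_degrees_def by blast

lemma homog_part_nonzero:
  assumes "d \<in> total_degrees f"
  shows "homog_part d f \<noteq> 0"
proof
  assume 0: "homog_part d f = 0"
  obtain i j k where ijk: "d = i + j + k" "coeff3 f i j k \<noteq> 0"
    using assms unfolding total_degrees_def by blast
  have "coeff3 (homog_part d f) i j k = coeff3 f i j k" by (simp add: coeff3_homog_part ijk(1))
  with 0 ijk(2) show False by simp
qed

lemma homogeneous_homog_part: "homogeneous d (homog_part d f)"
  by (auto simp: homogeneous_def coeff3_homog_part split: if_splits)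

text \<open>The degree \<open>D + D'\<close> part of a product, when \<open>D + D'\<close> is attained only once;
  applied to the largest and to the least total degrees of the factors.\<close>
lemma extremal_degree_mult:
  assumes D: "D \<in> total_degrees g" "D' \<in> total_degrees h"
    and extremal: "\<And>a b. a \<in> total_degrees g \<Longrightarrow> b \<in> total_degrees h \<Longrightarrow> a + b = D + D' \<Longrightarrow> a = D \<and> b = D'"
  shows "D + D' \<in> total_degrees (g * h)"
proof -
  let ?G = "homog_part D g" and ?H = "homog_part D' h"
  have "?G * ?H \<noteq> 0" using homog_part_nonzero[OF D(1)] homog_part_nonzero[OF D(2)] by simp
  then obtain i j k where ijk: "coeff3 (?G * ?H) i j k \<noteq> 0" using nonzero_coeff3 by blast
  have "homogeneous (D + D') (?G * ?H)"
    by (intro homogeneous_mult homogeneous_homog_part)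
  from homogeneousD[OF this ijk] have sum: "i + j + k = D + D'" .
  \<comment> \<open>By extremality only terms with factors of degrees \<open>D\<close> and
    \<open>D'\<close> contribute in degree \<open>D + D'\<close>, and passing to homogeneous parts
    leaves these terms unchanged.\<close>
  have "coeff3 (?G * ?H) i j k = coeff3 (g * h) i j k"
    unfolding coeff3_mult
  proof (rule sum.cong[OF refl], rule sum.cong[OF refl], rule sum.cong[OF refl])
    fix k1 j1 i1 assume le: "k1 \<in> {..k}" "j1 \<in> {..j}" "i1 \<in> {..i}"
    let ?a = "i1 + j1 + k1" and ?b = "i - i1 + (j - j1) + (k - k1)"
    have ab: "?a + ?b = D + D'" using le sum unfolding atMost_iff by linarith
    have 1: "?a \<in> total_degrees g" if "coeff3 g i1 j1 k1 \<noteq> 0"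
      using that by (rule total_degreesI)
    have 2: "?b \<in> total_degrees h" if "coeff3 h (i - i1) (j - j1) (k - k1) \<noteq> 0"
      using that by (rule total_degreesI)
    show "coeff3 ?G i1 j1 k1 * coeff3 ?H (i - i1) (j - j1) (k - k1) =
          coeff3 g i1 j1 k1 * coeff3 h (i - i1) (j - j1) (k - k1)"
    proof (cases "coeff3 g i1 j1 k1 = 0 \<or> coeff3 h (i - i1) (j - j1) (k - k1) = 0")
      case False
      hence "?a = D" "?b = D'" using extremal[OF 1 2 ab] by blast+
      thus ?thesis by (simp add: coeff3_homog_part)
    qed (auto simp: coeff3_homog_part)
  qed
  with ijk have "coeff3 (g * h) i j k \<noteq> 0" by simp
  from total_degreesI[OF this] show ?thesis by (simp only: sum)
qed

text \<open>The largest total degrees of the factors add up, and so do the least ones. Both sums are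
  \<open>d\<close>, so largest and least degree agree in each factor.\<close>

lemma homogeneous_factors:
  assumes hom: "homogeneous d (g * h)" and nz: "g * h \<noteq> 0"
  obtains a b where "homogeneous a g" "homogeneous b h" "a + b = d"
proof -
  have nz': "g \<noteq> 0" "h \<noteq> 0" using nz by auto
  note fin = finite_total_degrees[of g] finite_total_degrees[of h]
  note ne = total_degrees_nonempty[OF nz'(1)] total_degrees_nonempty[OF nz'(2)]
  let ?G = "total_degrees g" and ?H = "total_degrees h"
  have "Max ?G + Max ?H \<in> total_degrees (g * h)"
  proof (rule extremal_degree_mult)
    fix a b assume "a \<in> ?G" "b \<in> ?H" "a + b = Max ?G + Max ?H"
    moreover from this have "a \<le> Max ?G" "b \<le> Max ?H" using fin by auto
    ultimately show "a = Max ?G \<and> b = Max ?H" by linarith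
  qed (use fin ne in auto)
  moreover have "Min ?G + Min ?H \<in> total_degrees (g * h)"
  proof (rule extremal_degree_mult)
    fix a b assume "a \<in> ?G" "b \<in> ?H" "a + b = Min ?G + Min ?H"
    moreover from this have "a \<ge> Min ?G" "b \<ge> Min ?H" using fin by auto
    ultimately show "a = Min ?G \<and> b = Min ?H" by linarith
  qed (use fin ne in auto)
  ultimately have sums: "Max ?G + Max ?H = d" "Min ?G + Min ?H = d"
    using hom unfolding homogeneous_iff_total_degrees by auto
  have le: "Min ?G \<le> Max ?G" "Min ?H \<le> Max ?H" using fin ne by (auto intro: Min_le)
  have bounds: "Min ?G \<le> a \<and> a \<le> Max ?G" if "a \<in> ?G" for a using that fin by auto
  have bounds': "Min ?H \<le> a \<and> a \<le> Max ?H" if "a \<in> ?H" for a using that fin by auto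
  have "homogeneous (Max ?G) g" "homogeneous (Max ?H) h"
    using sums le bounds bounds' unfolding homogeneous_iff_total_degrees by force+
  with sums(1) that show ?thesis by blast
qed

lemma homogeneous_dvd:
  assumes "homogeneous d f" "f \<noteq> 0" "g dvd f"
  obtains e where "homogeneous e g" "e \<le> d"
  using assms homogeneous_factors[of d g] by (metis dvdE le_add1)

lemma homogeneous_cofactor:
  assumes "homogeneous d (g * h)" "g * h \<noteq> 0" "homogeneous a g"
  shows "a \<le> d" "homogeneous (d - a) h"
proof -
  obtain a' b where ab: "homogeneous a' g" "homogeneous b h" "a' + b = d"
    using homogeneous_factors[OF assms(1,2)] by blast
  moreover from this have "a' = a" using homogeneous_unique assms by (metis mult_eq_0_iff)
  ultimately show "a \<le> d" "homogeneous (d - a) h" by auto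
qed

lemma homogeneous_unit: "homogeneous d u \<Longrightarrow> u dvd 1 \<Longrightarrow> d = 0"
proof -
  assume u: "homogeneous d u" "u dvd 1"
  then obtain k where "u * k = 1" by (metis dvdE)
  thus "d = 0" using homogeneous_cofactor(1)[of 0 u k d] u(1) by simp
qed

lemma const_of_homogeneous_0:
  assumes "homogeneous 0 (f :: 'k::field poly3)"
  shows "f = [:[:[:coeff3 f 0 0 0:]:]:]"
proof (rule poly3_eqI)
  fix i j k
  have eq: "[:[:[:c:]:]:] = Polynomial.monom (Polynomial.monom (Polynomial.monom c 0) 0) 0" for c :: 'k
    by (simp add: monom_0)
  show "coeff3 f i j k = coeff3 [:[:[:coeff3 f 0 0 0:]:]:] i j k"
    unfolding eq coeff3_monom using assms by (auto simp: homogeneous_def)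
qed

lemma homogeneous_0_unit:
  assumes "homogeneous 0 (f :: 'k::field poly3)" "f \<noteq> 0"
  shows "f dvd 1"
proof -
  obtain c where c: "f = [:[:[:c:]:]:]" using const_of_homogeneous_0[OF assms(1)] by (rule that)
  with assms(2) have "c \<noteq> 0" by auto
  hence "f * [:[:[:inverse c:]:]:] = 1" unfolding c by (simp flip: one_pCons)
  thus ?thesis by (metis dvdI)
qed

lemma homogeneous_const: "homogeneous 0 [:[:[:c:]:]:]"
  using coeff3_monom[of c 0 0 0] by (auto simp: homogeneous_def monom_0 split: if_splits)

lemma homogeneous_vars: "homogeneous 1 vX" "homogeneous 1 vY" "homogeneous 1 vZ"
proof -
  have v: "vX = Polynomial.monom (Polynomial.monom (Polynomial.monom 1 1) 0) 0"
    "vY = Polynomial.monom (Polynomial.monom (Polynomial.monom 1 0) 1) 0"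
    "vZ = Polynomial.monom (Polynomial.monom (Polynomial.monom 1 0) 0) 1"
    by (simp_all add: vX_def vY_def vZ_def monom_0 monom_Suc flip: one_pCons)
  show "homogeneous 1 vX" "homogeneous 1 vY" "homogeneous 1 vZ"
    unfolding v homogeneous_def coeff3_monom by simp_all
qed

lemma vars_nonzero: "vX \<noteq> 0" "vY \<noteq> 0" "vZ \<noteq> 0"
  by (auto simp: vX_def vY_def vZ_def)


section \<open>Ideals and points of the projective plane\<close>

lemma ring_of_type_algebra_sel [simp]:
  "carrier ring_of_type_algebra = UNIV" "monoid.mult ring_of_type_algebra = (*)"
  "\<one>\<^bsub>ring_of_type_algebra\<^esub> = 1" "\<zero>\<^bsub>ring_of_type_algebra\<^esub> = 0"
  "ring.add ring_of_type_algebra = (+)"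
  by (auto simp: ring_of_type_algebra_def)

lemma ideal_ringI:
  fixes I :: "'a::comm_ring_1 set"
  assumes "0 \<in> I" "\<And>a b. a \<in> I \<Longrightarrow> b \<in> I \<Longrightarrow> a + b \<in> I" "\<And>a b. b \<in> I \<Longrightarrow> a * b \<in> I"
  shows "ideal I ring_of_type_algebra"
proof (rule idealI)
  show "ring (ring_of_type_algebra :: 'a ring)" by (rule ring_from_type_algebra)
  then interpret ring "ring_of_type_algebra :: 'a ring" .
  show "subgroup I (add_monoid ring_of_type_algebra)"
  proof (rule add.subgroupI)
    fix a assume a: "a \<in> I"
    have "\<ominus>\<^bsub>ring_of_type_algebra\<^esub> a = - a"
      by (rule minus_equality) auto
    with assms(3)[OF a, of "- 1"] show "\<ominus>\<^bsub>ring_of_type_algebra\<^esub> a \<in> I" by simp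
  qed (use assms in auto)
qed (use assms(3) in \<open>auto simp: mult.commute\<close>)

lemma ideal_ringD:
  fixes I :: "'a::comm_ring_1 set"
  assumes "ideal I ring_of_type_algebra"
  shows "0 \<in> I" "a \<in> I \<Longrightarrow> b \<in> I \<Longrightarrow> a + b \<in> I" "b \<in> I \<Longrightarrow> c * b \<in> I" "b \<in> I \<Longrightarrow> b * c \<in> I"
    "a \<in> I \<Longrightarrow> b \<in> I \<Longrightarrow> a - b \<in> I"
proof -
  interpret ideal I "ring_of_type_algebra :: 'a ring" by fact
  show 0: "0 \<in> I" using additive_subgroup.zero_closed[OF is_additive_subgroup] by simp
  show 1: "a \<in> I \<Longrightarrow> b \<in> I \<Longrightarrow> a + b \<in> I" for a b using additive_subgroup.a_closed[OF is_additive_subgroup] by simp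
  show 2: "b \<in> I \<Longrightarrow> c * b \<in> I" for b c using I_l_closed[of b c] by simp
  show "b \<in> I \<Longrightarrow> b * c \<in> I" using 2[of b c] by (simp add: mult.commute)
  show "a \<in> I \<Longrightarrow> b \<in> I \<Longrightarrow> a - b \<in> I" using 1[of a "- b"] 2[of b "- 1"] by simp
qed

lemma ideal_ring_sum:
  fixes I :: "'a::comm_ring_1 set"
  assumes "ideal I ring_of_type_algebra" "\<And>a. a \<in> A \<Longrightarrow> f a \<in> I"
  shows "(\<Sum>a\<in>A. f a) \<in> I"
  using assms(2) by (induction A rule: infinite_finite_induct)
    (auto intro: ideal_ringD[OF assms(1)])

lemma ideal_ideal_of: "ideal (ideal_of A) ring_of_type_algebra"
proof -
  interpret ring "ring_of_type_algebra :: 'a poly3 ring" by (rule ring_from_type_algebra)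
  show ?thesis unfolding ideal_of_def by (rule genideal_ideal) auto
qed

lemma ideal_of_superset: "A \<subseteq> ideal_of A"
proof -
  interpret ring "ring_of_type_algebra :: 'a poly3 ring" by (rule ring_from_type_algebra)
  show ?thesis unfolding ideal_of_def by (rule genideal_self) auto
qed

lemma ideal_of_minimal: "ideal I ring_of_type_algebra \<Longrightarrow> A \<subseteq> I \<Longrightarrow> ideal_of A \<subseteq> I"
proof -
  interpret ring "ring_of_type_algebra :: 'a poly3 ring" by (rule ring_from_type_algebra)
  show "ideal I ring_of_type_algebra \<Longrightarrow> A \<subseteq> I \<Longrightarrow> ideal_of A \<subseteq> I"
    unfolding ideal_of_def by (rule genideal_minimal)
qed

lemma ideal_of_singleton: "ideal_of {p} = {f. p dvd f}"
proof
  show "ideal_of {p} \<subseteq> {f. p dvd f}"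
    by (intro ideal_of_minimal ideal_ringI) auto
  show "{f. p dvd f} \<subseteq> ideal_of {p}"
    using ideal_ringD(4)[OF ideal_ideal_of] ideal_of_superset[of "{p}"] by (auto elim!: dvdE)
qed

lemma primeideal_ringI:
  fixes I :: "'a::comm_ring_1 set"
  assumes "ideal I ring_of_type_algebra" "1 \<notin> I" "\<And>a b. a * b \<in> I \<Longrightarrow> a \<in> I \<or> b \<in> I"
  shows "primeideal I ring_of_type_algebra"
  using assms by (intro primeidealI) auto

lemma ProjD:
  assumes "P \<in> Proj"
  shows "ideal P ring_of_type_algebra" "1 \<notin> P" "0 \<in> P" "a * b \<in> P \<longleftrightarrow> a \<in> P \<or> b \<in> P"
    "homogeneous_ideal P" "\<not> {vX, vY, vZ} \<subseteq> P"
proof -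
  have P: "primeideal P ring_of_type_algebra" using assms by (simp add: Proj_def)
  then interpret primeideal P ring_of_type_algebra .
  show I: "ideal P ring_of_type_algebra" by (rule ideal_axioms)
  show "0 \<in> P" by (rule ideal_ringD(1)[OF I])
  show "1 \<notin> P" using I_notcarr ideal_ringD(3)[OF I, of 1] by auto
  show "a * b \<in> P \<longleftrightarrow> a \<in> P \<or> b \<in> P" using I_prime[of a b] ideal_ringD(3,4)[OF I] by auto
qed (use assms in \<open>auto simp: Proj_def\<close>)

lemma Proj_power: "P \<in> Proj \<Longrightarrow> a ^ n \<in> P \<longleftrightarrow> n > 0 \<and> a \<in> P"
  by (induction n) (auto simp: ProjD)

lemma Proj_var:
  assumes "P \<in> Proj"
  obtains t where "t \<notin> P" "homogeneous 1 t"
  using ProjD(6)[OF assms] homogeneous_vars by blast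

text \<open>A multiple \<open>p * q\<close> is the sum of the forms
  \<open>p * homog_part n q\<close>, which are again multiples of \<open>p\<close>.\<close>

lemma homogeneous_idealI:
  assumes "ideal I ring_of_type_algebra" "I = {f. p dvd f}" "homogeneous d p"
  shows "homogeneous_ideal I"
  unfolding homogeneous_ideal_def
proof (intro conjI ballI assms(1))
  fix f assume "f \<in> I"
  then obtain q where q: "f = p * q" using assms(2) by (auto elim!: dvdE)
  \<comment> \<open>\<open>Max\<close> says nothing about the empty set of degrees of
    \<open>q = 0\<close>, hence the case distinction.\<close>
  define N where "N = (if q = 0 then 0 else Max (total_degrees q))"
  have "coeff3 q i j k = 0 \<or> i + j + k \<le> N" for i j k
    using finite_total_degrees[of q] by (auto simp: N_def total_degrees_def intro!: Max_ge)
  hence "q = (\<Sum>n\<le>N. homog_part n q)"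
    by (intro poly3_eqI) (auto simp: coeff3_sum coeff3_homog_part sum.delta')
  hence "f = (\<Sum>n\<le>N. p * homog_part n q)" by (simp add: q sum_distrib_left[symmetric])
  also have "\<dots> = sum_list (map (\<lambda>n. p * homog_part n q) [0..<Suc N])"
    by (simp add: sum_list_distinct_conv_sum_set atLeast0LessThan lessThan_Suc_atMost del: upt_Suc)
  finally show "\<exists>gs. set gs \<subseteq> I \<and> (\<forall>g\<in>set gs. \<exists>d. homogeneous d g) \<and> f = sum_list gs"
    using assms(2) homogeneous_mult[OF assms(3) homogeneous_homog_part]
    by (intro exI[of _ "map (\<lambda>n. p * homog_part n q) [0..<Suc N]"]) (auto simp del: upt_Suc)
qed

text \<open>A common divisor of degree 1 would make \<open>vX\<close> and \<open>vY\<close>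
  proportional. The lemma ensures that a principal prime ideal does not contain all three
  variables.\<close>

lemma vars_dvd_unit:
  assumes "(p::'k::field poly3) dvd vX" "p dvd vY"
  shows "p dvd 1"
proof -
  obtain e where e: "homogeneous e p" "e \<le> 1"
    using homogeneous_dvd[OF homogeneous_vars(1) vars_nonzero(1) assms(1)] by blast
  obtain a b where ab: "vX = p * a" "vY = p * b" using assms by (metis dvdE)
  have nz: "p * a \<noteq> 0" "p * b \<noteq> 0" unfolding ab[symmetric] by (rule vars_nonzero)+
  hence "p \<noteq> 0" by auto
  show ?thesis
  proof (cases "e = 0")
    case True
    with e(1) have "homogeneous 0 p" by simp
    thus ?thesis using \<open>p \<noteq> 0\<close> by (rule homogeneous_0_unit)
  next
    case False
    with e(2) have "e = 1" by simp
    with e(1) have p1: "homogeneous 1 p" by simp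
    have "homogeneous 1 (p * a)" "homogeneous 1 (p * b)" unfolding ab[symmetric] by (rule homogeneous_vars)+
    note homogeneous_cofactor(2)[OF this(1) nz(1) p1] homogeneous_cofactor(2)[OF this(2) nz(2) p1]
    hence "homogeneous 0 a" "homogeneous 0 b" by simp_all
    note hom0 = this
    obtain c where c: "a = [:[:[:c:]:]:]" using const_of_homogeneous_0[OF hom0(1)] by (rule that)
    obtain d where d: "b = [:[:[:d:]:]:]" using const_of_homogeneous_0[OF hom0(2)] by (rule that)
    have "b * vX = a * vY" unfolding ab by (simp add: ac_simps)
    hence "d = 0" unfolding c d by (simp add: vX_def vY_def)
    hence "b = 0" using d by simp
    with nz(2) show ?thesis by simp
  qed
qed

lemma generic_point_Proj: "generic_point \<in> Proj"
proof -
  have I: "ideal {0::'a poly3} ring_of_type_algebra" by (rule ideal_ringI) auto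
  moreover have "homogeneous_ideal {0::'a poly3}"
    by (rule homogeneous_idealI[OF I, of 0 0]) auto
  moreover have "primeideal {0::'a poly3} ring_of_type_algebra"
    by (rule primeideal_ringI[OF I]) auto
  ultimately show ?thesis
    using vars_nonzero(1) unfolding Proj_def generic_point_def by blast
qed

section \<open>Curves and valuations\<close>

text \<open>\<open>curve_eq P\<close> is an arbitrarily chosen generator. It divides the homogeneous
  generator that the definition of \<open>curves\<close> provides, so it is itself a form, of
  positive degree because it is not a unit.\<close>

lemma curvesD:
  assumes "P \<in> curves"
  shows "P \<in> Proj" "P = {f. curve_eq P dvd f}" "curve_eq P \<noteq> 0" "prime_elem (curve_eq P)"
    "homogeneous (curve_degree P) (curve_eq P)" "curve_degree P > 0"
proof -
  obtain p d where pd: "P \<in> Proj" "P \<noteq> {0}" "homogeneous d p" "P = ideal_of {p}"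
    using assms unfolding curves_def by blast
  show "P \<in> Proj" by fact
  have "P = ideal_of {curve_eq P}" unfolding curve_eq_def by (rule someI) (rule pd(4))
  thus P: "P = {f. curve_eq P dvd f}" unfolding ideal_of_singleton .
  show nz: "curve_eq P \<noteq> 0"
  proof
    assume "curve_eq P = 0"
    with P have "P = {0}" by auto
    with pd(2) show False ..
  qed
  show prime: "prime_elem (curve_eq P)"
  proof (rule prime_elemI)
    show "\<not> curve_eq P dvd 1" using ProjD(2)[OF pd(1)] P by blast
    show "curve_eq P dvd a \<or> curve_eq P dvd b" if "curve_eq P dvd a * b" for a b
      using ProjD(4)[OF pd(1), of a b] P that by blast
  qed (rule nz)
  have "p \<in> P" using pd(4) ideal_of_superset by blast
  hence dvd: "curve_eq P dvd p" using P by blast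
  have "p \<noteq> 0" using pd(2,4) unfolding ideal_of_singleton by auto
  then obtain e where e: "homogeneous e (curve_eq P)" using homogeneous_dvd[OF pd(3) _ dvd] by blast
  have deg: "curve_degree P = e"
    unfolding curve_degree_def using e nz homogeneous_unique by (intro the_equality) blast+
  thus "homogeneous (curve_degree P) (curve_eq P)" using e by simp
  show "curve_degree P > 0"
  proof (rule ccontr)
    assume "\<not> curve_degree P > 0"
    hence "homogeneous 0 (curve_eq P)" using deg e by simp
    hence "curve_eq P dvd 1" using nz by (rule homogeneous_0_unit)
    thus False using prime by (auto simp: prime_elem_def)
  qed
qed

lemma curve_mem_iff: "P \<in> curves \<Longrightarrow> f \<in> P \<longleftrightarrow> curve_eq P dvd f"
  using curvesD(2) by blast

lemma curve_memE:
  assumes "P \<in> curves" "f \<in> P"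
  obtains b where "f = curve_eq P * b"
  using curve_mem_iff[OF assms(1)] assms(2) by (metis dvdE)

lemma curvesI:
  assumes p: "prime_elem p" "homogeneous d (p :: 'k::field poly3)"
  shows "{f. p dvd f} \<in> curves"
proof -
  let ?P = "{f. p dvd f}"
  have ideal: "ideal ?P ring_of_type_algebra"
    unfolding ideal_of_singleton[symmetric] by (rule ideal_ideal_of)
  have n1: "\<not> p dvd 1" and nz: "p \<noteq> 0" using p(1) by (auto simp: prime_elem_def)
  have "primeideal ?P ring_of_type_algebra"
    using p(1) n1 by (intro primeideal_ringI[OF ideal]) (simp_all add: prime_elem_dvd_mult_iff)
  moreover have "homogeneous_ideal ?P" by (rule homogeneous_idealI[OF ideal refl p(2)])
  moreover have "\<not> {vX, vY, vZ} \<subseteq> ?P" using n1 vars_dvd_unit[of p] by blast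
  ultimately have Proj: "?P \<in> Proj" unfolding Proj_def by blast
  have "p \<in> ?P" by simp
  hence "?P \<noteq> {0}" using nz by (metis singletonD)
  with Proj show ?thesis unfolding curves_def ideal_of_singleton
    by (intro CollectI conjI exI[of _ p] exI[of _ d] p(2) refl)
qed

text \<open>The relation under the definite description in \<open>valuation\<close>, so that
  existence and uniqueness of the order can be treated separately.\<close>

definition has_val :: "'k::field point \<Rightarrow> 'k poly3 fract \<Rightarrow> int \<Rightarrow> bool" where
  "has_val P h v \<longleftrightarrow> (\<exists>a b. a \<notin> P \<and> b \<notin> P \<and> h = power_int (Fract (curve_eq P) 1) v * Fract a b)"

lemma Fract_nonzero: "a \<noteq> 0 \<Longrightarrow> b \<noteq> 0 \<Longrightarrow> Fract a b \<noteq> 0"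
  by (simp add: Zero_fract_def eq_fract)

lemma Fract_1_power: "Fract (a :: 'a::idom) 1 ^ n = Fract (a ^ n) 1"
  by (induction n) (auto simp: One_fract_def)

text \<open>For v > w, clearing denominators gives an equation between \<open>c * b\<close>, with
  both factors outside the prime ideal \<open>P\<close>, and a multiple of
  \<open>curve_eq P\<close>.\<close>

lemma has_val_le:
  assumes P: "P \<in> curves" and "has_val P h v" "has_val P h w"
  shows "v \<le> w"
proof (rule ccontr)
  assume "\<not> v \<le> w"
  define n where "n = nat (v - w)"
  have n: "v = w + int n" "n > 0" using \<open>\<not> v \<le> w\<close> by (auto simp: n_def)
  let ?p = "curve_eq P" and ?t = "Fract (curve_eq P) 1"
  obtain a b where ab: "a \<notin> P" "b \<notin> P" "h = power_int ?t v * Fract a b"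
    using assms(2) unfolding has_val_def by blast
  obtain c d where cd: "c \<notin> P" "d \<notin> P" "h = power_int ?t w * Fract c d"
    using assms(3) unfolding has_val_def by blast
  have Proj: "P \<in> Proj" using P by (rule curvesD)
  have nz: "b \<noteq> 0" "d \<noteq> 0" using ab(2) cd(2) ProjD(3)[OF Proj] by auto
  have t: "?t \<noteq> 0" using curvesD(3)[OF P] by (intro Fract_nonzero) auto
  have "power_int ?t w * (?t ^ n * Fract a b) = power_int ?t w * Fract c d"
    using ab(3) cd(3) n(1) t by (simp add: power_int_add power_int_of_nat mult.assoc)
  hence "?t ^ n * Fract a b = Fract c d" using t by simp
  hence "Fract (?p ^ n * a) b = Fract c d" by (simp add: Fract_1_power)
  hence "?p ^ n * a * d = c * b" using nz by (simp add: eq_fract)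
  moreover have "?p dvd ?p ^ n * a * d" using n(2) by (simp add: dvd_power mult.assoc)
  ultimately have "c * b \<in> P" using curve_mem_iff[OF P] by simp
  thus False using ProjD(4)[OF Proj] ab cd by blast
qed

lemma has_val_valuation:
  assumes "P \<in> curves" "has_val P h v"
  shows "valuation P h = v"
  unfolding valuation_def has_val_def[symmetric]
  using assms(2)
proof (rule the_equality)
  show "w = v" if "has_val P h w" for w
    using has_val_le[OF assms(1)] that assms(2) by (intro order.antisym)
qed

lemma has_val_mult:
  assumes P: "P \<in> curves" and "has_val P g v" "has_val P h w"
  shows "has_val P (g * h) (v + w)"
proof -
  let ?t = "Fract (curve_eq P) 1"
  obtain a b where ab: "a \<notin> P" "b \<notin> P" "g = power_int ?t v * Fract a b"
    using assms(2) unfolding has_val_def by blast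
  obtain c d where cd: "c \<notin> P" "d \<notin> P" "h = power_int ?t w * Fract c d"
    using assms(3) unfolding has_val_def by blast
  have "?t \<noteq> 0" using curvesD(3)[OF P] by (intro Fract_nonzero) auto
  hence "g * h = power_int ?t (v + w) * Fract (a * c) (b * d)"
    using ab(3) cd(3) by (simp add: power_int_add flip: mult_fract)
  moreover have "a * c \<notin> P" "b * d \<notin> P" using ab cd ProjD(4)[OF curvesD(1)[OF P]] by blast+
  ultimately show ?thesis unfolding has_val_def by blast
qed

lemma has_val_inverse:
  assumes P: "P \<in> curves" and "has_val P h v"
  shows "has_val P (inverse h) (- v)"
proof -
  let ?t = "Fract (curve_eq P) 1"
  obtain a b where ab: "a \<notin> P" "b \<notin> P" "h = power_int ?t v * Fract a b"
    using assms(2) unfolding has_val_def by blast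
  have "inverse h = power_int ?t (- v) * Fract b a"
    using ab(3) by (simp add: power_int_minus inverse_mult_distrib inverse_fract)
  with ab show ?thesis unfolding has_val_def by blast
qed

text \<open>Factors \<open>curve_eq P\<close> are split off one at a time. This stops because each
  of them lowers the degree by \<open>curve_degree P > 0\<close>.\<close>

lemma has_val_homogeneous:
  assumes P: "P \<in> curves" and a: "homogeneous m a" "a \<noteq> 0"
  obtains k a' m' where "a = curve_eq P ^ k * a'" "a' \<notin> P" "homogeneous m' a'"
    "m = k * curve_degree P + m'"
proof -
  have "\<exists>k a' m'. a = curve_eq P ^ k * a' \<and> a' \<notin> P \<and> homogeneous m' a' \<and> m = k * curve_degree P + m'"
    using a
  proof (induction m arbitrary: a rule: less_induct)
    case (less m)
    let ?p = "curve_eq P"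
    show ?case
    proof (cases "a \<in> P")
      case False
      thus ?thesis using less.prems by (intro exI[of _ 0] exI[of _ a] exI[of _ m]) auto
    next
      case True
      then obtain b where b: "a = ?p * b" using curve_memE[OF P] by blast
      note cof = homogeneous_cofactor[OF less.prems[unfolded b] curvesD(5)[OF P]]
      have "m - curve_degree P < m" using cof(1) curvesD(6)[OF P] by linarith
      moreover have "b \<noteq> 0" using b less.prems by auto
      ultimately obtain k a' m' where IH: "b = ?p ^ k * a'" "a' \<notin> P" "homogeneous m' a'"
        "m - curve_degree P = k * curve_degree P + m'"
        using less.IH[OF _ cof(2)] by blast
      show ?thesis
        using IH b cof(1) by (intro exI[of _ "Suc k"] exI[of _ a'] exI[of _ m']) (auto simp: mult.assoc)
    qed
  qed
  with that show ?thesis by blast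
qed

lemma twist_stalk_obtain:
  assumes "z \<in> twist_stalk d P"
  obtains a b m n where "homogeneous m a" "homogeneous n b" "b \<notin> P" "int m = int n + d" "z = Fract a b"
proof -
  from assms obtain a b m n where "homogeneous m a" "homogeneous n b" "b \<notin> P" "int m - int n = d" "z = Fract a b"
    unfolding twist_stalk_def by blast
  thus ?thesis by (intro that[of m a n b]) auto
qed

lemma twist_stalkI:
  "homogeneous m a \<Longrightarrow> homogeneous n b \<Longrightarrow> b \<notin> P \<Longrightarrow> int m = int n + d \<Longrightarrow> Fract a b \<in> twist_stalk d P"
  unfolding twist_stalk_def by (simp, intro exI[of _ a] exI[of _ b] exI conjI refl, auto)

lemma twist_stalk_generic: "P \<in> Proj \<Longrightarrow> z \<in> twist_stalk d P \<Longrightarrow> z \<in> twist_stalk d generic_point"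
  using ProjD(3)[of P] by (elim twist_stalk_obtain) (auto intro!: twist_stalkI simp: generic_point_def)

lemma has_val_twist_stalk:
  assumes P: "P \<in> curves" and z: "z \<in> twist_stalk d generic_point" "z \<noteq> 0"
  obtains a b m n k l where "has_val P z (int k - int l)" "homogeneous m a" "homogeneous n b"
    "a \<notin> P" "b \<notin> P" "int m + int (k * curve_degree P) = int n + int (l * curve_degree P) + d"
    "z = Fract (curve_eq P ^ k * a) (curve_eq P ^ l * b)"
proof -
  obtain a b m n where ab: "homogeneous m a" "homogeneous n b" "b \<noteq> 0" "int m = int n + d" "z = Fract a b"
    using z(1) by (elim twist_stalk_obtain) (auto simp: generic_point_def)
  have "a \<noteq> 0" using z(2) ab(5) by (auto simp: Zero_fract_def eq_fract)
  obtain k a' m' where a: "a = curve_eq P ^ k * a'" "a' \<notin> P" "homogeneous m' a'" "m = k * curve_degree P + m'"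
    using has_val_homogeneous[OF P ab(1) \<open>a \<noteq> 0\<close>] by blast
  obtain l b' n' where b: "b = curve_eq P ^ l * b'" "b' \<notin> P" "homogeneous n' b'" "n = l * curve_degree P + n'"
    using has_val_homogeneous[OF P ab(2,3)] by blast
  have t: "Fract (curve_eq P) 1 \<noteq> 0" using curvesD(3)[OF P] by (intro Fract_nonzero) auto
  have "Fract (curve_eq P ^ k * a') (curve_eq P ^ l * b') =
      Fract (curve_eq P ^ k) 1 * inverse (Fract (curve_eq P ^ l) 1) * Fract a' b'"
    by (simp add: inverse_fract)
  also have "\<dots> = power_int (Fract (curve_eq P) 1) (int k - int l) * Fract a' b'"
    using t by (simp add: power_int_diff power_int_of_nat Fract_1_power[symmetric] divide_inverse)
  finally have "has_val P z (int k - int l)"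
    using a(2) b(2) ab(5) a(1) b(1) unfolding has_val_def by blast
  moreover have "int m' + int (k * curve_degree P) = int n' + int (l * curve_degree P) + d"
    using ab(4) a(4) b(4) by simp
  ultimately show ?thesis
    using a(2,3) b(2,3) ab(5)[unfolded a(1) b(1)] by (intro that)
qed

lemma has_val_valuation_twist:
  assumes "P \<in> curves" "z \<in> twist_stalk d generic_point" "z \<noteq> 0"
  shows "has_val P z (valuation P z)"
proof (rule has_val_twist_stalk[OF assms])
  fix k l
  assume "has_val P z (int k - int l)"
  with has_val_valuation[OF assms(1) this] show ?thesis by simp
qed

lemma valuation_mult:
  assumes "P \<in> curves" "y \<in> twist_stalk d generic_point" "y \<noteq> 0" "z \<in> twist_stalk e generic_point" "z \<noteq> 0"
  shows "valuation P (y * z) = valuation P y + valuation P z"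
  using assms by (intro has_val_valuation has_val_mult has_val_valuation_twist)

lemma valuation_inverse:
  assumes "P \<in> curves" "z \<in> twist_stalk d generic_point" "z \<noteq> 0"
  shows "valuation P (inverse z) = - valuation P z"
  using assms by (intro has_val_valuation has_val_inverse has_val_valuation_twist)

text \<open>The local ring at a curve is a discrete valuation ring, and the same valuation describes
  its twists: if the order is nonnegative, the power of \<open>curve_eq P\<close> in the denominator
  cancels and leaves a denominator outside \<open>P\<close>.\<close>

lemma twist_stalk_iff_valuation:
  assumes P: "P \<in> curves" and z: "z \<in> twist_stalk d generic_point" "z \<noteq> 0"
  shows "z \<in> twist_stalk d P \<longleftrightarrow> valuation P z \<ge> 0"
proof
  assume "z \<in> twist_stalk d P"
  then obtain a b m n where ab: "homogeneous m a" "homogeneous n b" "b \<notin> P" "int m = int n + d" "z = Fract a b"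
    by (elim twist_stalk_obtain)
  have "a \<noteq> 0" using z(2) ab(5) by (auto simp: Zero_fract_def eq_fract)
  obtain k a' m' where a: "a = curve_eq P ^ k * a'" "a' \<notin> P" "homogeneous m' a'" "m = k * curve_degree P + m'"
    using has_val_homogeneous[OF P ab(1) \<open>a \<noteq> 0\<close>] by blast
  have "z = power_int (Fract (curve_eq P) 1) (int k) * Fract a' b"
    using ab(5) a(1) by (simp add: power_int_of_nat Fract_1_power)
  hence "has_val P z (int k)" using a(2) ab(3) unfolding has_val_def by blast
  thus "valuation P z \<ge> 0" using has_val_valuation[OF P] by fastforce
next
  assume nn: "valuation P z \<ge> 0"
  obtain a b m n k l where *: "has_val P z (int k - int l)" "homogeneous m a" "homogeneous n b"
    "a \<notin> P" "b \<notin> P" "int m + int (k * curve_degree P) = int n + int (l * curve_degree P) + d"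
    "z = Fract (curve_eq P ^ k * a) (curve_eq P ^ l * b)"
    by (rule has_val_twist_stalk[OF P z]) (rule that)
  have kl: "l \<le> k" using nn has_val_valuation[OF P *(1)] by simp
  have nz: "curve_eq P ^ l \<noteq> 0" "b \<noteq> 0" using curvesD(3)[OF P] *(5) ProjD(3)[OF curvesD(1)[OF P]] by auto
  have "curve_eq P ^ k = curve_eq P ^ l * curve_eq P ^ (k - l)"
    by (simp only: power_add[symmetric] le_add_diff_inverse[OF kl])
  hence "z = Fract (curve_eq P ^ l * (curve_eq P ^ (k - l) * a)) (curve_eq P ^ l * b)"
    using *(7) by (simp only: mult.assoc)
  also have "\<dots> = Fract (curve_eq P ^ (k - l) * a) b" by (rule mult_fract_cancel[OF nz(1)])
  finally have z': "z = Fract (curve_eq P ^ (k - l) * a) b" .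
  have "homogeneous ((k - l) * curve_degree P + m) (curve_eq P ^ (k - l) * a)"
    by (intro homogeneous_mult homogeneous_power curvesD P *)
  thus "z \<in> twist_stalk d P" unfolding z'
  proof (rule twist_stalkI[OF _ *(3,5)])
    have "int ((k - l) * curve_degree P) = int (k * curve_degree P) - int (l * curve_degree P)"
      using kl by (simp add: diff_mult_distrib of_nat_diff)
    thus "int ((k - l) * curve_degree P + m) = int n + d" using *(6) by simp
  qed
qed

section \<open>The degree of the divisor of a homogeneous fraction\<close>

lemma Fract_1_twist_stalk: "P \<in> Proj \<Longrightarrow> homogeneous m a \<Longrightarrow> Fract a 1 \<in> twist_stalk (int m) P"
  by (rule twist_stalkI[of m a 0 1]) (auto simp: ProjD)

lemma valuation_notin:
  assumes "P \<in> curves" "a \<notin> P" "b \<notin> P"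
  shows "valuation P (Fract a b) = 0"
  using assms by (intro has_val_valuation) (auto simp: has_val_def)

text \<open>An irreducible multiple of the nonunit \<open>curve_eq P\<close> is associated to it. So
  distinct curves have no prime element in common.\<close>

lemma curves_eqI:
  assumes "P \<in> curves" "prime_elem p" "p \<in> P"
  shows "P = {f. p dvd f}"
proof -
  obtain u where u: "p = curve_eq P * u" using curve_memE[OF assms(1,3)] .
  have irr: "irreducible p" using assms(2) by (rule prime_elem_imp_irreducible)
  have "\<not> curve_eq P dvd 1" using curvesD(4)[OF assms(1)] unfolding prime_elem_def by simp
  moreover have "curve_eq P dvd 1 \<or> u dvd 1" by (rule comm_semiring_1_class.irreducibleD[OF irr u])
  ultimately have "u dvd 1" by simp
  hence "p dvd f \<longleftrightarrow> curve_eq P dvd f" for f unfolding u by (rule mult_unit_dvd_iff)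
  note dvd_iff = this
  show ?thesis by (rule Set.set_eqI) (simp add: curve_mem_iff[OF assms(1)] dvd_iff)
qed

text \<open>Bezout's theorem for a curve and a general line, in disguise: the degree of a form is
  the sum of the degrees of its prime factors.\<close>
lemma degree_formula_form:
  assumes "homogeneous m a" "a \<noteq> 0"
  shows "finite {P \<in> curves. a \<in> P} \<and> (\<forall>S. finite S \<longrightarrow> S \<subseteq> curves \<longrightarrow> {P \<in> curves. a \<in> P} \<subseteq> S \<longrightarrow>
    (\<Sum>P\<in>S. int (curve_degree P) * valuation P (Fract a 1)) = int m)"
  using assms
proof (induction m arbitrary: a rule: less_induct)
  case (less m)
  show ?case
  proof (cases "m = 0")
    case True
    with less.prems have "a dvd 1" using homogeneous_0_unit by blast
    hence notin: "a \<notin> P" if "P \<in> curves" for P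
      using that ProjD(2)[OF curvesD(1)[OF that]] curve_mem_iff[OF that] by (meson dvd_trans)
    have "valuation P (Fract a 1) = 0" if "P \<in> curves" for P
      using that notin ProjD(2)[OF curvesD(1)[OF that]] by (intro valuation_notin) auto
    hence "(\<Sum>P\<in>S. int (curve_degree P) * valuation P (Fract a 1)) = 0" if "S \<subseteq> curves" for S
      using that by (intro sum.neutral) auto
    moreover have "finite {P \<in> curves. a \<in> P}" using notin by (auto intro: finite_subset[of _ "{}"])
    ultimately show ?thesis using True by simp
  next
    case False
    have "\<not> a dvd 1" using False homogeneous_unit less.prems(1) by blast
    then obtain F where F: "mset_factors F a" using mset_factors_exist less.prems(2) by blast
    then obtain p where "p \<in># F" unfolding mset_factors_def by blast
    with F have irr: "irreducible p" and dvd: "p dvd a"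
      unfolding mset_factors_def by (blast, auto intro: dvd_prod_mset)
    have prime: "prime_elem p" using irr by (simp add: prime_elem_iff_irreducible)
    obtain d where d: "homogeneous d p" using homogeneous_dvd[OF less.prems dvd] by blast
    have p: "p \<noteq> 0" "\<not> p dvd 1" using prime by (auto simp: prime_elem_def)
    have "d > 0" using homogeneous_0_unit[of p] p d by (cases "d = 0") auto
    \<comment> \<open>The curve with equation \<open>p\<close>. The divisor of
      \<open>a = p * b\<close> is \<open>P0\<close>, of degree \<open>d\<close>, plus the divisor of
      \<open>b\<close>, of degree \<open>m - d\<close> by induction.\<close>
    define P0 where "P0 = {f. p dvd f}"
    have P0: "P0 \<in> curves" unfolding P0_def by (rule curvesI[OF prime d])
    obtain b where b: "a = p * b" using dvd by (elim dvdE)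
    have "b \<noteq> 0" using b less.prems by auto
    note cof = homogeneous_cofactor[OF less.prems[unfolded b] d]
    have "m - d < m" using \<open>d > 0\<close> False by simp
    note IH = less.IH[OF this cof(2) \<open>b \<noteq> 0\<close>]
    have in_P0: "P = P0" if "P \<in> curves" "p \<in> P" for P
      unfolding P0_def using curves_eqI[OF that(1) prime that(2)] .
    have "p \<in> P0" by (simp add: P0_def)
    have mem: "{P \<in> curves. a \<in> P} = insert P0 {P \<in> curves. b \<in> P}"
      using in_P0 P0 \<open>p \<in> P0\<close> ProjD(4)[OF curvesD(1)] unfolding b by blast
    have val_p: "valuation P (Fract p 1) = (if P = P0 then 1 else 0)" if P: "P \<in> curves" for P
    proof (cases "P = P0")
      case True
      obtain u where u: "p = curve_eq P * u" using \<open>p \<in> P0\<close> True curve_memE[OF P] by blast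
      have "\<not> curve_eq P dvd 1" using curvesD(4)[OF P] by (auto simp: prime_elem_def)
      hence "u dvd 1" using comm_semiring_1_class.irreducibleD[OF irr u] by blast
      hence "u \<notin> P" using ProjD(2)[OF curvesD(1)[OF P]] curve_mem_iff[OF P] by (meson dvd_trans)
      moreover have "Fract p 1 = power_int (Fract (curve_eq P) 1) 1 * Fract u 1" by (simp add: u)
      ultimately have "has_val P (Fract p 1) 1"
        using ProjD(2)[OF curvesD(1)[OF P]] unfolding has_val_def by blast
      thus ?thesis using True has_val_valuation[OF P] by simp
    next
      case False
      hence "p \<notin> P" using in_P0 P by blast
      thus ?thesis using False ProjD(2)[OF curvesD(1)[OF P]] by (simp add: valuation_notin[OF P])
    qed
    have deg_P0: "curve_degree P0 = d"
    proof -
      obtain u where u: "p = curve_eq P0 * u" using \<open>p \<in> P0\<close> curve_memE[OF P0] by blast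
      have "p dvd curve_eq P0" using curve_mem_iff[OF P0, of "curve_eq P0"] by (simp add: P0_def)
      then obtain e where "homogeneous e p" "e \<le> curve_degree P0"
        using homogeneous_dvd[OF curvesD(5)[OF P0] curvesD(3)[OF P0]] by blast
      moreover from this have "e = d" using homogeneous_unique d p(1) by blast
      moreover have "curve_degree P0 \<le> d"
        using homogeneous_cofactor(1)[of d "curve_eq P0" u "curve_degree P0"] d u p(1) curvesD(5)[OF P0] by simp
      ultimately show ?thesis by simp
    qed
    have "(\<Sum>P\<in>S. int (curve_degree P) * valuation P (Fract a 1)) = int m"
      if S: "finite S" "S \<subseteq> curves" "{P \<in> curves. a \<in> P} \<subseteq> S" for S
    proof -
      have val: "valuation P (Fract a 1) = (if P = P0 then 1 else 0) + valuation P (Fract b 1)" if "P \<in> S" for P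
      proof -
        have P: "P \<in> curves" using that S by blast
        have "Fract a 1 = Fract p 1 * Fract b 1" by (simp add: b)
        thus ?thesis unfolding val_p[OF P, symmetric]
          using p(1) \<open>b \<noteq> 0\<close> by (simp only:) (intro valuation_mult[OF P
            Fract_1_twist_stalk[OF generic_point_Proj d] _ Fract_1_twist_stalk[OF generic_point_Proj cof(2)]] Fract_nonzero, auto)
      qed
      have "(\<Sum>P\<in>S. int (curve_degree P) * valuation P (Fract a 1)) =
          (\<Sum>P\<in>S. (if P = P0 then int d else 0) + int (curve_degree P) * valuation P (Fract b 1))"
        using deg_P0 by (intro sum.cong) (auto simp: val algebra_simps)
      also have "\<dots> = int d + int (m - d)"
        using IH S mem by (simp add: sum.distrib)
      finally show ?thesis using cof(1) by simp
    qed
    moreover have "finite {P \<in> curves. a \<in> P}" unfolding mem using IH by simp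
    ultimately show ?thesis by blast
  qed
qed

text \<open>The quantification over all finite supersets \<open>S\<close> of the support lets
  several divisors be summed over one common set of curves.\<close>

lemma degree_formula:
  assumes z: "z \<in> twist_stalk d generic_point" "z \<noteq> 0"
  obtains T where "finite T" "T \<subseteq> curves"
    "\<forall>S. finite S \<and> T \<subseteq> S \<and> S \<subseteq> curves \<longrightarrow> (\<Sum>P\<in>S. int (curve_degree P) * valuation P z) = d"
proof -
  obtain a b m n where ab: "homogeneous m a" "homogeneous n b" "b \<noteq> 0" "int m = int n + d" "z = Fract a b"
    using z(1) by (elim twist_stalk_obtain) (auto simp: generic_point_def)
  have "a \<noteq> 0" using z(2) ab(5) by (auto simp: Zero_fract_def eq_fract)
  note A = degree_formula_form[OF ab(1) \<open>a \<noteq> 0\<close>] and B = degree_formula_form[OF ab(2,3)]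
  define T where "T = {P \<in> curves. a \<in> P} \<union> {P \<in> curves. b \<in> P}"
  have val: "valuation P z = valuation P (Fract a 1) - valuation P (Fract b 1)" if P: "P \<in> curves" for P
  proof -
    have tw: "Fract b 1 \<in> twist_stalk (int n) generic_point" "Fract a 1 \<in> twist_stalk (int m) generic_point"
      by (rule Fract_1_twist_stalk[OF generic_point_Proj ab(2)], rule Fract_1_twist_stalk[OF generic_point_Proj ab(1)])
    have nz: "Fract b 1 \<noteq> 0" "Fract a 1 \<noteq> 0" by (simp_all add: Fract_nonzero ab(3) \<open>a \<noteq> 0\<close>)
    have "z * Fract b 1 = Fract a 1" using ab(3,5) by (simp add: eq_fract)
    hence "valuation P z + valuation P (Fract b 1) = valuation P (Fract a 1)"
      using valuation_mult[OF P z tw(1) nz(1)] by simp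
    thus ?thesis by simp
  qed
  show ?thesis
  proof (rule that[of T])
    show "\<forall>S. finite S \<and> T \<subseteq> S \<and> S \<subseteq> curves \<longrightarrow> (\<Sum>P\<in>S. int (curve_degree P) * valuation P z) = d"
    proof (intro allI impI)
      fix S assume S': "finite S \<and> T \<subseteq> S \<and> S \<subseteq> curves"
      hence S: "finite S" "T \<subseteq> S" "S \<subseteq> curves" by blast+
      have "(\<Sum>P\<in>S. int (curve_degree P) * valuation P z) =
        (\<Sum>P\<in>S. int (curve_degree P) * valuation P (Fract a 1) - int (curve_degree P) * valuation P (Fract b 1))"
      proof (rule sum.cong[OF refl])
        fix P assume "P \<in> S"
        with S(3) have "P \<in> curves" by blast
        from val[OF this] show "int (curve_degree P) * valuation P z = int (curve_degree P) * valuation P (Fract a 1)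
            - int (curve_degree P) * valuation P (Fract b 1)"
          by (simp only: right_diff_distrib)
      qed
      also have "\<dots> = int m - int n" using A B S unfolding T_def by (simp add: sum_subtractf)
      finally show "(\<Sum>P\<in>S. int (curve_degree P) * valuation P z) = d" using ab(4) by simp
    qed
  qed (use A B in \<open>auto simp: T_def\<close>)
qed

no_notation fps_nth (infixl \<open>$\<close> 75)

section \<open>Linear algebra over subrings of a field\<close>

text \<open>Rings are subsets of an ambient field, since the local rings and the function field are
  all given inside the field of fractions of \<open>K[X,Y,Z]\<close>.\<close>

definition subring_set :: "'a::field set \<Rightarrow> bool" where
  "subring_set R \<longleftrightarrow> 0 \<in> R \<and> 1 \<in> R \<and> (\<forall>a\<in>R. \<forall>b\<in>R. a + b \<in> R) \<and> (\<forall>a\<in>R. \<forall>b\<in>R. a * b \<in> R) \<and>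
     (\<forall>a\<in>R. - a \<in> R)"

definition subfield_set :: "'a::field set \<Rightarrow> bool" where
  "subfield_set K \<longleftrightarrow> subring_set K \<and> (\<forall>a\<in>K. inverse a \<in> K)"

definition valuation_subring :: "'a::field set \<Rightarrow> 'a set \<Rightarrow> bool" where
  "valuation_subring R K \<longleftrightarrow> subring_set R \<and> subfield_set K \<and> R \<subseteq> K \<and> (\<forall>z\<in>K. z \<in> R \<or> inverse z \<in> R)"

lemma subring_setD:
  assumes "subring_set R"
  shows "0 \<in> R" "1 \<in> R" "a \<in> R \<Longrightarrow> b \<in> R \<Longrightarrow> a + b \<in> R" "a \<in> R \<Longrightarrow> b \<in> R \<Longrightarrow> a * b \<in> R"
    "a \<in> R \<Longrightarrow> - a \<in> R" "a \<in> R \<Longrightarrow> b \<in> R \<Longrightarrow> a - b \<in> R"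
proof -
  show "0 \<in> R" "1 \<in> R" "a \<in> R \<Longrightarrow> b \<in> R \<Longrightarrow> a + b \<in> R" "a \<in> R \<Longrightarrow> b \<in> R \<Longrightarrow> a * b \<in> R" "a \<in> R \<Longrightarrow> - a \<in> R"
    using assms unfolding subring_set_def by blast+
  show "a - b \<in> R" if "a \<in> R" "b \<in> R"
    using assms that unfolding subring_set_def by (metis add_uminus_conv_diff)
qed

lemma subring_set_sum:
  assumes "subring_set R" "\<And>i. i \<in> I \<Longrightarrow> f i \<in> R"
  shows "(\<Sum>i\<in>I. f i) \<in> R"
  using assms(2) by (induction I rule: infinite_finite_induct) (auto intro: subring_setD[OF assms(1)])

lemma subring_set_prod:
  assumes "subring_set R" "\<And>i. i \<in> I \<Longrightarrow> f i \<in> R"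
  shows "(\<Prod>i\<in>I. f i) \<in> R"
  using assms(2) by (induction I rule: infinite_finite_induct) (auto intro: subring_setD[OF assms(1)])

lemma subfield_setD:
  assumes "subfield_set K"
  shows "subring_set K" "a \<in> K \<Longrightarrow> inverse a \<in> K" "a \<in> K \<Longrightarrow> b \<in> K \<Longrightarrow> a / b \<in> K"
  using assms unfolding subfield_set_def divide_inverse by (auto intro: subring_setD)

lemma valuation_subringD:
  assumes "valuation_subring R K"
  shows "subring_set R" "subfield_set K" "subring_set K" "z \<in> R \<Longrightarrow> z \<in> K"
    "z \<in> K \<Longrightarrow> z \<notin> R \<Longrightarrow> inverse z \<in> R"
  using assms unfolding valuation_subring_def subfield_set_def by auto

lemma subfield_valuation_subring: "subfield_set K \<Longrightarrow> valuation_subring K K"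
  unfolding valuation_subring_def subfield_set_def by auto

text \<open>\<open>c i0\<close> is a coefficient of least valuation. It exists because for any two
  nonzero coefficients one of the two quotients lies in \<open>R\<close>.\<close>

lemma valuation_subring_pivot:
  assumes RK: "valuation_subring R K" and I: "finite I" "\<And>i. i \<in> I \<Longrightarrow> c i \<in> K" "\<exists>i\<in>I. c i \<noteq> 0"
  shows "\<exists>i0\<in>I. c i0 \<noteq> 0 \<and> (\<forall>i\<in>I. c i / c i0 \<in> R)"
proof -
  note R = subring_setD[OF valuation_subringD(1)[OF RK]]
  note K = subfield_setD[OF valuation_subringD(2)[OF RK]]
  show ?thesis
    using I
  proof (induction I rule: finite_induct)
    case (insert x I)
    show ?case
    proof (cases "\<exists>i\<in>I. c i \<noteq> 0")
      case False
      with insert.prems have "c x \<noteq> 0" by auto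
      with False show ?thesis using R by (intro bexI[of _ x]) auto
    next
      case True
      then obtain i0 where i0: "i0 \<in> I" "c i0 \<noteq> 0" "\<forall>i\<in>I. c i / c i0 \<in> R"
        using insert by auto
      show ?thesis
      proof (cases "c x / c i0 \<in> R")
        case True
        with i0 show ?thesis by (intro bexI[of _ i0]) auto
      next
        case False
        have "c x / c i0 \<in> K" using insert.prems i0 by (intro K(3)) auto
        with False have inv: "c i0 / c x \<in> R" using valuation_subringD(5)[OF RK] by fastforce
        have "c x \<noteq> 0" using False R(1) by auto
        have "c i / c x \<in> R" if "i \<in> I" for i
        proof -
          have "c i / c x = (c i / c i0) * (c i0 / c x)" using i0(2) by simp
          thus ?thesis using i0(3) that inv R(4) by metis
        qed
        with \<open>c x \<noteq> 0\<close> show ?thesis using R(2) by (intro bexI[of _ x]) auto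
      qed
    qed
  qed simp
qed

text \<open>Gaussian elimination, by induction on the number of equations. The solution has to stay
  inside \<open>K\<close>, because the function field is a proper subfield of the ambient field of
  fractions.\<close>

lemma homogeneous_system:
  assumes K: "subfield_set K" and "finite I" "card I > s" "\<And>i j. i \<in> I \<Longrightarrow> j < s \<Longrightarrow> A i j \<in> K"
  shows "\<exists>c. (\<forall>i\<in>I. c i \<in> K) \<and> (\<exists>i\<in>I. c i \<noteq> 0) \<and> (\<forall>j<s. (\<Sum>i\<in>I. c i * A i j) = (0::'a::field))"
  using assms(2-)
proof (induction s arbitrary: I A)
  case 0
  hence "I \<noteq> {}" by auto
  thus ?case using subring_setD(2)[OF subfield_setD(1)[OF K]] by (intro exI[of _ "\<lambda>_. 1"]) auto
next
  case (Suc s)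
  note R = subring_setD[OF subfield_setD(1)[OF K]]
  show ?case
  proof (cases "\<forall>i\<in>I. A i s = 0")
    case True
    obtain c where c: "\<forall>i\<in>I. c i \<in> K" "\<exists>i\<in>I. c i \<noteq> 0" "\<forall>j<s. (\<Sum>i\<in>I. c i * A i j) = 0"
      using Suc.IH[OF Suc.prems(1), of A] Suc.prems by auto
    show ?thesis using c True by (intro exI[of _ c]) (auto simp: less_Suc_eq)
  next
    case False
    then obtain i0 where i0: "i0 \<in> I" "A i0 s \<noteq> 0" by blast
    let ?I = "I - {i0}"
    define q where "q i = A i s * inverse (A i0 s)" for i
    have q: "q i \<in> K" if "i \<in> I" for i
      unfolding q_def using that i0 Suc.prems(3) by (intro R(4) subfield_setD(2)[OF K]) auto
    have "\<exists>c. (\<forall>i\<in>?I. c i \<in> K) \<and> (\<exists>i\<in>?I. c i \<noteq> 0) \<and> (\<forall>j<s. (\<Sum>i\<in>?I. c i * (A i j - q i * A i0 j)) = 0)"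
    proof (rule Suc.IH)
      show "card ?I > s" using Suc.prems(1,2) i0 by simp
      show "A i j - q i * A i0 j \<in> K" if "i \<in> ?I" "j < s" for i j
        using that i0 q Suc.prems(3) by (intro R(4) R(6)) auto
    qed (use Suc.prems in auto)
    then obtain c where c: "\<forall>i\<in>?I. c i \<in> K" "\<exists>i\<in>?I. c i \<noteq> 0"
      "\<forall>j<s. (\<Sum>i\<in>?I. c i * (A i j - q i * A i0 j)) = 0" by blast
    \<comment> \<open>The unknown at \<open>i0\<close> is solved from equation \<open>s\<close>. Its
      substitution into equation \<open>j\<close> turns \<open>A i j\<close> into
      \<open>A i j - q i * A i0 j\<close>.\<close>
    define d where "d = c(i0 := - (\<Sum>i\<in>?I. c i * q i))"
    have sum: "(\<Sum>i\<in>I. d i * A i j) = (\<Sum>i\<in>?I. c i * (A i j - q i * A i0 j))" for j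
    proof -
      have "(\<Sum>i\<in>I. d i * A i j) = d i0 * A i0 j + (\<Sum>i\<in>?I. d i * A i j)"
        using i0 Suc.prems(1) by (simp add: sum.remove)
      also have "(\<Sum>i\<in>?I. d i * A i j) = (\<Sum>i\<in>?I. c i * A i j)"
        by (intro sum.cong) (auto simp: d_def)
      also have "d i0 * A i0 j = - (\<Sum>i\<in>?I. c i * q i * A i0 j)"
        by (simp add: d_def sum_distrib_right)
      finally show ?thesis by (simp add: right_diff_distrib sum_subtractf mult.assoc)
    qed
    have "(\<Sum>i\<in>I. d i * A i j) = 0" if "j < Suc s" for j
    proof (cases "j = s")
      case True
      show ?thesis unfolding sum using i0 True by (intro sum.neutral) (auto simp: q_def)
    next
      case False
      with that have "j < s" by simp
      with c(3) show ?thesis unfolding sum by blast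
    qed
    moreover have "d i \<in> K" if "i \<in> I" for i
    proof (cases "i = i0")
      case True
      have "- (\<Sum>i\<in>?I. c i * q i) \<in> K"
        using c(1) q by (intro R(5) subring_set_sum[OF subfield_setD(1)[OF K]] R(4)) auto
      thus ?thesis using True by (simp add: d_def)
    qed (use that c(1) in \<open>auto simp: d_def\<close>)
    moreover have "\<exists>i\<in>I. d i \<noteq> 0"
    proof -
      obtain i where "i \<in> ?I" "c i \<noteq> 0" using c(2) by blast
      thus ?thesis by (intro bexI[of _ i]) (auto simp: d_def)
    qed
    ultimately show ?thesis by blast
  qed
qed

lemma lin_comb_carrier [simp]: "lin_comb n c vs \<in> carrier_vec n"
  by (simp add: lin_comb_def)

lemma dim_lin_comb [simp]: "dim_vec (lin_comb n c vs) = n"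
  by (simp add: lin_comb_def)

lemma lin_comb_index [simp]: "j < n \<Longrightarrow> lin_comb n c vs $ j = (\<Sum>i<length vs. c i * vs ! i $ j)"
  by (simp add: lin_comb_def)

lemma lin_comb_cong: "(\<And>i. i < length vs \<Longrightarrow> c i = d i) \<Longrightarrow> lin_comb n c vs = lin_comb n d vs"
  by (intro eq_vecI) auto

lemma lin_comb_eq_0_iff: "lin_comb n c vs = 0\<^sub>v n \<longleftrightarrow> (\<forall>j<n. (\<Sum>i<length vs. c i * vs ! i $ j) = 0)"
  by (auto simp: vec_eq_iff)

lemma lin_spanI: "(\<And>i. i < length vs \<Longrightarrow> c i \<in> R) \<Longrightarrow> lin_comb n c vs \<in> lin_span n R vs"
  unfolding lin_span_def by blast

lemma lin_spanE:
  assumes "v \<in> lin_span n R vs"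
  obtains c where "\<forall>i<length vs. c i \<in> R" "v = lin_comb n c vs"
  using assms unfolding lin_span_def by blast

lemma lin_span_carrier: "lin_span n R vs \<subseteq> carrier_vec n"
  by (auto elim!: lin_spanE)

lemma lin_comb_trans:
  assumes "\<And>i. i < length ws \<Longrightarrow> ws ! i = lin_comb n (A i) vs"
  shows "lin_comb n c ws = lin_comb n (\<lambda>j. \<Sum>i<length ws. c i * A i j) vs"
proof (rule eq_vecI)
  fix k assume "k < dim_vec (lin_comb n (\<lambda>j. \<Sum>i<length ws. c i * A i j) vs)"
  hence k: "k < n" by simp
  have "lin_comb n c ws $ k = (\<Sum>i<length ws. \<Sum>j<length vs. c i * A i j * vs ! j $ k)"
    using k assms by (simp add: sum_distrib_left mult.assoc)
  also have "\<dots> = (\<Sum>j<length vs. \<Sum>i<length ws. c i * A i j * vs ! j $ k)" by (rule sum.swap)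
  finally show "lin_comb n c ws $ k = lin_comb n (\<lambda>j. \<Sum>i<length ws. c i * A i j) vs $ k"
    using k by (simp add: sum_distrib_right)
qed simp

lemma lin_span_mono_subset:
  assumes R: "subring_set R" and sub: "set ws \<subseteq> lin_span n R vs"
  shows "lin_span n R ws \<subseteq> lin_span n R vs"
proof
  have "\<exists>c. (\<forall>j<length vs. c j \<in> R) \<and> ws ! i = lin_comb n c vs" if "i < length ws" for i
    using sub nth_mem[OF that] by (auto elim!: lin_spanE)
  then obtain A where A: "\<And>i. i < length ws \<Longrightarrow> (\<forall>j<length vs. A i j \<in> R) \<and> ws ! i = lin_comb n (A i) vs"
    by metis
  fix v assume "v \<in> lin_span n R ws"
  then obtain c where c: "\<forall>i<length ws. c i \<in> R" "v = lin_comb n c ws" by (rule lin_spanE)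
  have "v = lin_comb n (\<lambda>j. \<Sum>i<length ws. c i * A i j) vs"
    unfolding c(2) using A by (intro lin_comb_trans) blast
  thus "v \<in> lin_span n R vs"
    using c(1) A by (auto intro!: lin_spanI subring_set_sum[OF R] subring_setD[OF R])
qed

lemma lin_span_smult_add:
  assumes R: "subring_set R" and "u \<in> lin_span n R vs" "w \<in> lin_span n R vs" "a \<in> R"
  shows "u + a \<cdot>\<^sub>v w \<in> lin_span n R vs"
proof -
  obtain c where c: "\<forall>i<length vs. c i \<in> R" "u = lin_comb n c vs" using assms(2) by (rule lin_spanE)
  obtain d where d: "\<forall>i<length vs. d i \<in> R" "w = lin_comb n d vs" using assms(3) by (rule lin_spanE)
  have "u + a \<cdot>\<^sub>v w = lin_comb n (\<lambda>i. c i + a * d i) vs"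
    unfolding c(2) d(2) by (intro eq_vecI) (auto simp: sum.distrib sum_distrib_left algebra_simps)
  moreover have "\<dots> \<in> lin_span n R vs"
    using c(1) d(1) assms(4) by (auto intro!: lin_spanI subring_setD(3,4)[OF R])
  ultimately show ?thesis by simp
qed

lemma zero_in_lin_span: "subring_set R \<Longrightarrow> 0\<^sub>v n \<in> lin_span n R vs"
proof -
  assume R: "subring_set R"
  have "0\<^sub>v n = lin_comb n (\<lambda>_. 0) vs" by (intro eq_vecI) auto
  thus ?thesis using lin_spanI[of vs "\<lambda>_. 0" R n] subring_setD(1)[OF R] by simp
qed

lemma lin_span_sum:
  assumes R: "subring_set R" and I: "finite I" "\<And>i. i \<in> I \<Longrightarrow> f i \<in> lin_span n R vs" "\<And>i. i \<in> I \<Longrightarrow> c i \<in> R"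
  shows "vec n (\<lambda>j. \<Sum>i\<in>I. c i * f i $ j) \<in> lin_span n R vs"
  using I
proof (induction I rule: finite_induct)
  case empty
  have "vec n (\<lambda>j. \<Sum>i\<in>{}. c i * f i $ j) = 0\<^sub>v n" by (intro eq_vecI) auto
  thus ?case using zero_in_lin_span[OF R] by simp
next
  case (insert x I)
  have x: "f x \<in> lin_span n R vs" using insert.prems by simp
  hence "dim_vec (f x) = n" using lin_span_carrier by fastforce
  hence "vec n (\<lambda>j. \<Sum>i\<in>insert x I. c i * f i $ j) = vec n (\<lambda>j. \<Sum>i\<in>I. c i * f i $ j) + c x \<cdot>\<^sub>v f x"
    using insert.hyps by (intro eq_vecI) auto
  thus ?case using insert x by (simp add: lin_span_smult_add[OF R])
qed

lemma lin_span_superset: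
  assumes R: "subring_set R" and "set vs \<subseteq> carrier_vec n" "v \<in> set vs"
  shows "v \<in> lin_span n R vs"
proof -
  obtain k where k: "k < length vs" "v = vs ! k" using assms(3) by (auto simp: in_set_conv_nth)
  have "v = lin_comb n (\<lambda>i. if i = k then 1 else 0) vs"
    using k subsetD[OF assms(2,3)] by (intro eq_vecI) (auto simp: if_distrib[of "\<lambda>x. x * _"] sum.delta cong: if_cong)
  thus ?thesis using lin_spanI[of vs "\<lambda>i. if i = k then 1 else 0" R n] subring_setD(1,2)[OF R] by simp
qed

lemma basis_exists:
  assumes RK: "valuation_subring R K" and "set vs \<subseteq> carrier_vec n"
  obtains ws where "is_basis n R (lin_span n R vs) ws" "set ws \<subseteq> set vs"
proof -
  note R = valuation_subringD(1)[OF RK]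
  have "\<exists>ws. is_basis n R (lin_span n R vs) ws \<and> set ws \<subseteq> set vs"
    using assms(2)
  proof (induction "length vs" arbitrary: vs rule: less_induct)
    case less
    show ?case
    proof (cases "\<forall>c. (\<forall>i<length vs. c i \<in> R) \<and> lin_comb n c vs = 0\<^sub>v n \<longrightarrow> (\<forall>i<length vs. c i = 0)")
      case True
      hence "is_basis n R (lin_span n R vs) vs" unfolding is_basis_def using less.prems by blast
      thus ?thesis by blast
    next
      case False
      then obtain c where c: "\<forall>i<length vs. c i \<in> R" "lin_comb n c vs = 0\<^sub>v n" "\<exists>i<length vs. c i \<noteq> 0" by blast
      have "\<exists>k\<in>{..<length vs}. c k \<noteq> 0 \<and> (\<forall>i\<in>{..<length vs}. c i / c k \<in> R)"
        using c valuation_subringD(4)[OF RK] by (intro valuation_subring_pivot[OF RK]) auto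
      then obtain k where k: "k < length vs" "c k \<noteq> 0" "\<forall>i<length vs. c i / c k \<in> R" by auto
      define us where "us = take k vs @ drop (Suc k) vs"
      have len: "length us < length vs" using k(1) by (simp add: us_def)
      have sub: "set us \<subseteq> set vs" unfolding us_def using set_take_subset set_drop_subset by fastforce
      have mem: "vs ! i \<in> set us" if i: "i < length vs" "i \<noteq> k" for i
      proof (cases "i < k")
        case True
        hence "vs ! i \<in> set (take k vs)" using k(1) by (auto simp: in_set_conv_nth intro!: exI[of _ i])
        thus ?thesis by (simp add: us_def)
      next
        case False
        hence "drop (Suc k) vs ! (i - Suc k) = vs ! i" "i - Suc k < length (drop (Suc k) vs)" using i k(1) by auto
        hence "vs ! i \<in> set (drop (Suc k) vs)" by (metis nth_mem)
        thus ?thesis by (simp add: us_def)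
      qed
      have us: "set us \<subseteq> carrier_vec n" using sub less.prems by blast
      let ?I = "{..<length vs} - {k}"
      have "vs ! k = vec n (\<lambda>j. \<Sum>i\<in>?I. - (c i / c k) * vs ! i $ j)"
      proof (rule eq_vecI)
        fix j assume "j < dim_vec (vec n (\<lambda>j. \<Sum>i\<in>?I. - (c i / c k) * vs ! i $ j))"
        hence j: "j < n" by simp
        have "0 = (\<Sum>i<length vs. c i * vs ! i $ j)" using c(2) j by (simp add: lin_comb_eq_0_iff)
        also have "\<dots> = c k * vs ! k $ j + (\<Sum>i\<in>?I. c i * vs ! i $ j)"
          using k(1) by (simp add: sum.remove)
        finally have "c k * vs ! k $ j = - (\<Sum>i\<in>?I. c i * vs ! i $ j)" by (simp add: eq_neg_iff_add_eq_0)
        hence "vs ! k $ j = - (\<Sum>i\<in>?I. c i * vs ! i $ j) / c k" using k(2) by (simp add: field_simps)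
        thus "vs ! k $ j = vec n (\<lambda>j. \<Sum>i\<in>?I. - (c i / c k) * vs ! i $ j) $ j"
          using j by (simp add: sum_divide_distrib sum_negf)
      next
        have "vs ! k \<in> carrier_vec n" using less.prems nth_mem[OF k(1)] by blast
        thus "dim_vec (vs ! k) = dim_vec (vec n (\<lambda>j. \<Sum>i\<in>?I. - (c i / c k) * vs ! i $ j))" by simp
      qed
      also have "\<dots> \<in> lin_span n R us"
        using mem k(3) by (intro lin_span_sum[OF R] lin_span_superset[OF R us] subring_setD(5)[OF R]) auto
      finally have "vs ! k \<in> lin_span n R us" .
      hence "vs ! i \<in> lin_span n R us" if "i < length vs" for i
        using mem[OF that] lin_span_superset[OF R us] by (cases "i = k") auto
      hence "set vs \<subseteq> lin_span n R us" by (auto simp: in_set_conv_nth)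
      hence "lin_span n R vs \<subseteq> lin_span n R us" by (rule lin_span_mono_subset[OF R])
      moreover have "lin_span n R us \<subseteq> lin_span n R vs"
        using sub lin_span_superset[OF R less.prems] by (intro lin_span_mono_subset[OF R]) blast
      ultimately have "lin_span n R vs = lin_span n R us" by (rule equalityI)
      moreover obtain ws where "is_basis n R (lin_span n R us) ws" "set ws \<subseteq> set us"
        using less.hyps[OF len us] by blast
      ultimately show ?thesis using sub by auto
    qed
  qed
  with that show ?thesis by blast
qed

lemma is_basisD:
  assumes "is_basis n R M vs"
  shows "set vs \<subseteq> carrier_vec n" "M = lin_span n R vs"
    "(\<And>i. i < length vs \<Longrightarrow> c i \<in> R) \<Longrightarrow> lin_comb n c vs = 0\<^sub>v n \<Longrightarrow> i < length vs \<Longrightarrow> c i = 0"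
  using assms unfolding is_basis_def by blast+

lemma basis_nth_carrier: "is_basis n R M vs \<Longrightarrow> i < length vs \<Longrightarrow> vs ! i \<in> carrier_vec n"
  using is_basisD(1) nth_mem by blast

lemma basis_subset: "subring_set R \<Longrightarrow> is_basis n R M vs \<Longrightarrow> set vs \<subseteq> M"
  using lin_span_superset is_basisD(1,2) by blast

text \<open>A relation over \<open>K\<close>, divided by a coefficient of least valuation, becomes a
  relation over \<open>R\<close> in which one coefficient is 1.\<close>

lemma basis_extend_scalars:
  assumes RK: "valuation_subring R K" and vs: "is_basis n R M vs"
  shows "is_basis n K (lin_span n K vs) vs"
  unfolding is_basis_def
proof (intro conjI allI impI refl is_basisD(1)[OF vs])
  fix c i assume c: "(\<forall>i<length vs. c i \<in> K) \<and> lin_comb n c vs = 0\<^sub>v n" and i: "i < length vs"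
  show "c i = 0"
  proof (rule ccontr)
    assume "c i \<noteq> 0"
    hence "\<exists>i\<in>{..<length vs}. c i \<noteq> 0" using i by blast
    hence "\<exists>k\<in>{..<length vs}. c k \<noteq> 0 \<and> (\<forall>i\<in>{..<length vs}. c i / c k \<in> R)"
      using c by (intro valuation_subring_pivot[OF RK]) auto
    then obtain k where k: "k < length vs" "c k \<noteq> 0" "\<forall>i<length vs. c i / c k \<in> R" by auto
    have "lin_comb n (\<lambda>i. c i / c k) vs = 0\<^sub>v n"
      using c by (simp add: lin_comb_eq_0_iff sum_divide_distrib[symmetric])
    hence "c k / c k = 0" using is_basisD(3)[OF vs, of "\<lambda>i. c i / c k" k] k by blast
    with k(2) show False by simp
  qed
qed

lemma basis_length_le:
  assumes K: "subfield_set K" and vs: "is_basis n K M vs" and ws: "is_basis n K M ws"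
  shows "length ws \<le> length vs"
proof (rule ccontr)
  assume "\<not> length ws \<le> length vs"
  note R = subfield_setD(1)[OF K]
  have "\<exists>c. (\<forall>j<length vs. c j \<in> K) \<and> ws ! i = lin_comb n c vs" if "i < length ws" for i
    using basis_subset[OF R ws] nth_mem[OF that] is_basisD(2)[OF vs] by (auto elim!: lin_spanE)
  then obtain A where A: "\<And>i. i < length ws \<Longrightarrow> (\<forall>j<length vs. A i j \<in> K) \<and> ws ! i = lin_comb n (A i) vs"
    by metis
  have "\<exists>c. (\<forall>i\<in>{..<length ws}. c i \<in> K) \<and> (\<exists>i\<in>{..<length ws}. c i \<noteq> 0) \<and>
      (\<forall>j<length vs. (\<Sum>i\<in>{..<length ws}. c i * A i j) = 0)"
    using \<open>\<not> length ws \<le> length vs\<close> A by (intro homogeneous_system[OF K]) auto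
  then obtain c where c: "\<forall>i\<in>{..<length ws}. c i \<in> K" "\<exists>i\<in>{..<length ws}. c i \<noteq> 0"
    "\<forall>j<length vs. (\<Sum>i\<in>{..<length ws}. c i * A i j) = 0" by blast
  have "lin_comb n c ws = lin_comb n (\<lambda>j. \<Sum>i<length ws. c i * A i j) vs"
    using A by (intro lin_comb_trans) blast
  also have "\<dots> = lin_comb n (\<lambda>_. 0) vs" using c(3) by (intro lin_comb_cong) blast
  also have "\<dots> = 0\<^sub>v n" by (intro eq_vecI) auto
  finally have 0: "lin_comb n c ws = 0\<^sub>v n" .
  obtain i where i: "i < length ws" "c i \<noteq> 0" using c(2) by blast
  have "c i = 0" using is_basisD(3)[OF ws _ 0 i(1)] c(1) by blast
  with i(2) show False ..
qed

lemma basis_length_unique: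
  "subfield_set K \<Longrightarrow> is_basis n K M vs \<Longrightarrow> is_basis n K M ws \<Longrightarrow> length ws = length vs"
  by (intro order.antisym basis_length_le)

lemma basis_unique_coeffs:
  assumes R: "subring_set R" and vs: "is_basis n R M vs"
    and "\<And>i. i < length vs \<Longrightarrow> c i \<in> R" "\<And>i. i < length vs \<Longrightarrow> d i \<in> R"
    and eq: "lin_comb n c vs = lin_comb n d vs" and "i < length vs"
  shows "c i = d i"
proof -
  have "lin_comb n (\<lambda>i. c i - d i) vs = lin_comb n c vs - lin_comb n d vs"
    by (intro eq_vecI) (auto simp: left_diff_distrib sum_subtractf)
  also have "\<dots> = 0\<^sub>v n" unfolding eq by (intro eq_vecI) auto
  finally have "c i - d i = 0"
    using assms(3,4,6) by (intro is_basisD(3)[OF vs, of "\<lambda>i. c i - d i"] subring_setD(6)[OF R])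
  thus ?thesis by simp
qed

text \<open>The convention of \<open>det_order\<close>: row \<open>i\<close> of the matrix holds the
  coordinates of the \<open>i\<close>-th vector.\<close>

definition expresses :: "nat \<Rightarrow> 'a::field mat \<Rightarrow> 'a set \<Rightarrow> 'a vec list \<Rightarrow> 'a vec list \<Rightarrow> bool" where
  "expresses n A R ws vs \<longleftrightarrow> A \<in> carrier_mat (length ws) (length vs) \<and>
     (\<forall>i<length ws. \<forall>j<length vs. A $$ (i, j) \<in> R) \<and>
     (\<forall>i<length ws. ws ! i = lin_comb n (\<lambda>j. A $$ (i, j)) vs)"

lemma expresses_exists:
  assumes "set ws \<subseteq> lin_span n R vs"
  obtains A where "expresses n A R ws vs"
proof -
  have "\<exists>c. (\<forall>j<length vs. c j \<in> R) \<and> ws ! i = lin_comb n c vs" if "i < length ws" for i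
    using assms nth_mem[OF that] by (auto elim!: lin_spanE)
  then obtain A where A: "\<And>i. i < length ws \<Longrightarrow> (\<forall>j<length vs. A i j \<in> R) \<and> ws ! i = lin_comb n (A i) vs"
    by metis
  have "ws ! i = lin_comb n (\<lambda>j. mat (length ws) (length vs) (\<lambda>(i, j). A i j) $$ (i, j)) vs"
    if "i < length ws" for i
    using A[OF that] that by (auto intro: lin_comb_cong)
  with A have "expresses n (mat (length ws) (length vs) (\<lambda>(i, j). A i j)) R ws vs"
    unfolding expresses_def by simp
  thus ?thesis by (rule that)
qed

lemma expresses_trans:
  assumes "subring_set R" "expresses n A R us ws" "expresses n B R ws vs"
  shows "expresses n (A * B) R us vs"
proof -
  have AB: "(A * B) $$ (i, j) = (\<Sum>k<length ws. A $$ (i, k) * B $$ (k, j))" if "i < length us" "j < length vs" for i j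
    using assms(2,3) that unfolding expresses_def by (auto simp: scalar_prod_def atLeast0LessThan)
  have "us ! i = lin_comb n (\<lambda>j. (A * B) $$ (i, j)) vs" if i: "i < length us" for i
  proof -
    have "us ! i = lin_comb n (\<lambda>j. A $$ (i, j)) ws" using assms(2) i unfolding expresses_def by blast
    also have "\<dots> = lin_comb n (\<lambda>j. \<Sum>k<length ws. A $$ (i, k) * B $$ (k, j)) vs"
      using assms(3) unfolding expresses_def by (intro lin_comb_trans) blast
    also have "\<dots> = lin_comb n (\<lambda>j. (A * B) $$ (i, j)) vs" using AB[OF i] by (intro lin_comb_cong) simp
    finally show ?thesis .
  qed
  moreover have "(A * B) $$ (i, j) \<in> R" if ij: "i < length us" "j < length vs" for i j
    unfolding AB[OF ij] using assms ij unfolding expresses_def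
    by (intro subring_set_sum subring_setD(4)) auto
  ultimately show ?thesis using assms(2,3) unfolding expresses_def by auto
qed

lemma expresses_mono: "R \<subseteq> K \<Longrightarrow> expresses n A R ws vs \<Longrightarrow> expresses n A K ws vs"
  unfolding expresses_def by blast

lemma expresses_self_unique:
  assumes R: "subring_set R" and vs: "is_basis n R M vs" and A: "expresses n A R vs vs"
  shows "A = 1\<^sub>m (length vs)"
proof (rule eq_matI)
  fix i j assume "i < dim_row (1\<^sub>m (length vs))" "j < dim_col (1\<^sub>m (length vs))"
  hence ij: "i < length vs" "j < length vs" by auto
  have "vs ! i = lin_comb n (\<lambda>j. if j = i then 1 else 0) vs"
    using ij basis_nth_carrier[OF vs ij(1)] by (intro eq_vecI) (auto simp: if_distrib[of "\<lambda>x. x * _"] sum.delta cong: if_cong)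
  moreover have "vs ! i = lin_comb n (\<lambda>j. A $$ (i, j)) vs" using A ij unfolding expresses_def by blast
  ultimately have "lin_comb n (\<lambda>j. A $$ (i, j)) vs = lin_comb n (\<lambda>j. if j = i then 1 else 0) vs" by simp
  from basis_unique_coeffs[OF R vs _ _ this ij(2)]
  have "A $$ (i, j) = (if j = i then 1 else 0)"
    using A ij subring_setD(1,2)[OF R] unfolding expresses_def by simp
  thus "A $$ (i, j) = 1\<^sub>m (length vs) $$ (i, j)" using ij by simp
qed (use A in \<open>auto simp: expresses_def\<close>)

lemma subring_set_det:
  assumes R: "subring_set R" and A: "A \<in> carrier_mat r r" "\<And>i j. i < r \<Longrightarrow> j < r \<Longrightarrow> A $$ (i, j) \<in> R"
  shows "det A \<in> R"
proof -
  have "signof p \<in> R" for p :: "nat \<Rightarrow> nat"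
    using subring_setD(2,5)[OF R] by (simp add: sign_def)
  moreover have "(\<Prod>i = 0..<r. A $$ (i, p i)) \<in> R" if "p permutes {0..<r}" for p
    using A(2) permutes_in_image[OF that] by (intro subring_set_prod[OF R]) auto
  ultimately show ?thesis unfolding det_def'[OF A(1)]
    by (intro subring_set_sum[OF R] subring_setD(4)[OF R]) auto
qed

text \<open>The matrices in the two directions are inverse to each other, so the determinant is a
  unit of \<open>R\<close>. This makes orders of vanishing independent of the stalk basis.\<close>

lemma expresses_bases_inverse:
  assumes R: "subring_set R" and vs: "is_basis n R M vs" and ws: "is_basis n R M ws"
    and len: "length ws = length vs" and A: "expresses n A R ws vs"
  obtains B where "expresses n B R vs ws" "det A * det B = 1" "det A \<in> R" "det B \<in> R"
proof -
  obtain B where B: "expresses n B R vs ws"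
    using expresses_exists basis_subset[OF R vs] is_basisD(2)[OF ws] by blast
  have "A * B = 1\<^sub>m (length ws)" using expresses_self_unique[OF R ws] expresses_trans[OF R A B] .
  moreover have "A \<in> carrier_mat (length ws) (length ws)" "B \<in> carrier_mat (length ws) (length ws)"
    using A B len unfolding expresses_def by auto
  ultimately have "det A * det B = 1" by (metis det_mult det_one)
  moreover have "det A \<in> R" "det B \<in> R"
    using A B len unfolding expresses_def by (auto intro!: subring_set_det[OF R, of _ "length ws"])
  ultimately show ?thesis using that B by blast
qed

section \<open>Minors\<close>

text \<open>The Pluecker coordinates of the vectors \<open>ss\<close>. Index functions replace index
  sets: repeated and unordered indices make them an alternating tensor, and contraction runs over
  the updates \<open>I(p := k)\<close>.\<close>

definition minor :: "'a::comm_ring_1 vec list \<Rightarrow> (nat \<Rightarrow> nat) \<Rightarrow> 'a" where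
  "minor ss I = det (mat (length ss) (length ss) (\<lambda>(a, b). ss ! b $ I a))"

lemma minor_cong: "(\<And>a. a < length ss \<Longrightarrow> I a = J a) \<Longrightarrow> minor ss I = minor ss J"
  unfolding minor_def by (intro arg_cong[of _ _ det] cong_mat) auto

text \<open>Two bases of one space have proportional Pluecker coordinates. The matrix enters
  transposed, because the vectors are columns in \<open>minor\<close> and give rows in
  \<open>expresses\<close>.\<close>

lemma minor_expresses:
  assumes A: "expresses n A R ss vs" and len: "length ss = length vs"
    and I: "\<And>a. a < length ss \<Longrightarrow> I a < n"
  shows "minor ss I = det A * minor vs I"
proof -
  let ?r = "length vs"
  let ?V = "mat ?r ?r (\<lambda>(a, b). vs ! b $ I a)"
  have A': "A \<in> carrier_mat ?r ?r" using A len unfolding expresses_def by simp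
  have ss: "ss ! b = lin_comb n (\<lambda>j. A $$ (b, j)) vs" if "b < ?r" for b
    using A len that unfolding expresses_def by simp
  have "mat ?r ?r (\<lambda>(a, b). ss ! b $ I a) = ?V * A\<^sup>T"
    using A' I len by (intro eq_matI) (auto simp: ss scalar_prod_def atLeast0LessThan mult.commute intro!: sum.cong)
  hence "minor ss I = det (?V * A\<^sup>T)" unfolding minor_def len by simp
  also have "\<dots> = det ?V * det A" using A' by (subst det_mult[of _ ?r]) (auto simp: det_transpose)
  finally show ?thesis by (simp add: minor_def mult.commute)
qed

text \<open>Laplace expansion along row \<open>p\<close>. The cofactors do not see the replaced
  index \<open>k\<close>, so the minor is a combination of the \<open>k\<close>-th entries with
  coefficients independent of \<open>k\<close>.\<close>

lemma minor_replace:
  assumes p: "p < length ss"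
  obtains cof where "\<forall>k. minor ss (I(p := k)) = (\<Sum>b<length ss. ss ! b $ k * cof b)"
    "\<forall>b<length ss. cof b = (- 1) ^ (p + b) * det (mat (length ss - 1) (length ss - 1)
        (\<lambda>(a, b'). ss ! (if b' < b then b' else Suc b') $ I (if a < p then a else Suc a)))"
proof -
  let ?r = "length ss"
  define cof where "cof b = (- 1) ^ (p + b) * det (mat (?r - 1) (?r - 1)
      (\<lambda>(a, b'). ss ! (if b' < b then b' else Suc b') $ I (if a < p then a else Suc a)))" for b
  have "minor ss (I(p := k)) = (\<Sum>b<?r. ss ! b $ k * cof b)" for k
  proof -
    let ?M = "mat ?r ?r (\<lambda>(a, b). ss ! b $ (I(p := k)) a)"
    have "det ?M = (\<Sum>b<?r. ?M $$ (p, b) * cofactor ?M p b)"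
      using p by (intro laplace_expansion_row) auto
    moreover have "mat_delete ?M p b = mat (?r - 1) (?r - 1)
      (\<lambda>(a, b'). ss ! (if b' < b then b' else Suc b') $ I (if a < p then a else Suc a))" if "b < ?r" for b
      using p that unfolding mat_delete_def by (intro eq_matI) auto
    ultimately show ?thesis unfolding minor_def cofactor_def cof_def using p by simp
  qed
  hence "\<forall>k. minor ss (I(p := k)) = (\<Sum>b<?r. ss ! b $ k * cof b)" by blast
  thus ?thesis by (rule that) (simp add: cof_def)
qed

text \<open>Expansion along row \<open>p\<close> moves the sum over \<open>k\<close> onto the single
  vectors, each of which satisfies the relation.\<close>

lemma minor_contraction:
  assumes p: "p < length ss" and "\<And>b. b < length ss \<Longrightarrow> (\<Sum>k<n. f k * ss ! b $ k) = 0"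
  shows "(\<Sum>k<n. f k * minor ss (I(p := k))) = 0"
proof -
  obtain cof where cof: "\<forall>k. minor ss (I(p := k)) = (\<Sum>b<length ss. ss ! b $ k * cof b)"
    by (rule minor_replace[OF p])
  have "(\<Sum>k<n. f k * minor ss (I(p := k))) = (\<Sum>k<n. \<Sum>b<length ss. f k * ss ! b $ k * cof b)"
    using cof by (simp add: sum_distrib_left mult.assoc)
  also have "\<dots> = (\<Sum>b<length ss. \<Sum>k<n. f k * ss ! b $ k * cof b)" by (rule sum.swap)
  also have "\<dots> = 0" using assms(2) by (intro sum.neutral) (auto simp: sum_distrib_right[symmetric])
  finally show ?thesis .
qed

lemma minor_equal_indices:
  assumes "p < length ss" "q < length ss" "p \<noteq> q" "I p = I q"
  shows "minor ss I = 0"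
  unfolding minor_def using assms by (intro det_identical_rows[of _ "length ss" p q]) (auto intro!: eq_vecI)

lemma minor_swap:
  assumes "p < length ss" "q < length ss" "p \<noteq> q"
  shows "minor ss (I(p := I q, q := I p)) = - minor ss I"
proof -
  let ?r = "length ss"
  let ?M = "mat ?r ?r (\<lambda>(a, b). ss ! b $ I a)"
  have "mat ?r ?r (\<lambda>(a, b). ss ! b $ (I(p := I q, q := I p)) a) = swaprows p q ?M"
    using assms by (intro eq_matI) auto
  thus ?thesis unfolding minor_def using det_swaprows[of p ?r q ?M] assms by simp
qed

text \<open>A nonzero minor of maximal size among the first vectors yields, by expansion along a
  new row, a linear relation whose coefficients are ratios of minors of the same size.\<close>
lemma minor_nonzero_exists:
  assumes K: "subfield_set K" and ss: "is_basis n K M ss"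
    and ratio: "\<And>k A B. k < length ss \<Longrightarrow> A \<in> carrier_mat k k \<Longrightarrow> B \<in> carrier_mat k k \<Longrightarrow>
        (\<And>i j. i < k \<Longrightarrow> j < k \<Longrightarrow> A $$ (i, j) \<in> D) \<Longrightarrow> (\<And>i j. i < k \<Longrightarrow> j < k \<Longrightarrow> B $$ (i, j) \<in> D) \<Longrightarrow>
        det B \<noteq> 0 \<Longrightarrow> det A / det B \<in> K"
    and D: "\<And>i j. i < length ss \<Longrightarrow> j < n \<Longrightarrow> ss ! i $ j \<in> D"
  shows "\<exists>I. (\<forall>a<length ss. I a < n) \<and> minor ss I \<noteq> 0"
proof -
  have "\<exists>I. (\<forall>a<k. I a < n) \<and> minor (take k ss) I \<noteq> 0" if "k \<le> length ss" for k
    using that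
  proof (induction k)
    case 0
    show ?case by (simp add: minor_def)
  next
    case (Suc k)
    then obtain I where I: "\<forall>a<k. I a < n" "minor (take k ss) I \<noteq> 0" by auto
    let ?us = "take (Suc k) ss"
    have len: "length ?us = Suc k" using Suc.prems by simp
    show ?case
    proof (rule ccontr)
      assume no: "\<not> ?case"
      have 0: "minor ?us (I(k := j)) = 0" if "j < n" for j
      proof (rule ccontr)
        assume "minor ?us (I(k := j)) \<noteq> 0"
        moreover have "\<forall>a<Suc k. (I(k := j)) a < n" using I(1) that by (auto simp: less_Suc_eq)
        ultimately show False using no by blast
      qed
      have "k < length ?us" using len by simp
      then obtain cof where cof: "\<forall>j. minor ?us (I(k := j)) = (\<Sum>b<length ?us. ?us ! b $ j * cof b)"
        "\<forall>b<length ?us. cof b = (- 1) ^ (k + b) * det (mat (length ?us - 1) (length ?us - 1)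
          (\<lambda>(a, b'). ?us ! (if b' < b then b' else Suc b') $ I (if a < k then a else Suc a)))"
        by (rule minor_replace)
      define N where "N b = mat k k (\<lambda>(a, b'). ?us ! (if b' < b then b' else Suc b') $ I (if a < k then a else Suc a))" for b
      have cof': "cof b = (- 1) ^ (k + b) * det (N b)" if "b < Suc k" for b
        using cof(2) that unfolding N_def len by simp
      have Nk: "det (N k) = minor (take k ss) I"
        unfolding minor_def N_def using Suc.prems by (intro arg_cong[of _ _ det] eq_matI) auto
      have ND: "N b $$ (i, j) \<in> D" if "b < Suc k" "i < k" "j < k" for b i j
        unfolding N_def using that Suc.prems I(1) by (auto intro!: D)
      have ck: "cof k \<noteq> 0" using cof'[of k] Nk I(2) by simp
      \<comment> \<open>The expansion of the vanishing minors along the new row is a relation among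
        the first \<open>k + 1\<close> vectors. It is normalized to have coefficient 1 at position
        \<open>k\<close> and continued by 0 beyond, which contradicts independence.\<close>
      define c where "c b = (if b < Suc k then cof b / cof k else 0)" for b
      have "cof b / cof k \<in> K" if "b < Suc k" for b
      proof -
        have "det (N b) / det (N k) \<in> K"
        proof (rule ratio[of k])
          show "N b $$ (i, j) \<in> D" "N k $$ (i, j) \<in> D" if "i < k" "j < k" for i j
            by (rule ND[OF \<open>b < Suc k\<close> that], rule ND[OF lessI that])
        qed (use Suc.prems Nk I(2) in \<open>simp_all add: N_def\<close>)
        moreover have "(- 1) ^ e * x \<in> K" if "x \<in> K" for e x
          using that subring_setD(5)[OF subfield_setD(1)[OF K]] by (cases "even e") auto
        ultimately have "(- 1) ^ (k + b) * (det (N b) / det (N k)) \<in> K" by blast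
        thus ?thesis using cof'[OF that] cof'[of k] by simp
      qed
      hence cK: "c b \<in> K" for b unfolding c_def using subring_setD(1)[OF subfield_setD(1)[OF K]] by simp
      have "lin_comb n c ss = 0\<^sub>v n" unfolding lin_comb_eq_0_iff
      proof (intro allI impI)
        fix j assume j: "j < n"
        have "(\<Sum>i<length ss. c i * ss ! i $ j) = (\<Sum>i<Suc k. c i * ss ! i $ j)"
          using Suc.prems by (intro sum.mono_neutral_right) (auto simp: c_def)
        also have "\<dots> = (\<Sum>i<Suc k. ?us ! i $ j * cof i) / cof k"
          unfolding sum_divide_distrib by (intro sum.cong) (auto simp: c_def)
        also have "\<dots> = 0" using cof(1) 0[OF j] len by simp
        finally show "(\<Sum>i<length ss. c i * ss ! i $ j) = 0" .
      qed
      hence "c k = 0" using is_basisD(3)[OF ss, of c k] cK Suc.prems by simp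
      thus False using ck by (simp add: c_def)
    qed
  qed
  from this[of "length ss"] show ?thesis by simp
qed

section \<open>Stalks of twisting sheaves\<close>

text \<open>For negative \<open>d\<close> even 0 has to be written with a denominator of degree
  \<open>- d\<close> outside \<open>P\<close>; a power of a variable outside \<open>P\<close>
  serves.\<close>

lemma twist_stalk_zero:
  assumes "P \<in> Proj"
  shows "0 \<in> twist_stalk d P"
proof -
  obtain t where t: "t \<notin> P" "homogeneous 1 t" using Proj_var[OF assms] .
  have "homogeneous (nat (- d)) (t ^ nat (- d))" using homogeneous_power[OF t(2)] by simp
  moreover have "t ^ nat (- d) \<notin> P" using t(1) Proj_power[OF assms] by simp
  ultimately have "Fract 0 (t ^ nat (- d)) \<in> twist_stalk d P"
    by (intro twist_stalkI[of "nat d"]) auto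
  moreover have "Fract 0 (t ^ nat (- d)) = 0"
    using t(1) ProjD(3)[OF assms] by (auto simp: Zero_fract_def eq_fract)
  ultimately show ?thesis by simp
qed

lemma twist_stalk_add:
  assumes P: "P \<in> Proj" and "y \<in> twist_stalk d P" "z \<in> twist_stalk d P"
  shows "y + z \<in> twist_stalk d P"
proof -
  obtain a b m n where y: "homogeneous m a" "homogeneous n b" "b \<notin> P" "int m = int n + d" "y = Fract a b"
    using assms(2) by (rule twist_stalk_obtain)
  obtain a' b' m' n' where z: "homogeneous m' a'" "homogeneous n' b'" "b' \<notin> P" "int m' = int n' + d" "z = Fract a' b'"
    using assms(3) by (rule twist_stalk_obtain)
  have nz: "b \<noteq> 0" "b' \<noteq> 0" using y(3) z(3) ProjD(3)[OF P] by auto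
  have "y + z = Fract (a * b' + a' * b) (b * b')" using y(5) z(5) nz by simp
  moreover have "homogeneous (m + n') (a * b')" by (rule homogeneous_mult[OF y(1) z(2)])
  moreover have "m + n' = m' + n" using y(4) z(4) by simp
  hence "homogeneous (m + n') (a' * b)" using homogeneous_mult[OF z(1) y(2)] by simp
  ultimately show ?thesis using y z ProjD(4)[OF P]
    by (auto intro!: twist_stalkI[of "m + n'" _ "n + n'"] homogeneous_add homogeneous_mult)
qed

lemma twist_stalk_uminus: "z \<in> twist_stalk d P \<Longrightarrow> - z \<in> twist_stalk d P"
proof (erule twist_stalk_obtain)
  fix a b m n
  assume *: "homogeneous m a" "homogeneous n b" "b \<notin> P" "int m = int n + d" "z = Fract a b"
  have "- z = Fract (- a) b" using *(5) by simp
  thus "- z \<in> twist_stalk d P" using * by (auto intro!: twist_stalkI[of m _ n])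
qed

lemma twist_stalk_mult:
  assumes P: "P \<in> Proj" and "y \<in> twist_stalk d P" "z \<in> twist_stalk e P"
  shows "y * z \<in> twist_stalk (d + e) P"
proof -
  obtain a b m n where y: "homogeneous m a" "homogeneous n b" "b \<notin> P" "int m = int n + d" "y = Fract a b"
    using assms(2) by (rule twist_stalk_obtain)
  obtain a' b' m' n' where z: "homogeneous m' a'" "homogeneous n' b'" "b' \<notin> P" "int m' = int n' + e" "z = Fract a' b'"
    using assms(3) by (rule twist_stalk_obtain)
  have "y * z = Fract (a * a') (b * b')" using y(5) z(5) by simp
  moreover have "Fract (a * a') (b * b') \<in> twist_stalk (d + e) P"
    using y z ProjD(4)[OF P] by (intro twist_stalkI[of "m + m'" _ "n + n'"] homogeneous_mult) auto
  ultimately show ?thesis by simp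
qed

lemma twist_stalk_inverse:
  assumes "z \<in> twist_stalk d generic_point" "z \<noteq> 0"
  shows "inverse z \<in> twist_stalk (- d) generic_point"
proof -
  obtain a b m n where z: "homogeneous m a" "homogeneous n b" "b \<notin> generic_point" "int m = int n + d" "z = Fract a b"
    using assms(1) by (rule twist_stalk_obtain)
  have "a \<noteq> 0" using assms(2) z(5) by (auto simp: Zero_fract_def eq_fract)
  hence "Fract b a \<in> twist_stalk (- d) generic_point"
    using z by (intro twist_stalkI[of n _ m]) (auto simp: generic_point_def)
  thus ?thesis using z(5) by simp
qed

lemma twist_stalk_one: "P \<in> Proj \<Longrightarrow> 1 \<in> twist_stalk 0 P"
  using Fract_1_twist_stalk[of P 0 1] by (simp add: One_fract_def)

lemma local_ring_subring: "P \<in> Proj \<Longrightarrow> subring_set (local_ring P)"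
  unfolding subring_set_def
  using twist_stalk_zero twist_stalk_one twist_stalk_add twist_stalk_mult[of P _ 0 _ 0] twist_stalk_uminus by auto

lemma function_field: "subfield_set (local_ring generic_point)"
  unfolding subfield_set_def
proof (intro conjI ballI local_ring_subring generic_point_Proj)
  fix z :: "'a poly3 fract" assume "z \<in> local_ring generic_point"
  thus "inverse z \<in> local_ring generic_point"
    using twist_stalk_inverse[of z 0] twist_stalk_zero[OF generic_point_Proj] by (cases "z = 0") auto
qed

lemma local_ring_subset: "P \<in> Proj \<Longrightarrow> local_ring P \<subseteq> local_ring generic_point"
  using twist_stalk_generic by blast

lemma curve_valuation_subring:
  assumes "P \<in> curves"
  shows "valuation_subring (local_ring P) (local_ring generic_point)"
  unfolding valuation_subring_def
proof (intro conjI ballI local_ring_subring function_field local_ring_subset curvesD(1)[OF assms])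
  fix z :: "'a poly3 fract" assume z: "z \<in> local_ring generic_point"
  show "z \<in> local_ring P \<or> inverse z \<in> local_ring P"
  proof (cases "z = 0")
    case True
    thus ?thesis using twist_stalk_zero[OF curvesD(1)[OF assms]] by simp
  next
    case False
    have inv: "inverse z \<in> local_ring generic_point" using twist_stalk_inverse[OF z False] by simp
    show ?thesis
      using twist_stalk_iff_valuation[OF assms z False] twist_stalk_iff_valuation[OF assms inv]
        valuation_inverse[OF assms z False] False by fastforce
  qed
qed

lemma twist_stalk_sum:
  assumes "P \<in> Proj" "\<And>i. i \<in> I \<Longrightarrow> f i \<in> twist_stalk d P"
  shows "(\<Sum>i\<in>I. f i) \<in> twist_stalk d P"
  using assms(2) by (induction I rule: infinite_finite_induct)
    (simp_all add: twist_stalk_zero[OF assms(1)] twist_stalk_add[OF assms(1)])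

lemma twist_stalk_prod:
  assumes "P \<in> Proj" "finite I" "\<And>i. i \<in> I \<Longrightarrow> f i \<in> twist_stalk d P"
  shows "(\<Prod>i\<in>I. f i) \<in> twist_stalk (int (card I) * d) P"
  using assms(2,3)
proof (induction I rule: finite_induct)
  case (insert x I)
  have "f x * (\<Prod>i\<in>I. f i) \<in> twist_stalk (d + int (card I) * d) P"
    using insert by (intro twist_stalk_mult[OF assms(1)]) auto
  moreover have "d + int (card I) * d = int (card (insert x I)) * d"
    using insert.hyps by (simp add: algebra_simps)
  ultimately show ?case using insert.hyps by simp
qed (simp add: twist_stalk_one[OF assms(1)])

lemma twist_stalk_det:
  assumes P: "P \<in> Proj" and A: "A \<in> carrier_mat r r" "\<And>i j. i < r \<Longrightarrow> j < r \<Longrightarrow> A $$ (i, j) \<in> twist_stalk d P"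
  shows "det A \<in> twist_stalk (int r * d) P"
proof -
  have "signof p * (\<Prod>i = 0..<r. A $$ (i, p i)) \<in> twist_stalk (int r * d) P" if "p permutes {0..<r}" for p
  proof -
    have "(\<Prod>i = 0..<r. A $$ (i, p i)) \<in> twist_stalk (int (card {0..<r}) * d) P"
      using A(2) permutes_in_image[OF that] by (intro twist_stalk_prod[OF P]) auto
    thus ?thesis by (simp add: sign_def twist_stalk_uminus)
  qed
  thus ?thesis unfolding det_def'[OF A(1)] by (intro twist_stalk_sum[OF P]) auto
qed

lemma common_denominator:
  assumes P: "P \<in> Proj" and "finite A" "A \<subseteq> twist_stalk d P"
  shows "\<exists>b n. homogeneous n b \<and> b \<notin> P \<and> (\<forall>z\<in>A. \<exists>a m. homogeneous m a \<and> int m = int n + d \<and> z = Fract a b)"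
  using assms(2,3)
proof (induction A rule: finite_induct)
  case empty
  show ?case using ProjD(2)[OF P] by (intro exI[of _ 1] exI[of _ 0]) simp
next
  case (insert x A)
  then obtain b n where b: "homogeneous n b" "b \<notin> P"
    "\<forall>z\<in>A. \<exists>a m. homogeneous m a \<and> int m = int n + d \<and> z = Fract a b" by auto
  have "x \<in> twist_stalk d P" using insert.prems by simp
  then obtain a' b' m' n' where x: "homogeneous m' a'" "homogeneous n' b'" "b' \<notin> P" "int m' = int n' + d" "x = Fract a' b'"
    by (rule twist_stalk_obtain)
  have nz: "b \<noteq> 0" "b' \<noteq> 0" using b(2) x(3) ProjD(3)[OF P] by auto
  have "\<exists>a m. homogeneous m a \<and> int m = int (n + n') + d \<and> z = Fract a (b * b')" if z: "z \<in> insert x A" for z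
  proof (cases "z = x")
    case True
    have "z = Fract (a' * b) (b * b')" using True x(5) nz by (simp add: eq_fract)
    thus ?thesis using homogeneous_mult[OF x(1) b(1)] x(4)
      by (intro exI[of _ "a' * b"] exI[of _ "m' + n"]) simp
  next
    case False
    then obtain a m where a: "homogeneous m a" "int m = int n + d" "z = Fract a b" using b(3) z by blast
    have "z = Fract (a * b') (b * b')" using a(3) nz by (simp add: eq_fract)
    thus ?thesis using homogeneous_mult[OF a(1) x(2)] a(2)
      by (intro exI[of _ "a * b'"] exI[of _ "m + n'"]) simp
  qed
  moreover have "homogeneous (n + n') (b * b')" by (rule homogeneous_mult[OF b(1) x(2)])
  moreover have "b * b' \<notin> P" using ProjD(4)[OF P] b(2) x(3) by blast
  ultimately show ?case by blast
qed

text \<open>Membership in finitely many stalks spreads to a neighbourhood, namely to the set where a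
  common denominator does not vanish.\<close>

lemma common_domain:
  assumes P: "P \<in> Proj" and "finite A" "A \<subseteq> twist_stalk d P"
  obtains b n where "homogeneous n b" "b \<notin> P" "\<forall>Q. b \<notin> Q \<longrightarrow> A \<subseteq> twist_stalk d Q"
proof -
  obtain b n where b: "homogeneous n b" "b \<notin> P"
    "\<forall>z\<in>A. \<exists>a m. homogeneous m a \<and> int m = int n + d \<and> z = Fract a b"
    using common_denominator[OF assms] by blast
  have "\<forall>Q. b \<notin> Q \<longrightarrow> A \<subseteq> twist_stalk d Q"
  proof (intro allI impI subsetI)
    fix Q z assume "b \<notin> Q" "z \<in> A"
    then obtain a m where "homogeneous m a" "int m = int n + d" "z = Fract a b" using b(3) by blast
    thus "z \<in> twist_stalk d Q" using twist_stalkI[of m a n b Q d] b(1) \<open>b \<notin> Q\<close> by simp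
  qed
  with b(1,2) show ?thesis by (rule that)
qed

section \<open>Open sets and stalks of coherent sheaves\<close>

lemma nonempty_open_generic: "nonempty_open U \<Longrightarrow> generic_point \<in> U"
  unfolding nonempty_open_def using generic_point_Proj ProjD(3) by (force simp: generic_point_def)

lemma nonempty_open_subset: "nonempty_open U \<Longrightarrow> U \<subseteq> Proj"
  unfolding nonempty_open_def by blast

lemma nonempty_openI: "generic_point \<in> {P \<in> Proj. \<not> A \<subseteq> P} \<Longrightarrow> nonempty_open {P \<in> Proj. \<not> A \<subseteq> P}"
  unfolding nonempty_open_def by blast

lemma nonempty_open_basic_open:
  assumes "h \<noteq> 0"
  shows "nonempty_open (basic_open h)"
proof -
  have "basic_open h = {P \<in> Proj. \<not> {h} \<subseteq> P}" unfolding basic_open_def by blast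
  moreover have "generic_point \<in> {P \<in> Proj. \<not> {h} \<subseteq> P}"
    using assms generic_point_Proj by (auto simp: generic_point_def)
  ultimately show ?thesis using nonempty_openI[of "{h}"] by simp
qed

lemma nonempty_open_Int_basic_open:
  assumes "nonempty_open U" "h \<noteq> 0"
  shows "nonempty_open (U \<inter> basic_open h)"
proof -
  obtain A where A: "U = {P \<in> Proj. \<not> A \<subseteq> P}" using assms(1) unfolding nonempty_open_def by blast
  have "U \<inter> basic_open h = {P \<in> Proj. \<not> (\<lambda>a. a * h) ` A \<subseteq> P}"
    unfolding A basic_open_def using ProjD(4) by (auto simp: image_subset_iff)
  moreover have "generic_point \<in> U \<inter> basic_open h"
    using nonempty_open_generic[OF assms(1)] nonempty_open_generic[OF nonempty_open_basic_open[OF assms(2)]] by blast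
  ultimately show ?thesis using nonempty_openI[of "(\<lambda>a. a * h) ` A"] by simp
qed

lemma basic_open_nonzero: "P \<in> basic_open h \<Longrightarrow> h \<noteq> 0"
  unfolding basic_open_def using ProjD(3) by blast

text \<open>The part of coherence that rank and \<open>c1\<close> depend on. It speaks of stalks
  only, and serves both for coherent subsheaves and for the syzygy sheaf itself.\<close>

definition locally_generated :: "nat \<Rightarrow> 'k::field sheaf \<Rightarrow> bool" where
  "locally_generated n F \<longleftrightarrow> (\<forall>P\<in>Proj. \<exists>h m vs. homogeneous m h \<and> h \<notin> P \<and> set vs \<subseteq> carrier_vec n \<and>
     (\<forall>Q\<in>basic_open h. stalk F Q = lin_span n (local_ring Q) vs))"

lemma module_sheafD:
  assumes "module_sheaf n F" "nonempty_open U"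
  shows "F U \<subseteq> carrier_vec n" "nonempty_open V \<Longrightarrow> V \<subseteq> U \<Longrightarrow> F U \<subseteq> F V"
  using assms unfolding module_sheaf_def by simp_all

text \<open>An element of the span over \<open>local_ring Q\<close> involves finitely many
  coefficients. They are regular where a common denominator \<open>b\<close> does not vanish, so the
  element is a section over \<open>basic_open h \<inter> basic_open b\<close>.\<close>

lemma coherent_locally_generated:
  assumes "coherent n F"
  shows "locally_generated n F"
  unfolding locally_generated_def
proof
  fix P :: "'a point" assume P: "P \<in> Proj"
  have F: "module_sheaf n F" using assms unfolding coherent_def by blast
  have "\<exists>h m vs. homogeneous m h \<and> m > 0 \<and> P \<in> basic_open h \<and> set vs \<subseteq> F (basic_open h) \<and>
        (\<forall>V. nonempty_open V \<and> V \<subseteq> basic_open h \<longrightarrow> F V = (\<Inter>Q\<in>V. lin_span n (local_ring Q) vs))"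
    using assms P unfolding coherent_def by simp
  then obtain h m vs where h: "homogeneous m h" "P \<in> basic_open h" "set vs \<subseteq> F (basic_open h)" and
    sections: "\<forall>V. nonempty_open V \<and> V \<subseteq> basic_open h \<longrightarrow> F V = (\<Inter>Q\<in>V. lin_span n (local_ring Q) vs)"
    by (elim exE conjE)
  have h4: "F V = (\<Inter>Q\<in>V. lin_span n (local_ring Q) vs)" if "nonempty_open V" "V \<subseteq> basic_open h" for V
    using sections that by simp
  have h0: "h \<noteq> 0" using basic_open_nonzero[OF h(2)] .
  have carrier: "set vs \<subseteq> carrier_vec n"
    using h(3) module_sheafD(1)[OF F nonempty_open_basic_open[OF h0]] by (rule subset_trans)
  have "stalk F Q = lin_span n (local_ring Q) vs" if Q: "Q \<in> basic_open h" for Q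
  proof
    have QP: "Q \<in> Proj" using Q unfolding basic_open_def by blast
    show "stalk F Q \<subseteq> lin_span n (local_ring Q) vs"
    proof
      fix v assume "v \<in> stalk F Q"
      then obtain U where U: "nonempty_open U" "Q \<in> U" "v \<in> F U" unfolding stalk_def by blast
      note V = nonempty_open_Int_basic_open[OF U(1) h0]
      have "F U \<subseteq> F (U \<inter> basic_open h)" by (rule module_sheafD(2)[OF F U(1) V Int_lower1])
      thus "v \<in> lin_span n (local_ring Q) vs" using h4[OF V Int_lower2] U(2,3) Q by blast
    qed
    show "lin_span n (local_ring Q) vs \<subseteq> stalk F Q"
    proof
      fix v assume "v \<in> lin_span n (local_ring Q) vs"
      then obtain c where c: "\<forall>i<length vs. c i \<in> local_ring Q" "v = lin_comb n c vs" by (rule lin_spanE)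
      have "c ` {..<length vs} \<subseteq> local_ring Q" using c(1) by blast
      then obtain b k where b: "b \<notin> Q" "\<forall>Q'. b \<notin> Q' \<longrightarrow> c ` {..<length vs} \<subseteq> local_ring Q'"
        using common_domain[OF QP, of "c ` {..<length vs}" 0] by (metis finite_imageI finite_lessThan)
      have b0: "b \<noteq> 0" using b(1) ProjD(3)[OF QP] by blast
      let ?V = "basic_open h \<inter> basic_open b"
      have V: "nonempty_open ?V" by (rule nonempty_open_Int_basic_open[OF nonempty_open_basic_open[OF h0] b0])
      have "v \<in> lin_span n (local_ring Q') vs" if "Q' \<in> ?V" for Q'
        unfolding c(2) using that b(2) by (intro lin_spanI) (auto simp: basic_open_def)
      hence "v \<in> F ?V" using h4[OF V Int_lower1] by blast
      moreover have "Q \<in> ?V" using Q QP b(1) unfolding basic_open_def by blast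
      ultimately show "v \<in> stalk F Q" using V unfolding stalk_def by blast
    qed
  qed
  moreover have "h \<notin> P" using h(2) unfolding basic_open_def by blast
  ultimately show "\<exists>h m vs. homogeneous m h \<and> h \<notin> P \<and> set vs \<subseteq> carrier_vec n \<and>
     (\<forall>Q\<in>basic_open h. stalk F Q = lin_span n (local_ring Q) vs)"
    using h(1) carrier by blast
qed

abbreviation rational_basis :: "nat \<Rightarrow> 'k::field sheaf \<Rightarrow> 'k poly3 fract vec list \<Rightarrow> bool" where
  "rational_basis n F ss \<equiv> stalk_basis n F generic_point ss"

lemma locally_generatedD:
  assumes "locally_generated n F" "P \<in> Proj"
  obtains h m vs where "homogeneous m h" "P \<in> basic_open h" "generic_point \<in> basic_open h" "set vs \<subseteq> carrier_vec n"
    "\<forall>Q\<in>basic_open h. stalk F Q = lin_span n (local_ring Q) vs"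
proof -
  obtain h m vs where h: "homogeneous m h" "h \<notin> P" "set vs \<subseteq> carrier_vec n"
     "\<forall>Q\<in>basic_open h. stalk F Q = lin_span n (local_ring Q) vs"
    using assms unfolding locally_generated_def by blast
  have P: "P \<in> basic_open h" using assms(2) h(2) unfolding basic_open_def by blast
  have "generic_point \<in> basic_open h"
    by (rule nonempty_open_generic[OF nonempty_open_basic_open[OF basic_open_nonzero[OF P]]])
  from that[OF h(1) P this h(3,4)] show ?thesis .
qed

lemma rational_basis_exists:
  assumes "locally_generated n F"
  obtains ss where "rational_basis n F ss"
proof -
  obtain h m vs where *: "generic_point \<in> basic_open h" "set vs \<subseteq> carrier_vec n"
    "\<forall>Q\<in>basic_open h. stalk F Q = lin_span n (local_ring Q) vs"
    using locally_generatedD[OF assms generic_point_Proj] by metis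
  obtain ss where "is_basis n (local_ring generic_point) (lin_span n (local_ring generic_point) vs) ss"
    using basis_exists[OF subfield_valuation_subring[OF function_field] *(2)] .
  with that *(1,3) show ?thesis unfolding stalk_basis_def by simp
qed

lemma curve_basis_exists:
  assumes "locally_generated n F" "P \<in> curves"
  obtains vs where "stalk_basis n F P vs"
proof -
  obtain h m us where *: "P \<in> basic_open h" "set us \<subseteq> carrier_vec n"
    "\<forall>Q\<in>basic_open h. stalk F Q = lin_span n (local_ring Q) us"
    using locally_generatedD[OF assms(1) curvesD(1)[OF assms(2)]] by metis
  obtain vs where "is_basis n (local_ring P) (lin_span n (local_ring P) us) vs"
    using basis_exists[OF curve_valuation_subring[OF assms(2)] *(2)] .
  with that *(1,3) show ?thesis unfolding stalk_basis_def by simp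
qed

lemma lin_span_mono_ring: "R \<subseteq> K \<Longrightarrow> lin_span n R vs \<subseteq> lin_span n K vs"
  unfolding lin_span_def by blast

text \<open>The neighbourhood of the curve that carries common generators also contains the generic
  point, so both stalks are spanned by the same vectors over their respective rings. Independence
  survives by \<open>basis_extend_scalars\<close>.\<close>

lemma curve_basis_rational:
  assumes F: "locally_generated n F" and P: "P \<in> curves" and vs: "stalk_basis n F P vs"
  shows "rational_basis n F vs"
proof -
  let ?R = "local_ring P" and ?K = "local_ring generic_point"
  obtain h m us where *: "P \<in> basic_open h" "generic_point \<in> basic_open h" "set us \<subseteq> carrier_vec n"
    "\<forall>Q\<in>basic_open h. stalk F Q = lin_span n (local_ring Q) us"
    using locally_generatedD[OF F curvesD(1)[OF P]] by metis
  note R = local_ring_subring[OF curvesD(1)[OF P]]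
  note K = subfield_setD(1)[OF function_field]
  note RK = lin_span_mono_ring[OF local_ring_subset[OF curvesD(1)[OF P]]]
  have eq: "lin_span n ?R vs = lin_span n ?R us"
    using vs *(1,4) is_basisD(2) unfolding stalk_basis_def by metis
  have "set vs \<subseteq> lin_span n ?R us" "set us \<subseteq> lin_span n ?R vs"
    using lin_span_superset[OF R *(3)] lin_span_superset[OF R is_basisD(1)[OF vs[unfolded stalk_basis_def]]] eq by blast+
  hence "lin_span n ?K vs = lin_span n ?K us"
    using RK by (intro equalityI lin_span_mono_subset[OF K]) blast+
  moreover have "is_basis n ?K (lin_span n ?K vs) vs"
    using basis_extend_scalars[OF curve_valuation_subring[OF P] vs[unfolded stalk_basis_def]] .
  ultimately show ?thesis using *(2,4) unfolding stalk_basis_def by simp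
qed

lemma rk_eq:
  assumes "rational_basis n F ss"
  shows "rk n F = length ss"
  unfolding rk_def
proof (rule the_equality)
  show "\<exists>vs. rational_basis n F vs \<and> length vs = length ss" using assms by blast
  show "r = length ss" if "\<exists>vs. rational_basis n F vs \<and> length vs = r" for r
    using that assms basis_length_unique[OF function_field] unfolding stalk_basis_def by blast
qed

section \<open>The first Chern class\<close>

lemma expresses_unique:
  assumes R: "subring_set R" and vs: "is_basis n R M vs" and "expresses n A R ws vs" "expresses n B R ws vs"
  shows "A = B"
proof (rule eq_matI)
  fix i j assume "i < dim_row B" "j < dim_col B"
  hence ij: "i < length ws" "j < length vs" using assms(4) unfolding expresses_def by auto
  have "lin_comb n (\<lambda>j. A $$ (i, j)) vs = lin_comb n (\<lambda>j. B $$ (i, j)) vs"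
    using assms(3,4) ij(1) unfolding expresses_def by metis
  from basis_unique_coeffs[OF R vs _ _ this ij(2)] show "A $$ (i, j) = B $$ (i, j)"
    using assms(3,4) ij(1) unfolding expresses_def by blast
qed (use assms(3,4) in \<open>auto simp: expresses_def\<close>)

lemma valuation_1: "P \<in> curves \<Longrightarrow> valuation P 1 = 0"
  unfolding One_fract_def using ProjD(2)[OF curvesD(1), of P] by (intro valuation_notin)

lemma rational_change_of_basis:
  assumes "rational_basis n F ss" "rational_basis n F vs"
  obtains A where "expresses n A (local_ring generic_point) ss vs" "det A \<noteq> 0" "det A \<in> local_ring generic_point"
    "length ss = length vs"
proof -
  let ?K = "local_ring generic_point"
  note K = subfield_setD(1)[OF function_field]
  note b = assms[unfolded stalk_basis_def]
  have len: "length ss = length vs" using basis_length_unique[OF function_field b(2,1)] .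
  obtain A where A: "expresses n A ?K ss vs"
    using expresses_exists basis_subset[OF K b(1)] is_basisD(2)[OF b(2)] by blast
  obtain B where "det A * det B = 1" "det A \<in> ?K"
    using expresses_bases_inverse[OF K b(2,1) len A] .
  with A len that show ?thesis by fastforce
qed

text \<open>The definite description in \<open>det_order\<close> is legitimate: another stalk basis
  changes the determinant by a unit of the local ring, which has valuation 0.\<close>

lemma det_order_eq:
  assumes F: "locally_generated n F" and P: "P \<in> curves" and ss: "rational_basis n F ss"
    and vs: "stalk_basis n F P vs" and A: "expresses n A (local_ring generic_point) ss vs"
  shows "det_order n F ss P = valuation P (det A)"
proof -
  let ?R = "local_ring P" and ?K = "local_ring generic_point"
  note R = local_ring_subring[OF curvesD(1)[OF P]]
  note K = subfield_setD(1)[OF function_field]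
  note RK = local_ring_subset[OF curvesD(1)[OF P]]
  have len: "length us = length ss" if "stalk_basis n F P us" for us
    using rk_eq[OF curve_basis_rational[OF F P that]] rk_eq[OF ss] by simp
  define good where "good v us B \<longleftrightarrow> stalk_basis n F P us \<and>
     B \<in> carrier_mat (length ss) (length us) \<and> length us = length ss \<and>
     (\<forall>i<length ss. \<forall>j<length us. B $$ (i, j) \<in> ?K) \<and>
     (\<forall>i<length ss. ss ! i = lin_comb n (\<lambda>j. B $$ (i, j)) us) \<and> v = valuation P (det B)" for v us B
  have "good (valuation P (det A)) vs A"
    using vs len[OF vs] A unfolding good_def expresses_def by blast
  moreover have "v = valuation P (det A)" if "good v us B" for v us B
  proof -
    have us: "stalk_basis n F P us" and B: "expresses n B ?K ss us" and v: "v = valuation P (det B)"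
      using that unfolding good_def expresses_def by blast+
    note bs = us[unfolded stalk_basis_def] vs[unfolded stalk_basis_def]
    obtain C where C: "expresses n C ?R us vs"
      using expresses_exists basis_subset[OF R bs(1)] is_basisD(2)[OF bs(2)] by blast
    obtain C' where C': "det C * det C' = 1" "det C \<in> ?R" "det C' \<in> ?R"
      using expresses_bases_inverse[OF R bs(2,1) _ C] len[OF us] len[OF vs] by metis
    have CK: "expresses n C ?K us vs" by (rule expresses_mono[OF RK C])
    have vsK: "is_basis n ?K (stalk F generic_point) vs"
      using curve_basis_rational[OF F P vs] unfolding stalk_basis_def .
    have "A = B * C" by (rule expresses_unique[OF K vsK A expresses_trans[OF K B CK]])
    moreover have "B \<in> carrier_mat (length ss) (length ss)" "C \<in> carrier_mat (length ss) (length ss)"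
      using B C len[OF us] len[OF vs] unfolding expresses_def by auto
    ultimately have det: "det A = det B * det C" by (simp add: det_mult)
    obtain B' where "expresses n B' ?K ss us" "det B' \<noteq> 0" "det B' \<in> ?K"
      using rational_change_of_basis[OF ss curve_basis_rational[OF F P us]] by metis
    moreover have "is_basis n ?K (stalk F generic_point) us"
      using curve_basis_rational[OF F P us] unfolding stalk_basis_def .
    ultimately have B0: "det B \<noteq> 0" "det B \<in> ?K" using expresses_unique[OF K _ B] by auto
    have C0: "det C \<noteq> 0" "det C' \<noteq> 0" using C'(1) by auto
    have CK': "det C \<in> ?K" "det C' \<in> ?K" using C'(2,3) RK by auto
    have "valuation P (det C) \<ge> 0" "valuation P (det C') \<ge> 0"
      using twist_stalk_iff_valuation[OF P CK'(1) C0(1)] twist_stalk_iff_valuation[OF P CK'(2) C0(2)] C'(2,3) by auto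
    moreover have "valuation P (det C) + valuation P (det C') = 0"
      using valuation_mult[OF P CK'(1) C0(1) CK'(2) C0(2)] C'(1) valuation_1[OF P] by simp
    ultimately have "valuation P (det C) = 0" by simp
    thus ?thesis using v det valuation_mult[OF P B0(2,1) CK'(1) C0(1)] by simp
  qed
  ultimately have "(THE v. \<exists>us B. good v us B) = valuation P (det A)"
    by (intro the_equality) blast+
  thus ?thesis unfolding det_order_def good_def .
qed

text \<open>Generators on an open set and a rational basis express each other with finitely many
  coefficients. Off the curves on which \<open>h\<close> or a common denominator \<open>b\<close>
  vanishes, the rational basis is therefore a basis of the stalk and has order 0.\<close>

lemma det_order_finite_support:
  assumes F: "locally_generated n F" and ss: "rational_basis n F ss"
  obtains T where "finite T" "T \<subseteq> curves" "\<forall>P\<in>curves - T. det_order n F ss P = 0"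
proof -
  let ?K = "local_ring generic_point"
  note K = subfield_setD(1)[OF function_field]
  note ssb = ss[unfolded stalk_basis_def]
  obtain h m us where h: "homogeneous m h" "generic_point \<in> basic_open h" "set us \<subseteq> carrier_vec n"
    "\<forall>Q\<in>basic_open h. stalk F Q = lin_span n (local_ring Q) us"
    using locally_generatedD[OF F generic_point_Proj] by metis
  have eq: "stalk F generic_point = lin_span n ?K us" "stalk F generic_point = lin_span n ?K ss"
    using h(2,4) is_basisD(2)[OF ssb] by blast+
  obtain B where B: "expresses n B ?K us ss"
    using expresses_exists lin_span_superset[OF K h(3)] eq by blast
  obtain C where C: "expresses n C ?K ss us"
    using expresses_exists basis_subset[OF K ssb] eq(1) by blast
  let ?A = "(\<lambda>(i, j). B $$ (i, j)) ` ({..<length us} \<times> {..<length ss}) \<union>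
            (\<lambda>(i, j). C $$ (i, j)) ` ({..<length ss} \<times> {..<length us})"
  have "?A \<subseteq> ?K" using B C unfolding expresses_def by auto
  moreover have "finite ?A" by simp
  ultimately obtain b k where b: "homogeneous k b" "b \<notin> generic_point" "\<forall>Q. b \<notin> Q \<longrightarrow> ?A \<subseteq> local_ring Q"
    using common_domain[OF generic_point_Proj, of ?A 0] by metis
  define T where "T = {P \<in> curves. h * b \<in> P}"
  have "h * b \<noteq> 0" using basic_open_nonzero[OF h(2)] b(2) by (auto simp: generic_point_def)
  hence "finite T" unfolding T_def using degree_formula_form[OF homogeneous_mult[OF h(1) b(1)]] by blast
  moreover have "T \<subseteq> curves" unfolding T_def by blast
  moreover have "det_order n F ss P = 0" if P: "P \<in> curves - T" for P
  proof -
    have Pc: "P \<in> curves" using P by blast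
    note PP = curvesD(1)[OF Pc]
    let ?R = "local_ring P"
    note R = local_ring_subring[OF PP]
    have hb: "h \<notin> P" "b \<notin> P" using P ProjD(4)[OF PP] unfolding T_def by blast+
    have AR: "?A \<subseteq> ?R" using b(3) hb(2) by blast
    have "expresses n B ?R us ss" "expresses n C ?R ss us"
      using B C AR unfolding expresses_def by (auto simp: image_subset_iff)
    hence "set us \<subseteq> lin_span n ?R ss" "set ss \<subseteq> lin_span n ?R us"
      unfolding expresses_def by (auto simp: in_set_conv_nth intro!: lin_spanI)
    hence "lin_span n ?R us = lin_span n ?R ss"
      by (intro equalityI lin_span_mono_subset[OF R])
    moreover have "P \<in> basic_open h" using PP hb(1) unfolding basic_open_def by blast
    ultimately have "stalk F P = lin_span n ?R ss" using h(4) by simp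
    hence vs: "stalk_basis n F P ss"
      using ssb local_ring_subset[OF PP] unfolding stalk_basis_def is_basis_def by blast
    have "set ss \<subseteq> lin_span n ?K ss" using basis_subset[OF K ssb] eq(2) by simp
    then obtain E where E: "expresses n E ?K ss ss" by (rule expresses_exists)
    have "E = 1\<^sub>m (length ss)" by (rule expresses_self_unique[OF K ssb E])
    thus ?thesis using det_order_eq[OF F Pc ss vs E] valuation_1[OF Pc] by simp
  qed
  ultimately show ?thesis using that by blast
qed

lemma det_order_change_of_basis:
  assumes F: "locally_generated n F" and P: "P \<in> curves" and ss: "rational_basis n F ss"
    and ss': "rational_basis n F ss'" and T: "expresses n T (local_ring generic_point) ss' ss"
  shows "det_order n F ss' P = valuation P (det T) + det_order n F ss P"
proof -
  let ?K = "local_ring generic_point"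
  note K = subfield_setD(1)[OF function_field]
  obtain vs where vs: "stalk_basis n F P vs" using curve_basis_exists[OF F P] .
  note vs' = curve_basis_rational[OF F P vs]
  obtain A where A: "expresses n A ?K ss vs" "det A \<noteq> 0" "det A \<in> ?K" "length ss = length vs"
    using rational_change_of_basis[OF ss vs'] .
  obtain T' where T': "expresses n T' ?K ss' ss" "det T' \<noteq> 0" "det T' \<in> ?K" "length ss' = length ss"
    using rational_change_of_basis[OF ss' ss] .
  have T_eq: "T' = T" using expresses_unique[OF K ss[unfolded stalk_basis_def] T'(1) T] .
  have "T \<in> carrier_mat (length ss) (length ss)" "A \<in> carrier_mat (length ss) (length ss)"
    using T A T'(4) unfolding expresses_def by auto
  hence "det (T * A) = det T * det A" by (rule det_mult)
  moreover have "det_order n F ss' P = valuation P (det (T * A))"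
    by (rule det_order_eq[OF F P ss' vs expresses_trans[OF K T A(1)]])
  moreover have "det_order n F ss P = valuation P (det A)" by (rule det_order_eq[OF F P ss vs A(1)])
  ultimately show ?thesis
    using valuation_mult[OF P T'(3)[unfolded T_eq] T'(2)[unfolded T_eq] A(3,2)] by simp
qed

text \<open>Another rational basis changes the orders by the divisor of a determinant in the
  function field, and such a divisor has degree 0.\<close>

lemma c1_eq:
  assumes F: "locally_generated n F" and ss: "rational_basis n F ss"
    and S: "finite S" "S \<subseteq> curves" "\<forall>P\<in>curves - S. det_order n F ss P = 0"
  shows "c1 n F = (\<Sum>P\<in>S. int (curve_degree P) * det_order n F ss P)"
proof -
  define sum_over where "sum_over us = (\<Sum>P\<in>{P \<in> curves. det_order n F us P \<noteq> 0}.
    int (curve_degree P) * det_order n F us P)" for us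
  have sum_eq: "sum_over us = (\<Sum>P\<in>S'. int (curve_degree P) * det_order n F us P)"
    if "finite S'" "S' \<subseteq> curves" "\<forall>P\<in>curves - S'. det_order n F us P = 0" for us S'
    unfolding sum_over_def using that by (intro sum.mono_neutral_left) auto
  have "sum_over us = sum_over ss" if us: "rational_basis n F us" for us
  proof -
    obtain T0 where T0: "finite T0" "T0 \<subseteq> curves" "\<forall>P\<in>curves - T0. det_order n F us P = 0"
      using det_order_finite_support[OF F us] .
    obtain A where A: "expresses n A (local_ring generic_point) us ss" "det A \<noteq> 0"
      "det A \<in> local_ring generic_point" using rational_change_of_basis[OF us ss] .
    obtain T1 where T1: "finite T1" "T1 \<subseteq> curves"
      "\<forall>S. finite S \<and> T1 \<subseteq> S \<and> S \<subseteq> curves \<longrightarrow> (\<Sum>P\<in>S. int (curve_degree P) * valuation P (det A)) = 0"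
      by (rule degree_formula[OF A(3,2)])
    let ?S = "S \<union> T0 \<union> T1"
    have fin: "finite ?S" and sub: "?S \<subseteq> curves" using S T0 T1 by auto
    have "sum_over us = (\<Sum>P\<in>?S. int (curve_degree P) * det_order n F us P)"
      using T0 by (intro sum_eq fin sub) blast
    also have "\<dots> = (\<Sum>P\<in>?S. int (curve_degree P) * valuation P (det A) + int (curve_degree P) * det_order n F ss P)"
    proof (rule sum.cong[OF refl])
      fix P assume "P \<in> ?S"
      hence "P \<in> curves" using sub by blast
      from det_order_change_of_basis[OF F this ss us A(1)]
      show "int (curve_degree P) * det_order n F us P =
        int (curve_degree P) * valuation P (det A) + int (curve_degree P) * det_order n F ss P"
        by (simp only: distrib_left)
    qed
    also have "\<dots> = 0 + (\<Sum>P\<in>?S. int (curve_degree P) * det_order n F ss P)"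
      unfolding sum.distrib using T1(3) fin sub by simp
    also have "(\<Sum>P\<in>?S. int (curve_degree P) * det_order n F ss P) = sum_over ss"
      using S(3) by (intro sum_eq[symmetric] fin sub) blast
    finally show ?thesis by simp
  qed
  hence "c1 n F = sum_over ss"
    unfolding c1_def sum_over_def[symmetric] using ss by (intro the_equality) blast+
  thus ?thesis using sum_eq[OF S] by simp
qed

section \<open>An upper bound for the first Chern class\<close>

lemma minor_twist_stalk:
  assumes P: "P \<in> Proj" and "\<And>i j. i < length vs \<Longrightarrow> j < n \<Longrightarrow> vs ! i $ j \<in> twist_stalk \<delta> P"
    and "\<forall>a<length vs. I a < n"
  shows "minor vs I \<in> twist_stalk (int (length vs) * \<delta>) P"
  unfolding minor_def using assms(2,3) by (intro twist_stalk_det[OF P]) auto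

text \<open>The entries have degree \<delta> and need not lie in the function field, over which the
  basis is independent. Determinants of equal size have equal degree, so their quotients do lie
  there.\<close>

lemma rational_basis_minor_nonzero:
  assumes ss: "rational_basis n F ss"
    and D: "\<And>i j. i < length ss \<Longrightarrow> j < n \<Longrightarrow> ss ! i $ j \<in> twist_stalk \<delta> generic_point"
  shows "\<exists>I. (\<forall>a<length ss. I a < n) \<and> minor ss I \<noteq> 0"
proof (rule minor_nonzero_exists[OF function_field ss[unfolded stalk_basis_def] _ D])
  fix k and A B :: "'a poly3 fract mat"
  assume A: "A \<in> carrier_mat k k" "\<And>i j. i < k \<Longrightarrow> j < k \<Longrightarrow> A $$ (i, j) \<in> twist_stalk \<delta> generic_point"
    and B: "B \<in> carrier_mat k k" "\<And>i j. i < k \<Longrightarrow> j < k \<Longrightarrow> B $$ (i, j) \<in> twist_stalk \<delta> generic_point"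
    and B0: "det B \<noteq> 0"
  have "det A * inverse (det B) \<in> twist_stalk (int k * \<delta> + - (int k * \<delta>)) generic_point"
    by (intro twist_stalk_mult twist_stalk_inverse twist_stalk_det generic_point_Proj A B B0)
  thus "det A / det B \<in> local_ring generic_point" by (simp add: divide_inverse)
qed

text \<open>With \<open>W\<close> the primitive polynomial vector proportional to the minors of a rational basis,
  \<open>c\<^sub>1(F)\<close> is at most the degree of the line bundle that \<open>det F\<close> generates generically in the
  exterior power of the ambient sum of twisting sheaves.\<close>
lemma c1_bound:
  assumes F: "locally_generated n F" and ss: "rational_basis n F ss"
    and \<delta>: "\<And>P v j. P \<in> Proj \<Longrightarrow> v \<in> stalk F P \<Longrightarrow> j < n \<Longrightarrow> v $ j \<in> twist_stalk \<delta> P"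
  obtains e W z where "c1 n F \<le> int (length ss) * \<delta> - int e" "z \<noteq> 0"
    "\<forall>I. (\<forall>a<length ss. I a < n) \<longrightarrow> homogeneous e (W I) \<and> Fract (W I) 1 = z * minor ss I"
proof -
  let ?r = "length ss" and ?\<eta> = "generic_point :: 'a point"
  note ssb = ss[unfolded stalk_basis_def]
  have basis_entries: "vs ! i $ j \<in> twist_stalk \<delta> P"
    if "stalk_basis n F P vs" "P \<in> Proj" "i < length vs" "j < n" for P vs i j
    using basis_subset[OF local_ring_subring[OF that(2)] that(1)[unfolded stalk_basis_def]] nth_mem[OF that(3)]
    by (intro \<delta> that(2,4)) blast
  \<comment> \<open>Extensional index functions, a finite set. Finiteness is what provides one
    common denominator \<open>D\<close> for all minors.\<close>
  define Is where "Is = PiE {..<?r} (\<lambda>_. {..<n})"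
  have fin: "finite Is" unfolding Is_def by (intro finite_PiE) auto
  have Is_less: "\<forall>a<?r. I a < n" if "I \<in> Is" for I using that unfolding Is_def by auto
  have restr: "restrict I {..<?r} \<in> Is" if "\<forall>a<?r. I a < n" for I
    using that unfolding Is_def by auto
  have minor_restr: "minor ss (restrict I {..<?r}) = minor ss I" for I by (intro minor_cong) simp
  have tw: "minor ss ` Is \<subseteq> twist_stalk (int ?r * \<delta>) ?\<eta>"
    using Is_less basis_entries[OF ss generic_point_Proj] minor_twist_stalk[OF generic_point_Proj] by blast
  obtain D q where D: "homogeneous q D" "D \<notin> ?\<eta>"
    "\<forall>z\<in>minor ss ` Is. \<exists>a m. homogeneous m a \<and> int m = int q + int ?r * \<delta> \<and> z = Fract a D"
    using common_denominator[OF generic_point_Proj finite_imageI[OF fin] tw] by blast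
  have D0: "D \<noteq> 0" using D(2) by (auto simp: generic_point_def)
  define p where "p = nat (int q + int ?r * \<delta>)"
  have "\<exists>a. homogeneous p a \<and> minor ss I = Fract a D" if I: "I \<in> Is" for I
  proof -
    obtain a m where "homogeneous m a" "int m = int q + int ?r * \<delta>" "minor ss I = Fract a D"
      using bspec[OF D(3) imageI[OF I]] by (elim exE conjE)
    moreover from this have "m = p" unfolding p_def by simp
    ultimately show ?thesis by blast
  qed
  then obtain N where N: "\<And>I. I \<in> Is \<Longrightarrow> homogeneous p (N I)" "\<And>I. I \<in> Is \<Longrightarrow> minor ss I = Fract (N I) D"
    by metis
  obtain I0 where I0: "I0 \<in> Is" "minor ss I0 \<noteq> 0"
    using rational_basis_minor_nonzero[OF ss basis_entries[OF ss generic_point_Proj]] restr minor_restr by metis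
  have N0: "N I0 \<noteq> 0" using I0 N(2) by (auto simp: Zero_fract_def eq_fract)
  have p: "int p = int q + int ?r * \<delta>"
  proof -
    obtain m where "int m = int q + int ?r * \<delta>" using bspec[OF D(3) imageI[OF I0(1)]] by (elim exE conjE)
    thus ?thesis unfolding p_def by simp
  qed
  \<comment> \<open>Instead of a greatest common divisor, a common divisor \<open>g\<close> among
    the forms of greatest degree \<open>a\<close> is used. Degrees are bounded by that of the
    nonzero numerator \<open>N I0\<close>.\<close>
  define common where "common a g \<longleftrightarrow> homogeneous a g \<and> (\<forall>I\<in>Is. g dvd N I)" for a g
  have common_le: "a \<le> p" if "common a g" for a g
  proof -
    have "g dvd N I0" using that I0(1) unfolding common_def by simp
    then obtain h where "N I0 = g * h" by (rule dvdE)
    thus ?thesis using homogeneous_cofactor(1)[of p g h a] N(1)[OF I0(1)] N0 that unfolding common_def by simp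
  qed
  define a where "a = (GREATEST a. \<exists>g. common a g)"
  have ex: "\<exists>g. common 0 g" unfolding common_def by (intro exI[of _ 1]) simp
  have le_p: "b \<le> p" if "\<exists>g. common b g" for b using that common_le by blast
  have a: "\<exists>g. common a g" unfolding a_def by (rule GreatestI_nat[where P = "\<lambda>a. \<exists>g. common a g", OF ex le_p])
  have a_max: "b \<le> a" if "\<exists>g. common b g" for b
    unfolding a_def by (rule Greatest_le_nat[where P = "\<lambda>a. \<exists>g. common a g", OF that le_p])
  obtain g where g: "common a g" using a by blast
  define e where "e = p - a"
  have ap: "a \<le> p" using common_le[OF g] .
  have g_dvd: "\<forall>I\<in>Is. \<exists>w. N I = g * w" using g unfolding common_def dvd_def by simp
  then obtain W where W: "\<And>I. I \<in> Is \<Longrightarrow> N I = g * W I" by metis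
  have g0: "g \<noteq> 0" using W[OF I0(1)] N0 by auto
  have W_hom: "homogeneous e (W I)" if "I \<in> Is" for I
  proof (cases "W I = 0")
    case False
    thus ?thesis using homogeneous_cofactor(2)[of p g "W I" a] N(1)[OF that] W[OF that] g g0
      unfolding common_def e_def by simp
  qed simp
  \<comment> \<open>The common factor of the minors, a fraction of degree \<open>a - q\<close>. The
    remaining forms \<open>W I\<close> have no common factor.\<close>
  define y where "y = Fract g D"
  have y0: "y \<noteq> 0" unfolding y_def using g0 D0 by (rule Fract_nonzero)
  have y_tw: "y \<in> twist_stalk (int a - int q) ?\<eta>"
    unfolding y_def using g D(1,2) unfolding common_def by (intro twist_stalkI[of a _ q]) auto
  have minor_W: "minor ss I = y * Fract (W I) 1" if "I \<in> Is" for I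
    using N(2)[OF that] W[OF that] unfolding y_def by simp
  have le: "det_order n F ss P \<le> valuation P y" if P: "P \<in> curves" for P
  proof -
    \<comment> \<open>Otherwise \<open>g * curve_eq P\<close> would be a common divisor of larger
      degree than \<open>g\<close>. At this index the minor of \<open>ss\<close> has the order of
      \<open>y\<close>, while that of a stalk basis has nonnegative order.\<close>
    have "\<exists>I\<in>Is. W I \<notin> P"
    proof (rule ccontr)
      assume "\<not> (\<exists>I\<in>Is. W I \<notin> P)"
      hence "curve_eq P dvd W I" if "I \<in> Is" for I using that curve_mem_iff[OF P] by blast
      hence "common (a + curve_degree P) (g * curve_eq P)"
        using g homogeneous_mult[of a g _ "curve_eq P"] curvesD(5)[OF P] W unfolding common_def
        by (simp add: mult_dvd_mono)
      hence "a + curve_degree P \<le> a" using a_max by blast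
      thus False using curvesD(6)[OF P] by simp
    qed
    then obtain I where I: "I \<in> Is" "W I \<notin> P" by blast
    have W0: "W I \<noteq> 0" using I(2) ProjD(3)[OF curvesD(1)[OF P]] by auto
    note W_tw = Fract_1_twist_stalk[OF generic_point_Proj W_hom[OF I(1)]]
    have "valuation P (Fract (W I) 1) = 0"
      using I(2) ProjD(2)[OF curvesD(1)[OF P]] by (rule valuation_notin[OF P])
    hence val: "valuation P (minor ss I) = valuation P y"
      unfolding minor_W[OF I(1)] using valuation_mult[OF P y_tw y0 W_tw] Fract_nonzero[OF W0] by simp
    obtain vs where vs: "stalk_basis n F P vs" using curve_basis_exists[OF F P] .
    obtain A where A: "expresses n A (local_ring ?\<eta>) ss vs" "det A \<noteq> 0" "det A \<in> local_ring ?\<eta>" "?r = length vs"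
      using rational_change_of_basis[OF ss curve_basis_rational[OF F P vs]] .
    have m: "minor ss I = det A * minor vs I"
      using Is_less[OF I(1)] by (intro minor_expresses[OF A(1,4)]) blast
    have "minor ss I \<noteq> 0" unfolding minor_W[OF I(1)] using y0 Fract_nonzero[OF W0] by simp
    hence vs0: "minor vs I \<noteq> 0" using m by auto
    have vs_tw: "minor vs I \<in> twist_stalk (int (length vs) * \<delta>) P"
      using Is_less[OF I(1)] A(4)
      by (intro minor_twist_stalk[OF curvesD(1)[OF P]] basis_entries[OF vs curvesD(1)[OF P]]) auto
    note vs_tw' = twist_stalk_generic[OF curvesD(1)[OF P] vs_tw]
    have "valuation P (minor vs I) \<ge> 0" using twist_stalk_iff_valuation[OF P vs_tw' vs0] vs_tw by simp
    moreover have "valuation P (minor ss I) = valuation P (det A) + valuation P (minor vs I)"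
      unfolding m by (rule valuation_mult[OF P A(3,2) vs_tw' vs0])
    ultimately show ?thesis using val det_order_eq[OF F P ss vs A(1)] by simp
  qed
  obtain T0 where T0: "finite T0" "T0 \<subseteq> curves" "\<forall>P\<in>curves - T0. det_order n F ss P = 0"
    using det_order_finite_support[OF F ss] .
  obtain T1 where T1: "finite T1" "T1 \<subseteq> curves" "\<forall>S. finite S \<and> T1 \<subseteq> S \<and> S \<subseteq> curves \<longrightarrow>
      (\<Sum>P\<in>S. int (curve_degree P) * valuation P y) = int a - int q"
    using degree_formula[OF y_tw y0] .
  have "c1 n F = (\<Sum>P\<in>T0 \<union> T1. int (curve_degree P) * det_order n F ss P)"
    using T0 T1 by (intro c1_eq[OF F ss]) auto
  also have "\<dots> \<le> (\<Sum>P\<in>T0 \<union> T1. int (curve_degree P) * valuation P y)"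
    using le T0(2) T1(2) by (intro sum_mono mult_left_mono) auto
  also have "\<dots> = int a - int q" using T0 T1 by simp
  \<comment> \<open>From \<open>e = p - a\<close> and \<open>p = q + r * \<delta>\<close>, where
    \<open>p\<close> is the degree of the numerators.\<close>
  also have "\<dots> = int ?r * \<delta> - int e" unfolding e_def using p ap by simp
  finally have bound: "c1 n F \<le> int ?r * \<delta> - int e" .
  show ?thesis
  proof (rule that[OF bound, of "inverse y" "\<lambda>I. W (restrict I {..<?r})"])
    show "inverse y \<noteq> 0" using y0 by simp
    show "\<forall>I. (\<forall>a<?r. I a < n) \<longrightarrow> homogeneous e (W (restrict I {..<?r})) \<and>
        Fract (W (restrict I {..<?r})) 1 = inverse y * minor ss I"
    proof (intro allI impI)
      fix I assume I: "\<forall>a<?r. I a < n"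
      have "minor ss I = y * Fract (W (restrict I {..<?r})) 1"
        using minor_W[OF restr[OF I]] minor_restr by simp
      thus "homogeneous e (W (restrict I {..<?r})) \<and> Fract (W (restrict I {..<?r})) 1 = inverse y * minor ss I"
        using W_hom[OF restr[OF I]] y0 by simp
    qed
  qed
qed

section \<open>Syzygy sheaves\<close>

declare inverse_fract [simp del]

abbreviation to_frac :: "'k::field poly3 \<Rightarrow> 'k poly3 fract" where
  "to_frac f \<equiv> Fract f 1"

lemma to_frac_sum: "to_frac (\<Sum>i\<in>I. f i) = (\<Sum>i\<in>I. to_frac (f i))"
proof (induction I rule: infinite_finite_induct)
  case (insert x I)
  have "to_frac (f x + (\<Sum>i\<in>I. f i)) = to_frac (f x) + to_frac (\<Sum>i\<in>I. f i)" by simp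
  thus ?case using insert by simp
qed (simp_all add: Zero_fract_def)

lemma to_frac_eq_iff: "to_frac a = to_frac b \<longleftrightarrow> a = b"
  by (simp add: eq_fract)

lemma to_frac_0: "to_frac 0 = 0"
  by (simp add: Zero_fract_def)

text \<open>Where \<open>fs ! i\<close> does not vanish, the kernel is spanned by the relations that
  solve for the \<open>i\<close>-th entry. The extra factor
  \<open>inverse (to_frac (fs ! i))\<close> puts all entries in degree \<open>- d\<close>; \<kappa>
  enumerates the indices other than \<open>i\<close>.\<close>

definition syz_basis :: "'k::field poly3 list \<Rightarrow> nat \<Rightarrow> (nat \<Rightarrow> nat) \<Rightarrow> 'k poly3 fract vec list" where
  "syz_basis fs i \<kappa> = map (\<lambda>k. vec (length fs) (\<lambda>l. if l = \<kappa> k then inverse (to_frac (fs ! i))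
     else if l = i then - (to_frac (fs ! \<kappa> k) * inverse (to_frac (fs ! i)) * inverse (to_frac (fs ! i))) else 0))
     [0..<length fs - 1]"

lemma length_syz_basis [simp]: "length (syz_basis fs i \<kappa>) = length fs - 1"
  by (simp add: syz_basis_def)

lemma twist_singleton: "twist d {P} = twist_stalk d P"
  by (simp add: twist_def)

lemma twist_D: "z \<in> twist d V \<Longrightarrow> P \<in> V \<Longrightarrow> z \<in> twist_stalk d P"
  by (simp add: twist_def)

lemma twistI: "(\<And>P. P \<in> V \<Longrightarrow> z \<in> twist_stalk d P) \<Longrightarrow> z \<in> twist d V"
  by (simp add: twist_def)

lemma twist_mult:
  assumes "V \<subseteq> Proj" "y \<in> twist d V" "z \<in> twist e V"
  shows "y * z \<in> twist (d + e) V"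
proof (rule twistI)
  fix P assume P: "P \<in> V"
  show "y * z \<in> twist_stalk (d + e) P"
    by (rule twist_stalk_mult[OF subsetD[OF assms(1) P] twist_D[OF assms(2) P] twist_D[OF assms(3) P]])
qed

lemma twist_add:
  assumes "V \<subseteq> Proj" "y \<in> twist d V" "z \<in> twist d V"
  shows "y + z \<in> twist d V"
proof (rule twistI)
  fix P assume P: "P \<in> V"
  show "y + z \<in> twist_stalk d P"
    by (rule twist_stalk_add[OF subsetD[OF assms(1) P] twist_D[OF assms(2) P] twist_D[OF assms(3) P]])
qed

lemma twist_uminus: "z \<in> twist d V \<Longrightarrow> - z \<in> twist d V"
  by (rule twistI, rule twist_stalk_uminus, rule twist_D)

lemma twist_sum:
  assumes "V \<subseteq> Proj" "\<And>i. i \<in> I \<Longrightarrow> f i \<in> twist d V"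
  shows "(\<Sum>i\<in>I. f i) \<in> twist d V"
proof (rule twistI)
  fix P assume P: "P \<in> V"
  show "(\<Sum>i\<in>I. f i) \<in> twist_stalk d P"
    by (rule twist_stalk_sum[OF subsetD[OF assms(1) P] twist_D[OF assms(2) P]])
qed

lemma twist_to_frac: "V \<subseteq> Proj \<Longrightarrow> homogeneous d f \<Longrightarrow> to_frac f \<in> twist (int d) V"
  unfolding twist_def by (intro INT_I Fract_1_twist_stalk) blast+

lemma twist_inverse_to_frac:
  "V \<subseteq> basic_open f \<Longrightarrow> homogeneous d f \<Longrightarrow> inverse (to_frac f) \<in> twist (- int d) V"
  unfolding twist_def inverse_fract
  by (intro INT_I twist_stalkI[of 0 1 d]) (auto simp: basic_open_def)

text \<open>The last assumption is the geometric form of the condition on the radical: the forms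
  generate the structure sheaf, so their kernel is a bundle.\<close>

locale syzygies =
  fixes fs :: "'k::field poly3 list" and n d :: nat
  assumes length_fs: "length fs = n"
    and homogeneous_fs: "\<And>i. i < n \<Longrightarrow> homogeneous d (fs ! i)"
    and no_common_zero: "\<And>P. P \<in> Proj \<Longrightarrow> \<exists>i<n. fs ! i \<notin> P"
begin

abbreviation "E \<equiv> Syz (replicate n d) fs"
abbreviation "f i \<equiv> to_frac (fs ! i)"

lemma mem_E: "v \<in> E U \<longleftrightarrow> v \<in> carrier_vec n \<and> (\<forall>i<n. v $ i \<in> twist (- int d) U) \<and> (\<Sum>i<n. f i * v $ i) = 0"
  by (simp add: Syz_def length_fs)

text \<open>The entries other than the \<open>i\<close>-th can be prescribed freely, and the syzygy
  relation then determines the \<open>i\<close>-th. \<open>V\<close> is an arbitrary nonempty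
  subset, so that \<open>V = {P}\<close> gives bases of the stalks.\<close>

lemma syz_basis_is_basis:
  assumes V: "V \<noteq> {}" "V \<subseteq> basic_open (fs ! i)" and i: "i < n" and \<kappa>: "bij_betw \<kappa> {..<n - 1} ({..<n} - {i})"
  shows "is_basis n (regular_functions V) (E V) (syz_basis fs i \<kappa>)"
proof -
  let ?vs = "syz_basis fs i \<kappa>" and ?F = "inverse (f i)"
  have VP: "V \<subseteq> Proj" using V(2) by (auto simp: basic_open_def)
  have fi0: "f i \<noteq> 0"
    using V basic_open_nonzero[of _ "fs ! i"] by (auto simp: Zero_fract_def eq_fract)
  have inj: "\<kappa> k = \<kappa> k' \<longleftrightarrow> k = k'" if "k < n - 1" "k' < n - 1" for k k'
    using \<kappa> that unfolding bij_betw_def inj_on_def by auto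
  have range: "\<kappa> k < n" "\<kappa> k \<noteq> i" if "k < n - 1" for k
    using bij_betw_apply[OF \<kappa>, of k] that by auto
  have surj: "\<exists>k<n - 1. j = \<kappa> k" if "j < n" "j \<noteq> i" for j
    using \<kappa> that unfolding bij_betw_def by (metis DiffI imageE lessThan_iff singletonD)
  have entry: "?vs ! k $ l = (if l = \<kappa> k then ?F else if l = i then - (f (\<kappa> k) * ?F * ?F) else 0)"
    if "k < n - 1" "l < n" for k l
    using that length_fs by (simp add: syz_basis_def)
  have carrier: "set ?vs \<subseteq> carrier_vec n" by (auto simp: syz_basis_def length_fs)
  have comb_\<kappa>: "lin_comb n c ?vs $ \<kappa> k = c k * ?F" if k: "k < n - 1" for c k
  proof -
    have "lin_comb n c ?vs $ \<kappa> k = (\<Sum>k'<n - 1. c k' * ?vs ! k' $ \<kappa> k)"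
      using range(1)[OF k] length_fs by simp
    also have "\<dots> = (\<Sum>k'<n - 1. if k' = k then c k * ?F else 0)"
    proof (rule sum.cong[OF refl])
      fix k' assume "k' \<in> {..<n - 1}"
      hence k': "k' < n - 1" by simp
      show "c k' * ?vs ! k' $ \<kappa> k = (if k' = k then c k * ?F else 0)"
        using entry[OF k' range(1)[OF k]] inj[OF k k'] range(2)[OF k] by simp
    qed
    also have "\<dots> = c k * ?F" using k by simp
    finally show ?thesis .
  qed
  have comb_i: "lin_comb n c ?vs $ i = - (\<Sum>k<n - 1. c k * (f (\<kappa> k) * ?F * ?F))" for c
  proof -
    have "lin_comb n c ?vs $ i = (\<Sum>k<n - 1. c k * ?vs ! k $ i)"
      using i length_fs by simp
    also have "\<dots> = (\<Sum>k<n - 1. - (c k * (f (\<kappa> k) * ?F * ?F)))"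
    proof (rule sum.cong[OF refl])
      fix k assume "k \<in> {..<n - 1}"
      hence k: "k < n - 1" by simp
      show "c k * ?vs ! k $ i = - (c k * (f (\<kappa> k) * ?F * ?F))"
        using entry[OF k i] range(2)[OF k] by simp
    qed
    finally show ?thesis by (simp add: sum_negf)
  qed
  have split: "(\<Sum>j<n. f j * v $ j) = f i * v $ i + (\<Sum>k<n - 1. f (\<kappa> k) * v $ \<kappa> k)" for v
  proof -
    have "(\<Sum>j<n. f j * v $ j) = f i * v $ i + (\<Sum>j\<in>{..<n} - {i}. f j * v $ j)"
      using i by (simp add: sum.remove)
    also have "(\<Sum>j\<in>{..<n} - {i}. f j * v $ j) = (\<Sum>k<n - 1. f (\<kappa> k) * v $ \<kappa> k)"
      by (rule sum.reindex_bij_betw[OF \<kappa>, symmetric])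
    finally show ?thesis .
  qed
  have F_tw: "?F \<in> twist (- int d) V" by (rule twist_inverse_to_frac[OF V(2) homogeneous_fs[OF i]])
  have sub: "lin_comb n c ?vs \<in> E V" if c: "\<forall>k<n - 1. c k \<in> regular_functions V" for c
    unfolding mem_E
  proof (intro conjI allI impI)
    fix j assume j: "j < n"
    show "lin_comb n c ?vs $ j \<in> twist (- int d) V"
    proof (cases "j = i")
      case False
      then obtain k where k: "k < n - 1" "j = \<kappa> k" using surj[OF j] by blast
      have "c k * ?F \<in> twist (0 + - int d) V" using c k(1) F_tw by (intro twist_mult[OF VP]) auto
      thus ?thesis using comb_\<kappa>[OF k(1)] k(2) by simp
    next
      case True
      have "c k * (f (\<kappa> k) * ?F * ?F) \<in> twist (0 + (int d + - int d + - int d)) V" if "k < n - 1" for k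
        using c that F_tw range[OF that] by (intro twist_mult[OF VP] twist_to_frac[OF VP] homogeneous_fs) auto
      hence "(\<Sum>k<n - 1. c k * (f (\<kappa> k) * ?F * ?F)) \<in> twist (- int d) V"
        by (intro twist_sum[OF VP]) auto
      thus ?thesis unfolding True comb_i by (rule twist_uminus)
    qed
  next
    have "(\<Sum>j<n. f j * lin_comb n c ?vs $ j) =
        - (f i * ?F * (\<Sum>k<n - 1. c k * f (\<kappa> k) * ?F)) + (\<Sum>k<n - 1. f (\<kappa> k) * (c k * ?F))"
      unfolding split comb_i by (simp add: comb_\<kappa> sum_distrib_left mult.assoc mult.left_commute del: mult_fract)
    also have "\<dots> = 0" using fi0 by (simp add: mult.assoc mult.left_commute del: mult_fract)
    finally show "(\<Sum>j<n. f j * lin_comb n c ?vs $ j) = 0" .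
  qed simp
  have "v \<in> lin_span n (regular_functions V) ?vs" if "v \<in> E V" for v
  proof -
    have v: "v \<in> carrier_vec n" "\<forall>j<n. v $ j \<in> twist (- int d) V" "(\<Sum>j<n. f j * v $ j) = 0"
      using that mem_E by blast+
    \<comment> \<open>The basis vector with number \<open>k\<close> has the entry
      \<open>inverse (f i)\<close> at position \<open>\<kappa> k\<close>, where all other basis
      vectors are 0; this dictates the coefficient.\<close>
    define c where "c k = f i * v $ \<kappa> k" for k
    have c: "c k \<in> regular_functions V" if "k < n - 1" for k
    proof -
      have "c k \<in> twist (int d + - int d) V"
        unfolding c_def using v(2) range[OF that] by (intro twist_mult[OF VP] twist_to_frac[OF VP] homogeneous_fs i) auto
      thus ?thesis by simp
    qed
    have eq: "v = lin_comb n c ?vs"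
    proof (rule eq_vecI)
      fix j assume "j < dim_vec (lin_comb n c ?vs)"
      hence j: "j < n" by simp
      show "v $ j = lin_comb n c ?vs $ j"
      proof (cases "j = i")
        case False
        then obtain k where k: "k < n - 1" "j = \<kappa> k" using surj[OF j] by blast
        thus ?thesis using comb_\<kappa>[OF k(1)] fi0 by (simp add: c_def)
      next
        case True
        have "f i * v $ i = - (\<Sum>k<n - 1. f (\<kappa> k) * v $ \<kappa> k)" using v(3) unfolding split by (simp add: eq_neg_iff_add_eq_0)
        hence "?F * (f i * v $ i) = ?F * - (\<Sum>k<n - 1. f (\<kappa> k) * v $ \<kappa> k)" by simp
        moreover have "?F * (f i * v $ i) = v $ i"
          using left_inverse[OF fi0] by (simp only: mult.assoc[symmetric] mult_1_left)
        moreover have "c k * (f (\<kappa> k) * ?F * ?F) = ?F * (f (\<kappa> k) * v $ \<kappa> k)" for k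
        proof -
          have "c k * (f (\<kappa> k) * ?F * ?F) = (?F * f i) * (?F * (f (\<kappa> k) * v $ \<kappa> k))"
            unfolding c_def by (simp only: mult.assoc mult.left_commute mult.commute)
          thus ?thesis by (simp only: left_inverse[OF fi0] mult_1_left)
        qed
        ultimately show ?thesis unfolding True comb_i by (simp only: sum_distrib_left mult_minus_right)
      qed
    qed (use v(1) in simp)
    show ?thesis unfolding eq using c length_fs by (intro lin_spanI) simp
  qed
  moreover have "lin_span n (regular_functions V) ?vs \<subseteq> E V"
    using sub length_fs by (auto elim!: lin_spanE)
  moreover have "c k = 0" if "lin_comb n c ?vs = 0\<^sub>v n" "k < n - 1" for c k
    using comb_\<kappa>[OF that(2), of c] that(1) range(1)[OF that(2)] fi0 by simp
  ultimately show ?thesis unfolding is_basis_def using carrier length_fs by (simp, blast)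
qed

lemma enumeration_exists:
  assumes "i < n"
  shows "\<exists>\<kappa>. bij_betw \<kappa> {..<n - 1} ({..<n} - {i})"
proof -
  have "card ({..<n} - {i}) = n - 1" using assms by simp
  thus ?thesis using ex_bij_betw_nat_finite[of "{..<n} - {i}"] by (simp add: atLeast0LessThan)
qed

lemma module_sheaf_E: "module_sheaf n E"
  unfolding module_sheaf_def
proof (intro conjI allI impI)
  fix U :: "'k point set" assume U: "nonempty_open U"
  note UP = nonempty_open_subset[OF U]
  show "E U \<subseteq> carrier_vec n" by (auto simp: mem_E)
  show "0\<^sub>v n \<in> E U" using UP twist_stalk_zero by (auto simp: mem_E twist_def)
  show "\<forall>v\<in>E U. \<forall>w\<in>E U. v + w \<in> E U"
  proof (intro ballI)
    fix v w assume v: "v \<in> E U" and w: "w \<in> E U"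
    have "v $ i + w $ i \<in> twist (- int d) U" if "i < n" for i
      using v w that by (intro twist_add[OF UP]) (simp_all add: mem_E)
    moreover have "(\<Sum>i<n. f i * (v + w) $ i) = (\<Sum>i<n. f i * v $ i) + (\<Sum>i<n. f i * w $ i)"
      using v w unfolding sum.distrib[symmetric] by (intro sum.cong) (auto simp: mem_E distrib_left)
    moreover have "(v + w) $ i = v $ i + w $ i" if "i < n" for i using v w that by (auto simp: mem_E)
    ultimately show "v + w \<in> E U" using v w by (simp add: mem_E)
  qed
  show "\<forall>a\<in>regular_functions U. \<forall>v\<in>E U. a \<cdot>\<^sub>v v \<in> E U"
  proof (intro ballI)
    fix a v assume a: "a \<in> regular_functions U" and v: "v \<in> E U"
    have "a * v $ i \<in> twist (- int d) U" if "i < n" for i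
      using twist_mult[OF UP a, of "v $ i" "- int d"] v that by (simp add: mem_E)
    moreover have "(\<Sum>i<n. f i * (a \<cdot>\<^sub>v v) $ i) = a * (\<Sum>i<n. f i * v $ i)"
      using v unfolding sum_distrib_left by (intro sum.cong) (auto simp: mem_E)
    moreover have "(a \<cdot>\<^sub>v v) $ i = a * v $ i" if "i < n" for i using v that by (auto simp: mem_E)
    ultimately show "a \<cdot>\<^sub>v v \<in> E U" using v by (simp add: mem_E)
  qed
next
  fix U V :: "'k point set" assume "nonempty_open U \<and> nonempty_open V \<and> V \<subseteq> U"
  hence "V \<subseteq> U" by blast
  thus "E U \<subseteq> E V" unfolding subset_iff mem_E twist_def by blast
next
  fix \<U> :: "'k point set set" assume *: "\<U> \<noteq> {} \<and> (\<forall>U\<in>\<U>. nonempty_open U)"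
  show "(\<Inter>U\<in>\<U>. E U) \<subseteq> E (\<Union>\<U>)"
  proof
    fix v assume v: "v \<in> (\<Inter>U\<in>\<U>. E U)"
    obtain U where "U \<in> \<U>" using * by blast
    with v have "v \<in> E U" by blast
    moreover have "v $ i \<in> twist (- int d) (\<Union>\<U>)" if "i < n" for i
      using v that unfolding twist_def INT_iff mem_E by blast
    ultimately show "v \<in> E (\<Union>\<U>)" by (simp add: mem_E)
  qed
qed

lemma vector_bundle_E: "vector_bundle n E"
  unfolding vector_bundle_def
proof (intro conjI module_sheaf_E ballI)
  fix P :: "'k point" assume P: "P \<in> Proj"
  obtain i where i: "i < n" "fs ! i \<notin> P" using no_common_zero[OF P] by blast
  obtain \<kappa> where \<kappa>: "bij_betw \<kappa> {..<n - 1} ({..<n} - {i})" using enumeration_exists[OF i(1)] by blast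
  have PU: "P \<in> basic_open (fs ! i)" using P i(2) by (simp add: basic_open_def)
  have "is_basis n (regular_functions V) (E V) (syz_basis fs i \<kappa>)" if "nonempty_open V" "V \<subseteq> basic_open (fs ! i)" for V
    using that(1) nonempty_open_generic[OF that(1)] by (intro syz_basis_is_basis[OF _ that(2) i(1) \<kappa>]) blast
  with PU nonempty_open_basic_open[OF basic_open_nonzero[OF PU]]
  show "\<exists>U vs. nonempty_open U \<and> P \<in> U \<and>
        (\<forall>V. nonempty_open V \<and> V \<subseteq> U \<longrightarrow> is_basis n (regular_functions V) (E V) vs)" by blast
qed

lemma stalk_E:
  assumes P: "P \<in> Proj"
  shows "stalk E P = E {P}"
proof
  show "stalk E P \<subseteq> E {P}"
    unfolding stalk_def by (auto simp: mem_E twist_def)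
  show "E {P} \<subseteq> stalk E P"
  proof
    fix v assume v: "v \<in> E {P}"
    have "(\<lambda>i. v $ i) ` {..<n} \<subseteq> twist_stalk (- int d) P" using v by (auto simp: mem_E twist_singleton)
    then obtain b k where b: "b \<notin> P" "\<forall>Q. b \<notin> Q \<longrightarrow> (\<lambda>i. v $ i) ` {..<n} \<subseteq> twist_stalk (- int d) Q"
      using common_domain[OF P, of "(\<lambda>i. v $ i) ` {..<n}" "- int d"] by (metis finite_imageI finite_lessThan)
    have PU: "P \<in> basic_open b" using P b(1) by (simp add: basic_open_def)
    have "v \<in> E (basic_open b)" using v b(2) by (auto simp: mem_E twist_def basic_open_def image_subset_iff)
    thus "v \<in> stalk E P"
      unfolding stalk_def using PU nonempty_open_basic_open[OF basic_open_nonzero[OF PU]] by blast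
  qed
qed

lemma stalk_basis_E:
  assumes "P \<in> Proj" "i < n" "fs ! i \<notin> P" "bij_betw \<kappa> {..<n - 1} ({..<n} - {i})"
  shows "stalk_basis n E P (syz_basis fs i \<kappa>)"
  using syz_basis_is_basis[of "{P}" i \<kappa>] assms
  unfolding stalk_basis_def stalk_E[OF assms(1)] by (simp add: twist_singleton basic_open_def)

lemma locally_generated_E: "locally_generated n E"
  unfolding locally_generated_def
proof
  fix P :: "'k point" assume P: "P \<in> Proj"
  obtain i where i: "i < n" "fs ! i \<notin> P" using no_common_zero[OF P] by blast
  obtain \<kappa> where \<kappa>: "bij_betw \<kappa> {..<n - 1} ({..<n} - {i})" using enumeration_exists[OF i(1)] by blast
  have "stalk E Q = lin_span n (local_ring Q) (syz_basis fs i \<kappa>)" "set (syz_basis fs i \<kappa>) \<subseteq> carrier_vec n"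
    if "Q \<in> basic_open (fs ! i)" for Q
    using stalk_basis_E[OF _ i(1) _ \<kappa>, of Q] that is_basisD(1,2) unfolding stalk_basis_def basic_open_def by blast+
  moreover have "P \<in> basic_open (fs ! i)" using P i(2) by (simp add: basic_open_def)
  ultimately show "\<exists>h m vs. homogeneous m h \<and> h \<notin> P \<and> set vs \<subseteq> carrier_vec n \<and>
     (\<forall>Q\<in>basic_open h. stalk E Q = lin_span n (local_ring Q) vs)"
    using i(2) homogeneous_fs[OF i(1)] by blast
qed

lemma rk_E: "rk n E = n - 1"
proof -
  obtain i where i: "i < n" "fs ! i \<notin> generic_point" using no_common_zero[OF generic_point_Proj] by blast
  obtain \<kappa> where \<kappa>: "bij_betw \<kappa> {..<n - 1} ({..<n} - {i})" using enumeration_exists[OF i(1)] by blast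
  show ?thesis using rk_eq[OF stalk_basis_E[OF generic_point_Proj i \<kappa>]] length_fs by simp
qed

section \<open>The first Chern class of the syzygy bundle\<close>

lemma minor_syz_basis:
  assumes i: "i < n" and \<kappa>: "bij_betw \<kappa> {..<n - 1} ({..<n} - {i})"
  shows "minor (syz_basis fs i \<kappa>) \<kappa> = inverse (f i) ^ (n - 1)"
proof -
  have inj: "\<kappa> k = \<kappa> k' \<longleftrightarrow> k = k'" if "k < n - 1" "k' < n - 1" for k k'
    using \<kappa> that unfolding bij_betw_def inj_on_def by auto
  have range: "\<kappa> k < n" "\<kappa> k \<noteq> i" if "k < n - 1" for k
    using bij_betw_apply[OF \<kappa>, of k] that by auto
  have "mat (n - 1) (n - 1) (\<lambda>(a, b). syz_basis fs i \<kappa> ! b $ \<kappa> a) = inverse (f i) \<cdot>\<^sub>m 1\<^sub>m (n - 1)"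
    using range inj length_fs by (intro eq_matI) (auto simp: syz_basis_def)
  thus ?thesis unfolding minor_def length_syz_basis length_fs by simp
qed

lemma syzygy_relation: "P \<in> Proj \<Longrightarrow> v \<in> stalk E P \<Longrightarrow> (\<Sum>i<n. f i * v $ i) = 0"
  by (simp add: stalk_E mem_E)

lemma stalk_E_twist: "P \<in> Proj \<Longrightarrow> v \<in> stalk E P \<Longrightarrow> j < n \<Longrightarrow> v $ j \<in> twist_stalk (- int d) P"
  by (simp add: stalk_E mem_E twist_singleton)

text \<open>Two bases \<open>syz_basis\<close>, for the indices \<open>i\<close> and
  \<open>j\<close>, differ by a determinant that is \<open>f i ^ n\<close> over
  \<open>f j ^ n\<close> up to sign. Where \<open>fs ! i\<close> does not vanish, the basis for
  \<open>j\<close> therefore has order \<open>- n\<close> times that of \<open>f j\<close>, and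
  \<open>f j\<close> has a divisor of degree \<open>d\<close>.\<close>

lemma c1_E: "c1 n E = - (int n * int d)"
proof -
  let ?\<eta> = "generic_point :: 'k point" and ?K = "local_ring (generic_point :: 'k point)"
  obtain j where j: "j < n" "fs ! j \<notin> ?\<eta>" using no_common_zero[OF generic_point_Proj] by blast
  obtain \<rho> where \<rho>: "bij_betw \<rho> {..<n - 1} ({..<n} - {j})" using enumeration_exists[OF j(1)] by blast
  let ?ss = "syz_basis fs j \<rho>"
  have ss: "rational_basis n E ?ss" by (rule stalk_basis_E[OF generic_point_Proj j \<rho>])
  have len: "length ?ss = n - 1" using length_fs by simp
  have fj0: "fs ! j \<noteq> 0" using j(2) by (auto simp: generic_point_def)
  have fj: "f j \<noteq> 0" using fj0 by (simp add: Fract_nonzero)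
  have fj_tw: "f j \<in> twist_stalk (int d) ?\<eta>" by (rule Fract_1_twist_stalk[OF generic_point_Proj homogeneous_fs[OF j(1)]])
  have ord: "det_order n E ?ss P = - (int n * valuation P (f j))" if P: "P \<in> curves" for P
  proof -
    note PP = curvesD(1)[OF P]
    obtain i where i: "i < n" "fs ! i \<notin> P" using no_common_zero[OF PP] by blast
    have fi0: "fs ! i \<noteq> 0" using i(2) ProjD(3)[OF PP] by auto
    have fi: "f i \<noteq> 0" using fi0 by (simp add: Fract_nonzero)
    have fi_tw: "f i \<in> twist_stalk (int d) ?\<eta>" by (rule Fract_1_twist_stalk[OF generic_point_Proj homogeneous_fs[OF i(1)]])
    have val_fi: "valuation P (f i) = 0" using valuation_notin[OF P i(2) ProjD(2)[OF PP]] .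
    \<comment> \<open>\<kappa> omits \<open>i\<close> instead of \<open>j\<close>. The sign
      \<open>u\<close> depends on the enumeration and is irrelevant for valuations.\<close>
    have "\<exists>\<kappa>. bij_betw \<kappa> {..<n - 1} ({..<n} - {i}) \<and> (\<exists>u\<in>{1, - 1}. f j * minor ?ss \<kappa> = u * f i * inverse (f j) ^ (n - 1))"
    proof (cases "i = j")
      case True
      thus ?thesis using \<rho> minor_syz_basis[OF j(1) \<rho>] by (intro exI[of _ \<rho>]) simp
    next
      case False
      then obtain p where p: "p < n - 1" "\<rho> p = i"
        using \<rho> i(1) unfolding bij_betw_def by (metis DiffI imageE lessThan_iff singletonD)
      let ?\<kappa> = "\<rho>(p := j)"
      have inj: "\<rho> k = \<rho> k' \<longleftrightarrow> k = k'" if "k < n - 1" "k' < n - 1" for k k'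
        using \<rho> that unfolding bij_betw_def inj_on_def by auto
      have range: "\<rho> k < n" "\<rho> k \<noteq> j" if "k < n - 1" for k
        using bij_betw_apply[OF \<rho>, of k] that by auto
      have "inj_on ?\<kappa> {..<n - 1}"
      proof (rule inj_onI)
        fix k k' assume "k \<in> {..<n - 1}" "k' \<in> {..<n - 1}" "?\<kappa> k = ?\<kappa> k'"
        thus "k = k'" using inj[of k k'] range(2)[of k] range(2)[of k'] by (auto split: if_splits)
      qed
      moreover have "?\<kappa> ` {..<n - 1} \<subseteq> {..<n} - {i}"
      proof
        fix l assume "l \<in> ?\<kappa> ` {..<n - 1}"
        then obtain k where "k < n - 1" "l = ?\<kappa> k" by auto
        thus "l \<in> {..<n} - {i}" using range[of k] inj[of k p] p j(1) False by (auto split: if_splits)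
      qed
      hence "?\<kappa> ` {..<n - 1} = {..<n} - {i}"
        using i(1) card_image[OF \<open>inj_on ?\<kappa> {..<n - 1}\<close>] by (intro card_subset_eq) auto
      ultimately have bij: "bij_betw ?\<kappa> {..<n - 1} ({..<n} - {i})" unfolding bij_betw_def by blast
      have "(\<Sum>k<n. f k * ?ss ! b $ k) = 0" if "b < length ?ss" for b
        using basis_subset[OF subfield_setD(1)[OF function_field] ss[unfolded stalk_basis_def]] nth_mem[OF that]
        by (intro syzygy_relation[OF generic_point_Proj]) blast
      \<comment> \<open>Contraction at the position \<open>p\<close> with
        \<open>\<rho> p = i\<close>. An index other than \<open>i\<close> and \<open>j\<close>
        already occurs elsewhere in \<rho> and gives a minor with equal rows, so two terms remain,
        as in Cramer's rule.\<close>
      hence "0 = (\<Sum>k<n. f k * minor ?ss (\<rho>(p := k)))"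
        using p(1) len by (intro minor_contraction[symmetric]) auto
      also have "\<dots> = (\<Sum>k\<in>{i, j}. f k * minor ?ss (\<rho>(p := k)))"
      proof (rule sum.mono_neutral_right)
        show "\<forall>k\<in>{..<n} - {i, j}. f k * minor ?ss (\<rho>(p := k)) = 0"
        proof
          fix k assume k: "k \<in> {..<n} - {i, j}"
          hence "k < n" "k \<noteq> j" by auto
          then obtain q where q: "q < n - 1" "\<rho> q = k"
            using \<rho> unfolding bij_betw_def by (metis DiffI imageE lessThan_iff singletonD)
          have "q \<noteq> p" using p q k by auto
          hence "minor ?ss (\<rho>(p := k)) = 0"
            using p(1) q len by (intro minor_equal_indices[of p _ q]) auto
          thus "f k * minor ?ss (\<rho>(p := k)) = 0" by simp
        qed
      qed (use i(1) j(1) in auto)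
      also have "\<dots> = f i * minor ?ss \<rho> + f j * minor ?ss ?\<kappa>"
        using False p(2) fun_upd_triv[of \<rho> p] by simp
      finally have "f j * minor ?ss ?\<kappa> = - (f i * minor ?ss \<rho>)" by (simp add: eq_neg_iff_add_eq_0 add.commute)
      hence "f j * minor ?ss ?\<kappa> = - 1 * f i * inverse (f j) ^ (n - 1)"
        unfolding minor_syz_basis[OF j(1) \<rho>] by (simp only: mult_1_left mult_minus_left)
      thus ?thesis using bij by blast
    qed
    then obtain \<kappa> u where \<kappa>: "bij_betw \<kappa> {..<n - 1} ({..<n} - {i})" and u: "u \<in> {1, - 1}"
      and rel: "f j * minor ?ss \<kappa> = u * f i * inverse (f j) ^ (n - 1)" by blast
    let ?vs = "syz_basis fs i \<kappa>"
    have vs: "stalk_basis n E P ?vs" by (rule stalk_basis_E[OF PP i \<kappa>])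
    obtain A where A: "expresses n A ?K ?ss ?vs" "det A \<noteq> 0" "det A \<in> ?K" "length ?ss = length ?vs"
      using rational_change_of_basis[OF ss curve_basis_rational[OF locally_generated_E P vs]] .
    have "\<kappa> a < n" if "a < length ?ss" for a using bij_betw_apply[OF \<kappa>, of a] that len by auto
    hence "minor ?ss \<kappa> = det A * minor ?vs \<kappa>" by (intro minor_expresses[OF A(1,4)])
    hence eq: "f j * (det A * inverse (f i) ^ (n - 1)) = u * f i * inverse (f j) ^ (n - 1)"
      using rel minor_syz_basis[OF i(1) \<kappa>] by simp
    have n: "n = Suc (n - 1)" using i(1) by simp
    have "det A * f j ^ n = u * f i ^ n"
    proof -
      have "det A * f j ^ n = f j * (det A * inverse (f i) ^ (n - 1)) * (f i ^ (n - 1) * f j ^ (n - 1))"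
        using fi by (subst n) (simp add: power_inverse del: mult_fract)
      also have "\<dots> = u * f i ^ n"
        unfolding eq using fj by (subst (4) n) (simp add: power_inverse del: mult_fract)
      finally show ?thesis .
    qed
    moreover have "(u * f i ^ n) * (u * f i ^ n) = f i ^ n * f i ^ n" using u by auto
    \<comment> \<open>Squaring removes the sign \<open>u\<close>.\<close>
    ultimately have sq: "(det A * f j ^ n) * (det A * f j ^ n) = f i ^ n * f i ^ n" by simp
    have pow: "g ^ m \<in> twist_stalk (int (m * d)) ?\<eta> \<and> valuation P (g ^ m) = int m * valuation P g"
      if g: "g \<in> twist_stalk (int d) ?\<eta>" "g \<noteq> 0" for g m
    proof (induction m)
      case 0
      show ?case using valuation_1[OF P] twist_stalk_one[OF generic_point_Proj] by simp
    next
      case (Suc m)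
      have gm: "g ^ m \<in> twist_stalk (int (m * d)) ?\<eta>" "g ^ m \<noteq> 0" using Suc g(2) by auto
      show ?case using Suc twist_stalk_mult[OF generic_point_Proj g(1) gm(1)] valuation_mult[OF P g gm]
        by (simp add: algebra_simps)
    qed
    note pj = pow[OF fj_tw fj, of n] and pi = pow[OF fi_tw fi, of n]
    have nzj: "f j ^ n \<noteq> 0" and nzi: "f i ^ n \<noteq> 0" using fj fi by simp_all
    have tw: "det A * f j ^ n \<in> twist_stalk (0 + int (n * d)) ?\<eta>"
      using pj by (intro twist_stalk_mult[OF generic_point_Proj A(3)]) blast
    have nz: "det A * f j ^ n \<noteq> 0" using A(2) nzj by simp
    have "valuation P (det A * f j ^ n) + valuation P (det A * f j ^ n) = valuation P (f i ^ n) + valuation P (f i ^ n)"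
      using valuation_mult[OF P tw nz tw nz] valuation_mult[OF P conjunct1[OF pi] nzi conjunct1[OF pi] nzi] sq by simp
    hence "valuation P (det A * f j ^ n) = 0" using pi val_fi by simp
    hence "valuation P (det A) + int n * valuation P (f j) = 0"
      using valuation_mult[OF P A(3,2) conjunct1[OF pj] nzj] pj by simp
    thus ?thesis using det_order_eq[OF locally_generated_E P ss vs A(1)] by simp
  qed
  obtain T where T: "finite T" "T \<subseteq> curves" "\<forall>S. finite S \<and> T \<subseteq> S \<and> S \<subseteq> curves \<longrightarrow>
      (\<Sum>P\<in>S. int (curve_degree P) * valuation P (f j)) = int d"
    using degree_formula[OF fj_tw fj] .
  obtain T0 where T0: "finite T0" "T0 \<subseteq> curves" "\<forall>P\<in>curves - T0. det_order n E ?ss P = 0"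
    using det_order_finite_support[OF locally_generated_E ss] .
  have "c1 n E = (\<Sum>P\<in>T0 \<union> T. int (curve_degree P) * det_order n E ?ss P)"
    using T0 T by (intro c1_eq[OF locally_generated_E ss]) auto
  also have "\<dots> = (\<Sum>P\<in>T0 \<union> T. - int n * (int (curve_degree P) * valuation P (f j)))"
    using T0(2) T(2) by (intro sum.cong) (auto simp: ord)
  also have "\<dots> = - int n * int d"
    unfolding sum_distrib_left[symmetric] using T T0 by simp
  finally show ?thesis by simp
qed

end

section \<open>A criterion for stability\<close>

lemma minor_2:
  assumes "length ss = 2"
  shows "minor ss I = ss ! 0 $ I 0 * ss ! 1 $ I 1 - ss ! 1 $ I 0 * ss ! 0 $ I 1"
proof -
  have "0 < length ss" using assms by simp
  then obtain cof where cof: "\<forall>k. minor ss (I(0 := k)) = (\<Sum>b<length ss. ss ! b $ k * cof b)"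
    "\<forall>b<length ss. cof b = (- 1) ^ (0 + b) * det (mat (length ss - 1) (length ss - 1)
        (\<lambda>(a, b'). ss ! (if b' < b then b' else Suc b') $ I (if a < 0 then a else Suc a)))"
    by (rule minor_replace)
  have "cof 0 = ss ! 1 $ I 1" "cof 1 = - (ss ! 0 $ I 1)"
    using cof(2)[rule_format, of 0] cof(2)[rule_format, of 1] assms by (simp_all add: det_single)
  moreover have "minor ss (I(0 := I 0)) = ss ! 0 $ I 0 * cof 0 + ss ! 1 $ I 0 * cof 1"
    using cof(1)[rule_format, of "I 0"] assms by (simp add: numeral_2_eq_2)
  ultimately show ?thesis by simp
qed

text \<open>Elements of degree 1 in the second exterior power that contraction with
  \<open>fs\<close> kills: skew matrices whose rows are linear syzygies.\<close>

definition skew_syzygy :: "'k::field poly3 list \<Rightarrow> (nat \<Rightarrow> nat \<Rightarrow> 'k poly3) \<Rightarrow> bool" where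
  "skew_syzygy fs W \<longleftrightarrow> (\<forall>i<5. \<forall>j<5. homogeneous 1 (W i j)) \<and> (\<forall>i<5. W i i = 0) \<and>
     (\<forall>i<5. \<forall>j<5. W j i = - W i j) \<and> (\<forall>i<5. (\<Sum>j<5. fs ! j * W i j) = 0)"

text \<open>The hypotheses exclude a destabilizing subsheaf \<open>F\<close> of rank 1, 2 and 3 in turn: a syzygy of
  degree 0, a decomposable element of degree 1 of the second exterior power, and an element
  of degree 1 of the third exterior power.\<close>
lemma stable_Syz_quadrics:
  fixes fs :: "'k::field poly3 list"
  assumes "syzygies fs 5 2"
    and syz0: "\<And>w. (\<And>i. i < 5 \<Longrightarrow> homogeneous 0 (w i)) \<Longrightarrow> (\<Sum>i<5. fs ! i * w i) = 0 \<Longrightarrow> \<forall>i<5. w i = 0"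
    and syz2: "\<And>W s t. skew_syzygy fs W \<Longrightarrow>
        (\<And>i j. i < 5 \<Longrightarrow> j < 5 \<Longrightarrow> to_frac (W i j) = s i * t j - s j * t i) \<Longrightarrow> \<forall>i<5. \<forall>j<5. W i j = 0"
    and syz3: "\<And>W. (\<And>i. i < 5 \<Longrightarrow> skew_syzygy fs (W i)) \<Longrightarrow>
        (\<And>i j k. i < 5 \<Longrightarrow> j < 5 \<Longrightarrow> k < 5 \<Longrightarrow> W j i k = - W i j k) \<Longrightarrow>
        (\<And>i k. i < 5 \<Longrightarrow> k < 5 \<Longrightarrow> W i i k = 0) \<Longrightarrow> \<forall>i<5. \<forall>j<5. \<forall>k<5. W i j k = 0"
  shows "stable 5 (Syz [2, 2, 2, 2, 2] fs)"
proof -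
  interpret syzygies fs 5 2 by fact
  have E_eq: "Syz [2, 2, 2, 2, 2] fs = E" by (simp add: numeral_eq_Suc)
  have slope_E: "slope 5 E = - 5 / 2" unfolding slope_def c1_E rk_E by simp
  have "slope 5 F < slope 5 E"
    if F: "coherent 5 F" "subsheaf F E" "0 < rk 5 F" "rk 5 F < rk 5 E" for F
  proof -
    have sub: "v \<in> stalk E P" if "v \<in> stalk F P" for v P
      using that F(2) unfolding stalk_def subsheaf_def by blast
    note LG = coherent_locally_generated[OF F(1)]
    obtain ss where ss: "rational_basis 5 F ss" using rational_basis_exists[OF LG] .
    let ?r = "length ss"
    have r: "?r = 1 \<or> ?r = 2 \<or> ?r = 3" using F(3,4) unfolding rk_eq[OF ss] rk_E by linarith
    have tw: "v $ j \<in> twist_stalk (- 2) P" if "P \<in> Proj" "v \<in> stalk F P" "j < 5" for P v j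
      using stalk_E_twist[OF that(1) sub[OF that(2)] that(3)] by simp
    obtain e W z where bound: "c1 5 F \<le> int ?r * - 2 - int e" and z: "z \<noteq> 0"
      and W: "\<forall>I. (\<forall>a<?r. I a < 5) \<longrightarrow> homogeneous e (W I) \<and> to_frac (W I) = z * minor ss I"
      by (rule c1_bound[OF LG ss tw])
    have mem: "ss ! b \<in> stalk F generic_point" if "b < ?r" for b
      using basis_subset[OF subfield_setD(1)[OF function_field] ss[unfolded stalk_basis_def]] nth_mem[OF that] by blast
    have entries: "ss ! i $ j \<in> twist_stalk (- 2) generic_point" if "i < ?r" "j < 5" for i j
      by (rule tw[OF generic_point_Proj mem[OF that(1)] that(2)])
    obtain I0 where I0: "\<forall>a<?r. I0 a < 5" "minor ss I0 \<noteq> 0"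
      using rational_basis_minor_nonzero[OF ss entries] by blast
    have W_eq: "W I = W J" if "\<forall>a<?r. I a < 5" "\<And>a. a < ?r \<Longrightarrow> I a = J a" for I J
    proof -
      have "\<forall>a<?r. J a < 5" using that by simp
      hence "to_frac (W I) = to_frac (W J)" using W that minor_cong[of ss I J] by simp
      thus ?thesis by (simp only: to_frac_eq_iff)
    qed
    have W_0: "W I = 0" if "\<forall>a<?r. I a < 5" "minor ss I = 0" for I
    proof -
      have "to_frac (W I) = to_frac 0" using W that by (simp add: to_frac_0)
      thus ?thesis by (simp only: to_frac_eq_iff)
    qed
    have W_neg: "W J = - W I" if "\<forall>a<?r. I a < 5" "\<forall>a<?r. J a < 5" "minor ss J = - minor ss I" for I J
    proof -
      have "to_frac (W J) = - to_frac (W I)" using W that by simp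
      also have "\<dots> = to_frac (- W I)" by simp
      finally show ?thesis by (simp only: to_frac_eq_iff)
    qed
    have W_nz: "W I0 \<noteq> 0"
    proof
      assume "W I0 = 0"
      hence "z * minor ss I0 = 0" using W I0(1) to_frac_0 by metis
      thus False using z I0(2) by simp
    qed
    have contr: "(\<Sum>k<5. fs ! k * W (I(p := k))) = 0" if I: "\<forall>a<?r. I a < 5" and p: "p < ?r" for I p
    proof -
      have "to_frac (\<Sum>k<5. fs ! k * W (I(p := k))) = (\<Sum>k<5. f k * to_frac (W (I(p := k))))"
        unfolding to_frac_sum by (intro sum.cong) auto
      also have "\<dots> = (\<Sum>k<5. z * (f k * minor ss (I(p := k))))"
      proof (rule sum.cong[OF refl])
        fix k assume "k \<in> {..<5::nat}"
        hence "\<forall>a<?r. (I(p := k)) a < 5" using I by simp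
        hence "to_frac (W (I(p := k))) = z * minor ss (I(p := k))" using W by blast
        thus "f k * to_frac (W (I(p := k))) = z * (f k * minor ss (I(p := k)))" by (simp only: mult.left_commute)
      qed
      also have "\<dots> = z * (\<Sum>k<5. f k * minor ss (I(p := k)))" by (rule sum_distrib_left[symmetric])
      also have "(\<Sum>k<5. f k * minor ss (I(p := k))) = 0"
        by (intro minor_contraction p syzygy_relation[OF generic_point_Proj] sub mem)
      finally have "to_frac (\<Sum>k<5. fs ! k * W (I(p := k))) = to_frac 0" by (simp only: to_frac_0 mult_zero_right)
      thus ?thesis by (simp only: to_frac_eq_iff)
    qed
    have r0: "0 < ?r" using r by auto
    have e1: "e \<ge> 1"
    proof (rule ccontr)
      assume "\<not> e \<ge> 1"
      hence "e = 0" by simp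
      \<comment> \<open>Let only the index at position 0 vary: for \<open>e = 0\<close> this gives a
        constant syzygy, which \<open>syz0\<close> makes vanish, including its entry
        \<open>W I0\<close>.\<close>
      have "homogeneous 0 (W (I0(0 := k)))" if "k < 5" for k
        using W that I0(1) \<open>e = 0\<close> by auto
      hence "\<forall>k<5. W (I0(0 := k)) = 0" using contr[OF I0(1) r0] by (rule syz0)
      hence "W (I0(0 := I0 0)) = 0" using I0(1) r0 by blast
      thus False using W_nz by simp
    qed
    have e2: "e \<ge> 2" if ne: "?r \<noteq> 1"
    proof (rule ccontr)
      assume "\<not> e \<ge> 2"
      with e1 have e: "e = 1" by simp
      consider "?r = 2" | "?r = 3" using r ne by blast
      thus False
      proof cases
        case 1
        \<comment> \<open>The values beyond position 1 are immaterial, because \<open>W I\<close>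
          depends only on \<open>I\<close> below \<open>?r\<close> by \<open>W_eq\<close>.\<close>
        define J where "J i j = (\<lambda>a::nat. if a = 0 then i else j :: nat)" for i j
        have J: "\<forall>a<?r. J i j a < 5" if "i < 5" "j < 5" for i j using that by (simp add: J_def)
        have minor_J: "minor ss (J i j) = ss ! 0 $ i * ss ! 1 $ j - ss ! 1 $ i * ss ! 0 $ j" for i j
          by (simp add: minor_2[OF 1] J_def)
        have "skew_syzygy fs (\<lambda>i j. W (J i j))"
          unfolding skew_syzygy_def
        proof (intro conjI allI impI)
          fix i j :: nat assume i: "i < 5" and j: "j < 5"
          show "homogeneous 1 (W (J i j))" using W J[OF i j] e by blast
          show "W (J j i) = - W (J i j)" by (rule W_neg[OF J[OF i j] J[OF j i]]) (simp add: minor_J mult.commute)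
        next
          fix i :: nat assume i: "i < 5"
          show "W (J i i) = 0" by (rule W_0[OF J[OF i i]]) (simp add: minor_J)
          have "W ((J i 0)(1 := k)) = W (J i k)" if "k < 5" for k
            using i that 1 by (intro W_eq) (auto simp: J_def)
          moreover have "(\<Sum>k<5. fs ! k * W ((J i 0)(1 := k))) = 0"
            using J[OF i, of 0] 1 by (intro contr) auto
          ultimately show "(\<Sum>k<5. fs ! k * W (J i k)) = 0" by simp
        qed
        \<comment> \<open>The scalar \<open>z\<close> is absorbed into the first vector, which
          exhibits the matrix as decomposable.\<close>
        moreover have "to_frac (W (J i j)) = (z * ss ! 0 $ i) * ss ! 1 $ j - (z * ss ! 0 $ j) * ss ! 1 $ i"
          if "i < 5" "j < 5" for i j
          using W J[OF that] by (simp add: minor_J algebra_simps)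
        ultimately have "\<forall>i<5. \<forall>j<5. W (J i j) = 0"
          by (rule syz2[where s = "\<lambda>i. z * ss ! 0 $ i" and t = "\<lambda>i. ss ! 1 $ i"])
        moreover have I01: "I0 0 < 5" "I0 1 < 5" using I0(1) 1 by auto
        ultimately have "W (J (I0 0) (I0 1)) = 0" by blast
        moreover have "W I0 = W (J (I0 0) (I0 1))"
          using I0(1) 1 by (intro W_eq) (auto simp: J_def less_2_cases_iff)
        ultimately show False using W_nz by simp
      next
        case 2
        define J where "J i j k = (\<lambda>a::nat. if a = 0 then i else if a = 1 then j else k :: nat)" for i j k
        have J: "\<forall>a<?r. J i j k a < 5" if "i < 5" "j < 5" "k < 5" for i j k using that by (simp add: J_def)
        have swap01: "minor ss (J j i k) = - minor ss (J i j k)" for i j k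
        proof -
          have "J j i k = (J i j k)(0 := J i j k 1, 1 := J i j k 0)" by (auto simp: J_def fun_eq_iff)
          thus ?thesis using minor_swap[of 0 ss 1 "J i j k"] 2 by simp
        qed
        have swap12: "minor ss (J i k j) = - minor ss (J i j k)" for i j k
        proof -
          have "minor ss (J i k j) = minor ss ((J i j k)(1 := J i j k 2, 2 := J i j k 1))"
            using 2 by (intro minor_cong) (auto simp: J_def)
          thus ?thesis using minor_swap[of 1 ss 2 "J i j k"] 2 by simp
        qed
        have "skew_syzygy fs (\<lambda>j k. W (J i j k))" if i: "i < 5" for i
          unfolding skew_syzygy_def
        proof (intro conjI allI impI)
          fix j k :: nat assume j: "j < 5" and k: "k < 5"
          show "homogeneous 1 (W (J i j k))" using W J[OF i j k] e by blast
          show "W (J i k j) = - W (J i j k)" by (rule W_neg[OF J[OF i j k] J[OF i k j] swap12])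
        next
          fix j :: nat assume j: "j < 5"
          show "W (J i j j) = 0"
            using 2 by (intro W_0 J i j minor_equal_indices[of 1 _ 2]) (auto simp: J_def)
          have "W ((J i j 0)(2 := k)) = W (J i j k)" if "k < 5" for k
            using i j that 2 by (intro W_eq) (auto simp: J_def)
          moreover have "(\<Sum>k<5. fs ! k * W ((J i j 0)(2 := k))) = 0"
            using J[OF i j, of 0] 2 by (intro contr) auto
          ultimately show "(\<Sum>k<5. fs ! k * W (J i j k)) = 0" by simp
        qed
        moreover have "W (J j i k) = - W (J i j k)" if "i < 5" "j < 5" "k < 5" for i j k
          using that by (intro W_neg J swap01)
        moreover have "W (J i i k) = 0" if "i < 5" "k < 5" for i k
          using 2 that by (intro W_0 J minor_equal_indices[of 0 _ 1]) (auto simp: J_def)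
        ultimately have "\<forall>i<5. \<forall>j<5. \<forall>k<5. W (J i j k) = 0" by (rule syz3)
        moreover have I012: "I0 0 < 5" "I0 1 < 5" "I0 2 < 5" using I0(1) 2 by auto
        ultimately have "W (J (I0 0) (I0 1) (I0 2)) = 0" by blast
        moreover have "W I0 = W (J (I0 0) (I0 1) (I0 2))"
        proof (rule W_eq[OF I0(1)])
          fix a assume "a < ?r"
          hence "a = 0 \<or> a = 1 \<or> a = 2" using 2 by auto
          thus "I0 a = J (I0 0) (I0 1) (I0 2) a" by (auto simp: J_def)
        qed
        ultimately show False using W_nz by simp
      qed
    qed
    \<comment> \<open>The bound gives \<open>2 * c1 5 F\<close> at most -4r - 2e, and 2e > r holds
      for r = 1, e = 1 and for r = 2, 3, e = 2.\<close>
    have "2 * c1 5 F < - 5 * int ?r" using r bound e1 e2 by auto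
    hence "of_int (2 * c1 5 F) < (of_int (- 5 * int ?r) :: rat)" by (simp only: of_int_less_iff)
    hence "slope 5 F < - 5 / 2" unfolding slope_def rk_eq[OF ss] using r0 by (simp add: field_simps)
    thus ?thesis unfolding slope_E .
  qed
  thus ?thesis unfolding E_eq stable_def using vector_bundle_E by blast
qed

section \<open>Linear syzygies of five quadrics\<close>

abbreviation cst :: "'k::field \<Rightarrow> 'k poly3" where
  "cst c \<equiv> [:[:[:c:]:]:]"

lemma cst_ring: "cst (a + b) = cst a + cst b" "cst (a - b) = cst a - cst b" "cst (- a) = - cst a"
  "cst (a * b) = cst a * cst b" "cst 0 = 0" "cst 1 = 1"
  by (simp_all flip: one_pCons)

lemma homogeneous_0_cst: "homogeneous 0 f \<Longrightarrow> \<exists>c. f = cst c"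
  using const_of_homogeneous_0 by (rule exI)

lemma homog_part_self: "homogeneous d f \<Longrightarrow> homog_part d f = f"
  by (rule poly3_eqI) (auto simp: coeff3_homog_part homogeneous_def)

lemma linear_form_expand:
  assumes "homogeneous 1 f"
  shows "f = cst (coeff3 f 1 0 0) * vX + cst (coeff3 f 0 1 0) * vY + cst (coeff3 f 0 0 1) * vZ"
proof -
  have "homog_part 1 f = cst (coeff3 f 1 0 0) * vX + cst (coeff3 f 0 1 0) * vY + cst (coeff3 f 0 0 1) * vZ"
    by (simp add: homog_part_def vX_def vY_def vZ_def monom_0 monom_Suc)
  thus ?thesis using homog_part_self[OF assms] by simp
qed

lemma quadric_expand:
  assumes "homogeneous 2 f"
  shows "f = cst (coeff3 f 2 0 0) * vX ^ 2 + cst (coeff3 f 1 1 0) * (vX * vY) + cst (coeff3 f 1 0 1) * (vX * vZ) +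
    cst (coeff3 f 0 2 0) * vY ^ 2 + cst (coeff3 f 0 1 1) * (vY * vZ) + cst (coeff3 f 0 0 2) * vZ ^ 2"
proof -
  have "homog_part 2 f = cst (coeff3 f 2 0 0) * vX ^ 2 + cst (coeff3 f 1 1 0) * (vX * vY) + cst (coeff3 f 1 0 1) * (vX * vZ) +
    cst (coeff3 f 0 2 0) * vY ^ 2 + cst (coeff3 f 0 1 1) * (vY * vZ) + cst (coeff3 f 0 0 2) * vZ ^ 2"
    by (simp add: homog_part_def vX_def vY_def vZ_def monom_0 monom_Suc numeral_2_eq_2)
  thus ?thesis using homog_part_self[OF assms] by simp
qed

text \<open>Powers of a monic linear polynomial have distinct degrees and leading coefficient 1, so
  the coefficients can be read off from the top.\<close>

lemma monic_independent:
  fixes u :: "'a::comm_ring_1"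
  assumes "[:a:] + [:b:] * [:u, 1:] + [:c:] * [:u, 1:] ^ 2 + [:d:] * [:u, 1:] ^ 3 = 0"
  shows "a = 0 \<and> b = 0 \<and> c = 0 \<and> d = 0"
  using assms by (auto simp: power2_eq_square power3_eq_cube)

lemma const_poly_hom:
  fixes A B :: "'a::comm_ring_1"
  shows "[:A + B:] = [:A:] + [:B:]" "[:A * B:] = [:A:] * [:B:]" "[:A ^ m:] = [:A:] ^ m"
proof -
  show "[:A + B:] = [:A:] + [:B:]" "[:A * B:] = [:A:] * [:B:]" by simp_all
  show "[:A ^ m:] = [:A:] ^ m"
  proof (induction m)
    case (Suc m)
    have "[:A * A ^ m:] = [:A:] * [:A ^ m:]" by simp
    thus ?case by (simp only: power_Suc Suc.IH)
  qed (simp flip: one_pCons)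
qed

text \<open>Meant for \<open>simp only\<close>: ring identities are normalized while the constants
  \<open>cst c\<close> and the coordinates remain opaque instead of being multiplied out as
  coefficient lists.\<close>

lemmas ring_expand = algebra_simps mult_minus_left mult_minus_right minus_add_distrib minus_minus
  minus_diff_eq add_uminus_conv_diff uminus_add_conv_diff diff_minus_eq_add

text \<open>Linear forms as Gram-Schmidt produces them: a unitriangular change of variables, with
  \<open>p\<close>, \<open>q\<close>, \<open>s\<close> the values of the bilinear form at the
  squares of \<open>x\<close>, \<open>y\<close>, \<open>z\<close>.\<close>

locale coordinates =
  fixes a b c p q s :: "'k::field" and x y z :: "'k poly3"
  assumes pqs: "p \<noteq> 0" "q \<noteq> 0" "s \<noteq> 0"
    and xyz: "x = vX" "y = vY + cst a * vX" "z = vZ + cst b * vX + cst c * vY"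
begin

text \<open>A basis of the kernel of the linear form on quadrics that sends the mixed products to 0
  and the squares of \<open>x\<close>, \<open>y\<close>, \<open>z\<close> to \<open>p\<close>,
  \<open>q\<close>, \<open>s\<close>.\<close>

definition g :: "nat \<Rightarrow> 'k poly3" where
  "g i = (if i = 0 then cst q * x ^ 2 - cst p * y ^ 2 else if i = 1 then cst s * x ^ 2 - cst p * z ^ 2
     else if i = 2 then x * y else if i = 3 then x * z else y * z)"

lemma g_simps: "g 0 = cst q * x ^ 2 - cst p * y ^ 2" "g 1 = cst s * x ^ 2 - cst p * z ^ 2"
  "g 2 = x * y" "g 3 = x * z" "g 4 = y * z"
  by (simp_all add: g_def)

text \<open>Since \<open>z\<close> is monic in the outermost variable and \<open>y\<close> in the
  next one, \<open>monic_independent\<close> applies first to the powers of \<open>z\<close> and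
  then, in each coefficient, to those of \<open>y\<close>.\<close>

lemma cubic_independent:
  assumes "cst e1 * x ^ 3 + cst e2 * y ^ 3 + cst e3 * z ^ 3 + cst e4 * (x ^ 2 * y) + cst e5 * (x ^ 2 * z) +
    cst e6 * (x * y ^ 2) + cst e7 * (x * z ^ 2) + cst e8 * (y ^ 2 * z) + cst e9 * (y * z ^ 2) + cst e10 * (x * y * z) = 0"
  shows "e1 = 0 \<and> e2 = 0 \<and> e3 = 0 \<and> e4 = 0 \<and> e5 = 0 \<and> e6 = 0 \<and> e7 = 0 \<and> e8 = 0 \<and> e9 = 0 \<and> e10 = 0"
proof -
  define \<xi> \<eta> :: "'k poly poly" where "\<xi> = [:[:0, 1:]:]" and "\<eta> = [:[:0, a:], 1:]"
  define k :: "'k \<Rightarrow> 'k poly poly" where "k t = [:[:t:]:]" for t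
  have x: "x = [:\<xi>:]" and y: "y = [:\<eta>:]" and cst: "cst t = [:k t:]" for t
    by (simp_all add: xyz \<xi>_def \<eta>_def k_def vX_def vY_def)
  obtain u where z: "z = [:u, 1:]" by (simp add: xyz vX_def vY_def vZ_def)
  have "[:k e1 * \<xi> ^ 3 + k e2 * \<eta> ^ 3 + k e4 * (\<xi> ^ 2 * \<eta>) + k e6 * (\<xi> * \<eta> ^ 2):] +
    [:k e5 * \<xi> ^ 2 + k e8 * \<eta> ^ 2 + k e10 * (\<xi> * \<eta>):] * [:u, 1:] + [:k e7 * \<xi> + k e9 * \<eta>:] * [:u, 1:] ^ 2 +
    [:k e3:] * [:u, 1:] ^ 3 =
    cst e1 * x ^ 3 + cst e2 * y ^ 3 + cst e3 * z ^ 3 + cst e4 * (x ^ 2 * y) + cst e5 * (x ^ 2 * z) +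
    cst e6 * (x * y ^ 2) + cst e7 * (x * z ^ 2) + cst e8 * (y ^ 2 * z) + cst e9 * (y * z ^ 2) + cst e10 * (x * y * z)"
    unfolding const_poly_hom x z y cst by (simp only: ring_expand)
  note trans[OF this assms]
  from monic_independent[OF this]
  have 0: "k e1 * \<xi> ^ 3 + k e2 * \<eta> ^ 3 + k e4 * (\<xi> ^ 2 * \<eta>) + k e6 * (\<xi> * \<eta> ^ 2) = 0"
    "k e5 * \<xi> ^ 2 + k e8 * \<eta> ^ 2 + k e10 * (\<xi> * \<eta>) = 0" "k e7 * \<xi> + k e9 * \<eta> = 0" "k e3 = 0" by blast+
  define T where "T = [:0, 1 :: 'k:]"
  have T0: "T \<noteq> 0" by (simp add: T_def)
  have \<xi>: "\<xi> = [:T:]" by (simp add: \<xi>_def T_def)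
  have "[:[:e1:] * T ^ 3:] + [:[:e4:] * T ^ 2:] * \<eta> + [:[:e6:] * T:] * \<eta> ^ 2 + [:[:e2:]:] * \<eta> ^ 3 =
      k e1 * \<xi> ^ 3 + k e2 * \<eta> ^ 3 + k e4 * (\<xi> ^ 2 * \<eta>) + k e6 * (\<xi> * \<eta> ^ 2)"
    unfolding k_def \<xi> const_poly_hom pCons_0_0 mult_zero_left add_0_right by (simp only: ring_expand)
  from monic_independent[OF trans[OF this 0(1), unfolded \<eta>_def]] T0
  have 1: "e1 = 0 \<and> e4 = 0 \<and> e6 = 0 \<and> e2 = 0" by simp
  have "[:[:e5:] * T ^ 2:] + [:[:e10:] * T:] * \<eta> + [:[:e8:]:] * \<eta> ^ 2 + [:0:] * \<eta> ^ 3 =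
      k e5 * \<xi> ^ 2 + k e8 * \<eta> ^ 2 + k e10 * (\<xi> * \<eta>)"
    unfolding k_def \<xi> const_poly_hom pCons_0_0 mult_zero_left add_0_right by (simp only: ring_expand)
  from monic_independent[OF trans[OF this 0(2), unfolded \<eta>_def]] T0
  have 2: "e5 = 0 \<and> e10 = 0 \<and> e8 = 0" by simp
  have "[:[:e7:] * T:] + [:[:e9:]:] * \<eta> + [:0:] * \<eta> ^ 2 + [:0:] * \<eta> ^ 3 = k e7 * \<xi> + k e9 * \<eta>"
    unfolding k_def \<xi> const_poly_hom pCons_0_0 mult_zero_left add_0_right by (simp only: ring_expand)
  from monic_independent[OF trans[OF this 0(3), unfolded \<eta>_def]] T0
  have 3: "e7 = 0 \<and> e9 = 0" by simp
  from 0(4) have "e3 = 0" by (simp add: k_def)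
  with 1 2 3 show ?thesis by blast
qed

lemma vars_xyz: "vX = x" "vY = y - cst a * x" "vZ = z - cst b * x - cst c * (y - cst a * x)"
  by (simp_all add: xyz)

lemma linear_form_xyz:
  assumes "homogeneous 1 f"
  shows "\<exists>l m n. f = cst l * x + cst m * y + cst n * z"
proof -
  obtain l m n where f: "f = cst l * vX + cst m * vY + cst n * vZ"
    using linear_form_expand[OF assms] by (rule that)
  have "f = cst (l - m * a - n * b + n * c * a) * x + cst (m - n * c) * y + cst n * z"
    unfolding f vars_xyz cst_ring by (simp only: ring_expand)
  thus ?thesis by blast
qed

text \<open>Multiplication by \<open>x ^ 2\<close> turns a relation of linear forms into one of
  cubic monomials.\<close>

lemma linear_form_0:
  assumes "cst l * x + cst m * y + cst n * z = 0"
  shows "l = 0 \<and> m = 0 \<and> n = 0"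
proof -
  have "cst l * x ^ 3 + cst 0 * y ^ 3 + cst 0 * z ^ 3 + cst m * (x ^ 2 * y) + cst n * (x ^ 2 * z) +
    cst 0 * (x * y ^ 2) + cst 0 * (x * z ^ 2) + cst 0 * (y ^ 2 * z) + cst 0 * (y * z ^ 2) + cst 0 * (x * y * z)
    = x ^ 2 * (cst l * x + cst m * y + cst n * z)"
    unfolding cst_ring(5) mult_zero_left add_0_right by (simp only: ring_expand power2_eq_square power3_eq_cube)
  also have "\<dots> = 0" unfolding assms by simp
  finally show ?thesis using cubic_independent[of l 0 0 m n 0 0 0 0 0] by blast
qed

lemma linear_form_eq:
  "cst l * x + cst m * y + cst n * z = cst l' * x + cst m' * y + cst n' * z \<longleftrightarrow> l = l' \<and> m = m' \<and> n = n'"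
proof
  assume eq: "cst l * x + cst m * y + cst n * z = cst l' * x + cst m' * y + cst n' * z"
  have "cst (l - l') * x + cst (m - m') * y + cst (n - n') * z =
    (cst l * x + cst m * y + cst n * z) - (cst l' * x + cst m' * y + cst n' * z)"
    unfolding cst_ring by (simp only: ring_expand)
  hence "cst (l - l') * x + cst (m - m') * y + cst (n - n') * z = 0" unfolding eq by simp
  from linear_form_0[OF this] show "l = l' \<and> m = m' \<and> n = n'" by simp
qed simp

text \<open>One equation for each of the ten cubic monomials in \<open>x\<close>, \<open>y\<close>,
  \<open>z\<close>, with nonzero factors \<open>p\<close> cancelled.\<close>

lemma linear_syzygy:
  assumes "(\<Sum>i<5. g i * (cst (l i) * x + cst (m i) * y + cst (n i) * z)) = 0"
  shows "q * l 0 + s * l 1 = 0" "m 0 = 0" "n 1 = 0" "q * m 0 + s * m 1 + l 2 = 0" "q * n 0 + s * n 1 + l 3 = 0"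
    "m 2 = p * l 0" "n 3 = p * l 1" "m 4 = p * n 0" "n 4 = p * m 1" "n 2 + m 3 + l 4 = 0"
proof -
  have sum5: "(\<Sum>i<5. h i) = h 0 + h 1 + h 2 + h 3 + h 4" for h :: "nat \<Rightarrow> 'k poly3"
    by (simp add: eval_nat_numeral)
  have "cst (q * l 0 + s * l 1) * x ^ 3 + cst (- (p * m 0)) * y ^ 3 + cst (- (p * n 1)) * z ^ 3 +
    cst (q * m 0 + s * m 1 + l 2) * (x ^ 2 * y) + cst (q * n 0 + s * n 1 + l 3) * (x ^ 2 * z) +
    cst (m 2 - p * l 0) * (x * y ^ 2) + cst (n 3 - p * l 1) * (x * z ^ 2) + cst (m 4 - p * n 0) * (y ^ 2 * z) +
    cst (n 4 - p * m 1) * (y * z ^ 2) + cst (n 2 + m 3 + l 4) * (x * y * z) =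
    (\<Sum>i<5. g i * (cst (l i) * x + cst (m i) * y + cst (n i) * z))"
    unfolding sum5 g_simps cst_ring by (simp only: ring_expand power2_eq_square power3_eq_cube)
  note e = cubic_independent[OF trans[OF this assms]]
  show "q * l 0 + s * l 1 = 0" "m 0 = 0" "n 1 = 0" "q * m 0 + s * m 1 + l 2 = 0" "q * n 0 + s * n 1 + l 3 = 0"
    "m 2 = p * l 0" "n 3 = p * l 1" "m 4 = p * n 0" "n 4 = p * m 1" "n 2 + m 3 + l 4 = 0"
    using e pqs by (blast | simp)+
qed

text \<open>Up to a scalar \<open>t\<close> there is only one skew-symmetric matrix of linear syzygies, the one in the
  Buchsbaum-Eisenbud resolution of the Gorenstein ideal generated by the \<open>g i\<close>.\<close>
lemma skew_syzygy_unique: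
  assumes skew: "skew_syzygy (map g [0..<5]) W"
  obtains t where "W 0 1 = 0" "W 0 2 = cst (- t) * z" "W 0 3 = 0" "W 0 4 = cst t * x" "W 1 2 = 0"
    "W 1 3 = cst (q * t / s) * y" "W 2 3 = cst (- (q * t)) * x"
    "t = 0 \<longrightarrow> (\<forall>i<5. \<forall>j<5. W i j = 0)"
proof -
  have "\<exists>l m n. W i j = cst l * x + cst m * y + cst n * z" if "i < 5" "j < 5" for i j
    using skew that unfolding skew_syzygy_def by (intro linear_form_xyz) blast
  then obtain l m n where W: "\<And>i j. i < 5 \<Longrightarrow> j < 5 \<Longrightarrow> W i j = cst (l i j) * x + cst (m i j) * y + cst (n i j) * z"
    by metis
  have diag: "l i i = 0 \<and> m i i = 0 \<and> n i i = 0" if "i < 5" for i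
    using skew W[OF that that] that unfolding skew_syzygy_def by (intro linear_form_0) simp
  have anti: "l j i = - l i j \<and> m j i = - m i j \<and> n j i = - n i j" if "i < 5" "j < 5" for i j
  proof -
    have "W j i = - W i j" using skew that unfolding skew_syzygy_def by blast
    hence "cst (l j i) * x + cst (m j i) * y + cst (n j i) * z = - (cst (l i j) * x + cst (m i j) * y + cst (n i j) * z)"
      unfolding W[OF that] W[OF that(2,1)] .
    also have "\<dots> = cst (- l i j) * x + cst (- m i j) * y + cst (- n i j) * z"
      unfolding cst_ring by (simp only: ring_expand)
    finally show ?thesis unfolding linear_form_eq .
  qed
  have syz: "(\<Sum>j<5. g j * (cst (l i j) * x + cst (m i j) * y + cst (n i j) * z)) = 0" if "i < 5" for i
  proof -
    have "(\<Sum>j<5. g j * (cst (l i j) * x + cst (m i j) * y + cst (n i j) * z)) = (\<Sum>j<5. map g [0..<5] ! j * W i j)"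
    proof (rule sum.cong[OF refl])
      fix j :: nat assume "j \<in> {..<5}"
      hence j: "j < 5" by simp
      have "map g [0..<5] ! j = g j" using j by simp
      thus "g j * (cst (l i j) * x + cst (m i j) * y + cst (n i j) * z) = map g [0..<5] ! j * W i j"
        unfolding W[OF that j] by (rule arg_cong[OF sym])
    qed
    also have "\<dots> = 0" using skew that unfolding skew_syzygy_def by blast
    finally show ?thesis .
  qed
  note rel = linear_syzygy[OF syz]
  have lt: "(0::nat) < 5" "(1::nat) < 5" "(2::nat) < 5" "(3::nat) < 5" "(4::nat) < 5" by simp_all
  note d = diag[OF lt(1)] diag[OF lt(2)] diag[OF lt(3)] diag[OF lt(4)] diag[OF lt(5)]
  note r0 = rel[OF lt(1)] and r1 = rel[OF lt(2)] and r2 = rel[OF lt(3)] and r3 = rel[OF lt(4)] and r4 = rel[OF lt(5)]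
  note a01 = anti[OF lt(1,2)] and a02 = anti[OF lt(1,3)] and a03 = anti[OF lt(1,4)] and a04 = anti[OF lt(1,5)]
    and a12 = anti[OF lt(2,3)] and a13 = anti[OF lt(2,4)] and a14 = anti[OF lt(2,5)]
    and a23 = anti[OF lt(3,4)] and a24 = anti[OF lt(3,5)] and a34 = anti[OF lt(4,5)]
  \<comment> \<open>The \<open>z\<close>-coefficient at position (2, 0), the parameter in which all
    other entries are finally expressed.\<close>
  define t where "t = n 2 0"
  \<comment> \<open>The zero diagonal enters here: as the entry (0, 0) vanishes, the equations for
    row 0 leave at most a multiple of \<open>y\<close> at (0, 1); row 1 leaves at most a multiple of
    \<open>z\<close> at (1, 0), so both entries vanish by skew symmetry.\<close>
  have n0: "l 0 0 = 0" "n 0 0 = 0" "l 0 1 = 0" "n 0 1 = 0" using d r0 pqs by simp_all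
  have n1: "l 1 1 = 0" "m 1 1 = 0" "l 1 0 = 0" "m 1 0 = 0" using d r1 pqs by simp_all
  have n01: "m 0 1 = 0" "n 1 0 = 0" using a01 n0 n1 by simp_all
  have e02: "l 0 2 = 0" "m 0 2 = 0" "l 0 3 = 0" "n 0 3 = 0" "m 0 4 = 0" "n 0 4 = 0" "l 0 4 = - n 0 2 - m 0 3"
    using r0 n0 n01 by (simp_all add: add_eq_0_iff)
  have e12: "l 1 2 = 0" "m 1 2 = 0" "l 1 3 = 0" "n 1 3 = 0" "m 1 4 = 0" "n 1 4 = 0" "l 1 4 = - n 1 2 - m 1 3"
    using r1 n1 n01 by (simp_all add: add_eq_0_iff)
  have n2: "n 2 2 = 0" "l 2 0 = 0" "l 2 1 = 0" "m 2 1 = 0" using d r2 pqs by simp_all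
  have n12: "n 1 2 = 0" using a12 r2 by simp
  have e2: "l 2 3 = - (q * t)" "n 2 3 = 0" "m 2 4 = p * t" "n 2 4 = 0" "l 2 4 = - m 2 3"
    using r2 n2 by (simp_all add: t_def add_eq_0_iff)
  have n3: "m 3 3 = 0" "n 3 0 = 0" "l 3 1 = 0" "l 3 0 = 0" using d a03 a13 e02 e12 r3 pqs by simp_all
  have e3: "n 3 2 = 0" "m 3 2 = 0" "l 3 2 = - (s * m 3 1)" "l 3 4 = 0" "m 3 4 = 0" "n 3 4 = p * m 3 1"
    using r3 n3 a23 e2 by (simp_all add: add_eq_0_iff)
  have m03: "m 0 3 = 0" using a03 r3 by simp
  have m23: "m 2 3 = 0" using a23 e3 by simp
  \<comment> \<open>Two parameters, \<open>t\<close> and \<open>m 3 1\<close>, are left. The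
    \<open>x\<close>-coefficient at (2, 3) is known from row 2 and, by skew symmetry, from row 3,
    and the comparison ties them together.\<close>
  have "- (s * m 3 1) = q * t" using a23 e2 e3 by simp
  hence s31: "s * m 3 1 = - (q * t)" by (metis minus_minus)
  have m13: "m 1 3 = q * t / s" using a13 s31 pqs by (simp add: field_simps)
  have m31: "m 3 1 = - (q * t / s)" using a13 m13 by simp
  have n02: "n 0 2 = - t" using a02 by (simp add: t_def)
  have all: "l 0 4 = t" "l 1 4 = - (q * t / s)" using e02 e12 n02 m03 n12 m13 by simp_all
  show ?thesis
  proof (rule that[of t])
    show "W 0 1 = 0" unfolding W[OF lt(1,2)] n0 n01 by simp
    show "W 0 2 = cst (- t) * z" unfolding W[OF lt(1,3)] e02 n02 by simp
    show "W 0 3 = 0" unfolding W[OF lt(1,4)] e02 m03 by simp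
    show "W 0 4 = cst t * x" unfolding W[OF lt(1,5)] e02(5,6) all by simp
    show "W 1 2 = 0" unfolding W[OF lt(2,3)] e12 n12 by simp
    show "W 1 3 = cst (q * t / s) * y" unfolding W[OF lt(2,4)] e12 m13 by simp
    show "W 2 3 = cst (- (q * t)) * x" unfolding W[OF lt(3,4)] e2 m23 by simp
    show "t = 0 \<longrightarrow> (\<forall>i<5. \<forall>j<5. W i j = 0)"
    proof
    assume t: "t = 0"
    have upper: "W i j = 0" if "i < j" "j < 5" for i j
    proof -
      have "i = 0 \<and> j = 1 \<or> i = 0 \<and> j = 2 \<or> i = 0 \<and> j = 3 \<or> i = 0 \<and> j = 4 \<or> i = 1 \<and> j = 2 \<or>
        i = 1 \<and> j = 3 \<or> i = 1 \<and> j = 4 \<or> i = 2 \<and> j = 3 \<or> i = 2 \<and> j = 4 \<or> i = 3 \<and> j = 4"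
        using that by presburger
      hence "l i j = 0 \<and> m i j = 0 \<and> n i j = 0"
        by (elim disjE conjE) (simp_all add: n0 n01 e02(1-6) n02 m03 all e12(1-6) n12 m13 e2 m23 e3 m31 t del: One_nat_def)
      moreover have "i < 5" using that by simp
      ultimately show ?thesis using W[of i j] that(2) by simp
    qed
    show "\<forall>i<5. \<forall>j<5. W i j = 0"
    proof (intro allI impI)
      fix i j :: nat assume ij: "i < 5" "j < 5"
      consider "i < j" | "i = j" | "j < i" by linarith
      thus "W i j = 0"
      proof cases
        case 1
        thus ?thesis using upper ij by blast
      next
        case 2
        thus ?thesis using skew ij unfolding skew_syzygy_def by blast
      next
        case 3
        hence "W j i = 0" using upper ij by blast
        moreover have "W i j = - W j i" using skew ij unfolding skew_syzygy_def by blast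
        ultimately show ?thesis by simp
      qed
    qed
    qed
  qed
qed

lemma coordinates_nonzero: "x \<noteq> 0" "y \<noteq> 0" "z \<noteq> 0"
  by (simp_all add: xyz vX_def vY_def vZ_def)

text \<open>In the Pluecker relation for the indices 0, 1, 2, 3 the products W01 W23 and W03 W12
  vanish for the unique matrix, while W02 W13 is a nonzero multiple of \<open>t ^ 2\<close> times
  \<open>y * z\<close>.\<close>

lemma skew_syzygy_decomposable:
  assumes skew: "skew_syzygy (map g [0..<5]) W"
    and dec: "\<And>i j. i < 5 \<Longrightarrow> j < 5 \<Longrightarrow> to_frac (W i j) = u i * v j - u j * v i"
  shows "\<forall>i<5. \<forall>j<5. W i j = 0"
proof -
  obtain t where t: "W 0 1 = 0" "W 0 2 = cst (- t) * z" "W 0 3 = 0" "W 0 4 = cst t * x" "W 1 2 = 0"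
    "W 1 3 = cst (q * t / s) * y" "W 2 3 = cst (- (q * t)) * x"
    "t = 0 \<longrightarrow> (\<forall>i<5. \<forall>j<5. W i j = 0)"
    by (rule skew_syzygy_unique[OF skew])
  have "to_frac (W 0 2 * W 1 3) = to_frac (W 0 2) * to_frac (W 1 3)" by simp
  also have "\<dots> = to_frac (W 0 1) * to_frac (W 2 3) + to_frac (W 0 3) * to_frac (W 1 2)"
  proof -
    have dec': "to_frac (W 0 1) = u 0 * v 1 - u 1 * v 0" "to_frac (W 0 2) = u 0 * v 2 - u 2 * v 0"
      "to_frac (W 0 3) = u 0 * v 3 - u 3 * v 0" "to_frac (W 1 2) = u 1 * v 2 - u 2 * v 1"
      "to_frac (W 1 3) = u 1 * v 3 - u 3 * v 1" "to_frac (W 2 3) = u 2 * v 3 - u 3 * v 2"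
      by (rule dec; simp)+
    show ?thesis unfolding dec' by (simp add: algebra_simps)
  qed
  also have "\<dots> = 0" unfolding t to_frac_0 by simp
  finally have "to_frac (W 0 2 * W 1 3) = to_frac 0" unfolding to_frac_0 .
  hence "W 0 2 * W 1 3 = 0" unfolding to_frac_eq_iff .
  hence "t = 0" unfolding t using pqs coordinates_nonzero by auto
  thus ?thesis using t(8) by blast
qed

text \<open>Each slice \<open>W i\<close> is a multiple of the unique matrix, and its row
  \<open>i\<close> vanishes. Every row of that matrix has a nonzero entry, so the multiple is
  0.\<close>

lemma skew_syzygy_triple:
  assumes skew: "\<And>i. i < 5 \<Longrightarrow> skew_syzygy (map g [0..<5]) (W i)"
    and diag: "\<And>i k. i < 5 \<Longrightarrow> k < 5 \<Longrightarrow> W i i k = 0"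
  shows "\<forall>i<5. \<forall>j<5. \<forall>k<5. W i j k = 0"
proof (intro allI impI)
  fix i j k :: nat assume ijk: "i < 5" "j < 5" "k < 5"
  obtain t where t: "W i 0 1 = 0" "W i 0 2 = cst (- t) * z" "W i 0 3 = 0" "W i 0 4 = cst t * x" "W i 1 2 = 0"
    "W i 1 3 = cst (q * t / s) * y" "W i 2 3 = cst (- (q * t)) * x"
    "t = 0 \<longrightarrow> (\<forall>j<5. \<forall>k<5. W i j k = 0)"
    by (rule skew_syzygy_unique[OF skew[OF ijk(1)]])
  have flip: "W i j k = - W i k j" if "j < 5" "k < 5" for j k
    using skew[OF ijk(1)] that unfolding skew_syzygy_def by blast
  have "i = 0 \<or> i = 1 \<or> i = 2 \<or> i = 3 \<or> i = 4" using ijk(1) by presburger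
  moreover have "t = 0" if "i = 0"
    using diag[of 0 2] t(2) that coordinates_nonzero by auto
  moreover have "t = 0" if "i = 1"
    using diag[of 1 3] t(6) that coordinates_nonzero pqs by auto
  moreover have "t = 0" if "i = 2"
    using diag[of 2 3] t(7) that coordinates_nonzero pqs by auto
  moreover have "t = 0" if "i = 3"
    using diag[of 3 1] flip[of 1 3] t(6) that coordinates_nonzero pqs by auto
  moreover have "t = 0" if "i = 4"
    using diag[of 4 0] flip[of 0 4] t(4) that coordinates_nonzero by auto
  ultimately have "t = 0" by blast
  thus "W i j k = 0" using t(8) ijk by blast
qed

end

section \<open>Change of generators\<close>

text \<open>The transpose of \<open>A\<close> acts: if \<open>fs ! j\<close> has the coordinates
  \<open>A j b\<close> with respect to \<open>g\<close>, then a syzygy \<open>w\<close> of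
  \<open>fs\<close> becomes a syzygy of \<open>g\<close>.\<close>

definition transform :: "(nat \<Rightarrow> nat \<Rightarrow> 'k::field) \<Rightarrow> (nat \<Rightarrow> 'k poly3) \<Rightarrow> nat \<Rightarrow> 'k poly3" where
  "transform A w b = (\<Sum>j<5. cst (A j b) * w j)"

abbreviation transform2 :: "(nat \<Rightarrow> nat \<Rightarrow> 'k::field) \<Rightarrow> (nat \<Rightarrow> nat \<Rightarrow> 'k poly3) \<Rightarrow> nat \<Rightarrow> nat \<Rightarrow> 'k poly3" where
  "transform2 A V a b \<equiv> transform A (\<lambda>i. transform A (V i) b) a"

lemma cst_sum: "cst (\<Sum>i\<in>I. c i) = (\<Sum>i\<in>I. cst (c i))"
  by (induction I rule: infinite_finite_induct) (simp_all add: cst_ring)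

lemma coeff3_cst_mult: "coeff3 (cst c * f) i j k = c * coeff3 f i j k"
  by (simp add: coeff3_def)

lemma homogeneous_transform:
  assumes "\<And>j. j < 5 \<Longrightarrow> homogeneous d (w j)"
  shows "homogeneous d (transform A w b)"
  unfolding transform_def
proof (rule homogeneous_sum)
  fix j :: nat assume "j \<in> {..<5}"
  thus "homogeneous d (cst (A j b) * w j)"
    using homogeneous_mult[OF homogeneous_const, of d "w j" "A j b"] assms by simp
qed

lemma transform2_skew:
  assumes "\<And>i j. i < 5 \<Longrightarrow> j < 5 \<Longrightarrow> V j i = - V i j"
  shows "transform2 A V b a = - transform2 A V a b"
proof -
  have "transform2 A V b a = (\<Sum>i<5. \<Sum>j<5. cst (A i b) * (cst (A j a) * V i j))"
    unfolding transform_def by (simp only: sum_distrib_left)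
  also have "\<dots> = (\<Sum>j<5. \<Sum>i<5. cst (A i b) * (cst (A j a) * V i j))" by (rule sum.swap)
  also have "\<dots> = (\<Sum>j<5. \<Sum>i<5. - (cst (A j a) * (cst (A i b) * V j i)))"
  proof (rule sum.cong[OF refl], rule sum.cong[OF refl])
    fix i j :: nat assume "j \<in> {..<5}" "i \<in> {..<5}"
    hence "V i j = - V j i" using assms by blast
    thus "cst (A i b) * (cst (A j a) * V i j) = - (cst (A j a) * (cst (A i b) * V j i))"
      by (simp only: mult_minus_right mult.left_commute)
  qed
  also have "\<dots> = - transform2 A V a b"
    unfolding transform_def by (simp only: sum_distrib_left sum_negf)
  finally show ?thesis .
qed

text \<open>In characteristic 0 skew symmetry of a transformed matrix yields its zero
  diagonal.\<close>

lemma eq_uminus_self: "(f :: 'k::field_char_0 poly3) = - f \<Longrightarrow> f = 0"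
proof -
  assume "f = - f"
  hence "f + f = 0" by (metis add.right_inverse)
  hence "2 * f = 0" by (simp only: mult_2)
  thus "f = 0" by simp
qed

text \<open>\<open>expand\<close> carries syzygies of \<open>fs\<close> to syzygies of
  \<open>g\<close>; the right inverse \<open>C\<close> makes this passage injective, so that
  vanishing can be carried back.\<close>

locale generator_change =
  fixes fs :: "'k::field_char_0 poly3 list" and g :: "nat \<Rightarrow> 'k poly3" and A C :: "nat \<Rightarrow> nat \<Rightarrow> 'k"
  assumes expand: "\<And>r. r < 5 \<Longrightarrow> fs ! r = (\<Sum>c<5. cst (A r c) * g c)"
    and inverse: "\<And>r r'. r < 5 \<Longrightarrow> r' < 5 \<Longrightarrow> (\<Sum>c<5. A r c * C c r') = (if r = r' then 1 else 0)"
begin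

lemma transform_syzygy: "(\<Sum>b<5. g b * transform A w b) = (\<Sum>j<5. fs ! j * w j)"
proof -
  have "(\<Sum>b<5. g b * transform A w b) = (\<Sum>b<5. \<Sum>j<5. cst (A j b) * g b * w j)"
    unfolding transform_def sum_distrib_left by (simp only: ac_simps)
  also have "\<dots> = (\<Sum>j<5. \<Sum>b<5. cst (A j b) * g b * w j)" by (rule sum.swap)
  also have "\<dots> = (\<Sum>j<5. fs ! j * w j)"
    by (rule sum.cong[OF refl]) (simp only: expand sum_distrib_right lessThan_iff)
  finally show ?thesis .
qed

lemma transform_eq_0:
  assumes "\<And>b. b < 5 \<Longrightarrow> transform A w b = 0" and "r < 5"
  shows "w r = 0"
proof -
  have "0 = (\<Sum>b<5. cst (C b r) * transform A w b)" using assms(1) by simp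
  also have "\<dots> = (\<Sum>b<5. \<Sum>j<5. cst (A j b) * cst (C b r) * w j)"
    unfolding transform_def sum_distrib_left by (simp only: ac_simps)
  also have "\<dots> = (\<Sum>j<5. \<Sum>b<5. cst (A j b) * cst (C b r) * w j)" by (rule sum.swap)
  also have "\<dots> = (\<Sum>j<5. cst (\<Sum>b<5. A j b * C b r) * w j)"
    by (simp only: cst_sum cst_ring sum_distrib_right)
  also have "\<dots> = (\<Sum>j<5. if j = r then w j else 0)"
  proof (rule sum.cong[OF refl])
    fix j :: nat assume "j \<in> {..<5}"
    hence "(\<Sum>b<5. A j b * C b r) = (if j = r then 1 else 0)" using inverse assms(2) by blast
    thus "cst (\<Sum>b<5. A j b * C b r) * w j = (if j = r then w j else 0)" by (simp add: cst_ring)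
  qed
  also have "\<dots> = w r" using assms(2) by simp
  finally show ?thesis by simp
qed

lemma transform2_eq_0:
  assumes "\<And>a b. a < 5 \<Longrightarrow> b < 5 \<Longrightarrow> transform2 A V a b = 0" and "i < 5" "j < 5"
  shows "V i j = 0"
proof -
  have "transform A (V i) b = 0" if "b < 5" for b
    using transform_eq_0[of "\<lambda>i. transform A (V i) b" i] assms(1) that assms(2) by blast
  thus ?thesis using transform_eq_0[of "V i" j] assms(3) by blast
qed

lemma transform2_skew_syzygy:
  assumes W: "skew_syzygy fs W"
  shows "skew_syzygy (map g [0..<5]) (transform2 A W)"
  unfolding skew_syzygy_def
proof (intro conjI allI impI)
  have skew: "W j i = - W i j" if "i < 5" "j < 5" for i j
    using W that unfolding skew_syzygy_def by blast
  fix a b :: nat assume "a < 5" "b < 5"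
  have "homogeneous 1 (W i j)" if "i < 5" "j < 5" for i j
    using W that unfolding skew_syzygy_def by blast
  thus "homogeneous 1 (transform2 A W a b)" by (intro homogeneous_transform)
  show "transform2 A W b a = - transform2 A W a b" by (rule transform2_skew[OF skew])
next
  have skew: "W j i = - W i j" if "i < 5" "j < 5" for i j
    using W that unfolding skew_syzygy_def by blast
  fix a :: nat assume "a < 5"
  show "transform2 A W a a = 0" by (rule eq_uminus_self[OF transform2_skew[OF skew]])
  have "(\<Sum>b<5. map g [0..<5] ! b * transform2 A W a b) = (\<Sum>b<5. g b * transform2 A W a b)"
  proof (rule sum.cong[OF refl])
    fix b :: nat assume "b \<in> {..<5}"
    hence "map g [0..<5] ! b = g b" by simp
    thus "map g [0..<5] ! b * transform2 A W a b = g b * transform2 A W a b" by (rule arg_cong)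
  qed
  also have "\<dots> = (\<Sum>b<5. \<Sum>i<5. cst (A i a) * (g b * transform A (W i) b))"
    unfolding transform_def[of A _ a] sum_distrib_left by (simp only: mult.left_commute)
  also have "\<dots> = (\<Sum>i<5. \<Sum>b<5. cst (A i a) * (g b * transform A (W i) b))" by (rule sum.swap)
  also have "\<dots> = (\<Sum>i<5. cst (A i a) * (\<Sum>j<5. fs ! j * W i j))"
    by (simp only: sum_distrib_left[symmetric] transform_syzygy)
  also have "\<dots> = 0"
  proof (rule sum.neutral, rule ballI)
    fix i :: nat assume "i \<in> {..<5}"
    hence "(\<Sum>j<5. fs ! j * W i j) = 0" using W unfolding skew_syzygy_def by blast
    thus "cst (A i a) * (\<Sum>j<5. fs ! j * W i j) = 0" by (simp only: mult_zero_right)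
  qed
  finally show "(\<Sum>b<5. map g [0..<5] ! b * transform2 A W a b) = 0" .
qed

text \<open>The transformed matrix is the wedge of the transformed vectors, so decomposability is
  preserved.\<close>

lemma transform2_decomposable:
  assumes dec: "\<And>i j. i < 5 \<Longrightarrow> j < 5 \<Longrightarrow> to_frac (W i j) = s i * t j - s j * t i"
  shows "to_frac (transform2 A W a b) =
    (\<Sum>i<5. to_frac (cst (A i a)) * s i) * (\<Sum>j<5. to_frac (cst (A j b)) * t j) -
    (\<Sum>i<5. to_frac (cst (A i b)) * s i) * (\<Sum>j<5. to_frac (cst (A j a)) * t j)"
proof -
  define \<alpha> where "\<alpha> i a = to_frac (cst (A i a))" for i a
  have "transform2 A W a b = (\<Sum>i<5. \<Sum>j<5. cst (A i a) * (cst (A j b) * W i j))"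
    unfolding transform_def by (simp only: sum_distrib_left)
  hence "to_frac (transform2 A W a b) = (\<Sum>i<5. \<Sum>j<5. to_frac (cst (A i a) * (cst (A j b) * W i j)))"
    by (simp only: to_frac_sum)
  also have "\<dots> = (\<Sum>i<5. \<Sum>j<5. (\<alpha> i a * s i) * (\<alpha> j b * t j) - (\<alpha> i a * t i) * (\<alpha> j b * s j))"
  proof (rule sum.cong[OF refl], rule sum.cong[OF refl])
    fix i j :: nat assume "i \<in> {..<5}" "j \<in> {..<5}"
    hence h1: "to_frac (W i j) = s i * t j - s j * t i" using dec by blast
    have h2: "to_frac (cst (A i a) * (cst (A j b) * W i j)) = \<alpha> i a * (\<alpha> j b * to_frac (W i j))"
      by (simp add: \<alpha>_def)
    show "to_frac (cst (A i a) * (cst (A j b) * W i j)) =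
        (\<alpha> i a * s i) * (\<alpha> j b * t j) - (\<alpha> i a * t i) * (\<alpha> j b * s j)"
      unfolding h2 h1 by (simp only: ring_expand)
  qed
  also have "\<dots> = (\<Sum>i<5. \<alpha> i a * s i) * (\<Sum>j<5. \<alpha> j b * t j) - (\<Sum>i<5. \<alpha> i a * t i) * (\<Sum>j<5. \<alpha> j b * s j)"
    by (simp only: sum_subtractf sum_product)
  also have "\<dots> = (\<Sum>i<5. \<alpha> i a * s i) * (\<Sum>j<5. \<alpha> j b * t j) - (\<Sum>j<5. \<alpha> j b * s j) * (\<Sum>i<5. \<alpha> i a * t i)"
    by (simp only: mult.commute)
  finally show ?thesis unfolding \<alpha>_def .
qed

end

section \<open>The open set\<close>

definition quadric_coeff :: "'k::field poly3 \<Rightarrow> nat \<Rightarrow> 'k" where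
  "quadric_coeff f m = (if m = 0 then coeff3 f 2 0 0 else if m = 1 then coeff3 f 1 1 0 else if m = 2 then coeff3 f 1 0 1
     else if m = 3 then coeff3 f 0 2 0 else if m = 4 then coeff3 f 0 1 1 else coeff3 f 0 0 2)"

text \<open>Five rows of coefficients and a free last row: as a function of \<open>v\<close> the
  determinant is a linear form that vanishes on the first five rows.\<close>

definition quadric_mat :: "'k::field poly3 list \<Rightarrow> (nat \<Rightarrow> 'k) \<Rightarrow> 'k mat" where
  "quadric_mat fs v = mat 6 6 (\<lambda>(r, c). if r < 5 then quadric_coeff (fs ! r) c else v c)"

text \<open>The coordinates of the linear form on quadrics, unique up to a scalar, that vanishes on \<open>fs\<close>.\<close>
definition polar :: "'k::field poly3 list \<Rightarrow> nat \<Rightarrow> 'k" where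
  "polar fs m = det (quadric_mat fs (\<lambda>c. if c = m then 1 else 0))"

text \<open>The product of \<open>p\<close>, \<open>p q\<close> and \<open>p (p q) s\<close> for the diagonal entries \<open>p\<close>, \<open>q\<close>, \<open>s\<close> that Gram-Schmidt
  orthogonalization yields for the symmetric bilinear form given by \<open>polar fs\<close>.\<close>
definition discriminant :: "'k::field poly3 list \<Rightarrow> 'k" where
  "discriminant fs = (let \<delta> = polar fs 0 * polar fs 3 - polar fs 1 * polar fs 1 in
     polar fs 0 * (\<delta> * (polar fs 0 * (\<delta> * polar fs 5) - \<delta> * (polar fs 2 * polar fs 2) -
       (polar fs 1 * polar fs 2 - polar fs 0 * polar fs 4) * (polar fs 1 * polar fs 2 - polar fs 0 * polar fs 4))))"

lemma quadric_mat_carrier [simp]: "quadric_mat fs v \<in> carrier_mat 6 6"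
  by (simp add: quadric_mat_def)

text \<open>Laplace expansion along the last row, whose cofactors do not involve \<open>v\<close>.
  Unit vectors for \<open>v\<close> identify these cofactors with the numbers
  \<open>polar fs c\<close>.\<close>

lemma det_quadric_mat: "det (quadric_mat fs v) = (\<Sum>c<6. v c * polar fs c)"
proof -
  define cof where "cof c = cofactor (quadric_mat fs (\<lambda>_. 0)) 5 c" for c
  have md: "mat_delete (quadric_mat fs v) 5 c = mat_delete (quadric_mat fs (\<lambda>_. 0)) 5 c" for v c
    unfolding mat_delete_def quadric_mat_def by (intro eq_matI) auto
  have cof: "cofactor (quadric_mat fs v) 5 c = cof c" for v c unfolding cofactor_def cof_def md[of v c] ..
  have det: "det (quadric_mat fs v) = (\<Sum>c<6. v c * cof c)" for v
  proof -
    have "det (quadric_mat fs v) = (\<Sum>c<6. quadric_mat fs v $$ (5, c) * cofactor (quadric_mat fs v) 5 c)"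
      by (rule laplace_expansion_row) simp_all
    thus ?thesis unfolding cof by (simp add: quadric_mat_def)
  qed
  have "polar fs m = cof m" if "m < 6" for m
  proof -
    have "polar fs m = (\<Sum>c<6. if c = m then cof c else 0)"
      unfolding polar_def det by (intro sum.cong) auto
    thus ?thesis using that by simp
  qed
  thus ?thesis unfolding det by (intro sum.cong) auto
qed

lemma polar_vanishes:
  assumes "r < 5"
  shows "(\<Sum>c<6. quadric_coeff (fs ! r) c * polar fs c) = 0"
  unfolding det_quadric_mat[symmetric]
  using assms by (intro det_identical_rows[of _ 6 5 r]) (auto simp: quadric_mat_def intro!: eq_vecI)

text \<open>A relation among the five quadrics, continued by 0, is a relation among the six rows of
  \<open>quadric_mat\<close>, so every \<open>polar fs m\<close> would be 0.\<close>

lemma independent_if_polar: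
  assumes "\<And>c. c < 6 \<Longrightarrow> (\<Sum>r<5. d r * quadric_coeff (fs ! r) c) = 0" "polar fs m \<noteq> 0" "r < 5"
  shows "d r = 0"
proof (rule ccontr)
  assume dr: "d r \<noteq> 0"
  let ?M = "quadric_mat fs (\<lambda>c. if c = m then 1 else 0)"
  let ?v = "vec 6 (\<lambda>r. if r < 5 then d r else 0)"
  have "?M\<^sup>T *\<^sub>v ?v = 0\<^sub>v 6"
  proof (rule eq_vecI)
    fix c assume "c < dim_vec (0\<^sub>v 6 :: 'a vec)"
    hence c: "c < 6" by simp
    have "(?M\<^sup>T *\<^sub>v ?v) $ c = (\<Sum>r<6. ?M $$ (r, c) * (if r < 5 then d r else 0))"
      using c by (simp add: scalar_prod_def atLeast0LessThan quadric_mat_def)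
    also have "\<dots> = (\<Sum>r<5. ?M $$ (r, c) * (if r < 5 then d r else 0))"
      by (intro sum.mono_neutral_right) auto
    also have "\<dots> = (\<Sum>r<5. d r * quadric_coeff (fs ! r) c)"
      using c by (intro sum.cong) (auto simp: quadric_mat_def)
    finally show "(?M\<^sup>T *\<^sub>v ?v) $ c = 0\<^sub>v 6 $ c" using assms(1) c by simp
  qed (simp add: quadric_mat_def)
  moreover have "?v \<noteq> 0\<^sub>v 6"
  proof
    assume "?v = 0\<^sub>v 6"
    hence "?v $ r = 0\<^sub>v 6 $ r" by simp
    thus False using dr assms(3) by simp
  qed
  moreover have "?v \<in> carrier_vec 6" by simp
  moreover have "?M\<^sup>T \<in> carrier_mat 6 6" by simp
  ultimately have "det (?M\<^sup>T) = 0"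
    using det_0_iff_vec_prod_zero_field[of "?M\<^sup>T" 6] by blast
  hence "polar fs m = 0" unfolding polar_def det_transpose[OF quadric_mat_carrier] .
  with assms(2) show False ..
qed

lemma quadric_coeff_sum:
  assumes "(\<Sum>r<5. cst (d r) * fs ! r) = 0"
  shows "(\<Sum>r<5. d r * quadric_coeff (fs ! r) c) = 0"
proof -
  have zero: "(\<Sum>r<5. d r * coeff3 (fs ! r) i j k) = 0" for i j k
  proof -
    have "coeff3 (\<Sum>r<5. cst (d r) * fs ! r) i j k = 0" unfolding assms by simp
    thus ?thesis by (simp only: coeff3_sum coeff3_cst_mult)
  qed
  show ?thesis unfolding quadric_coeff_def
    by (cases "c = 0"; cases "c = 1"; cases "c = 2"; cases "c = 3"; cases "c = 4") (simp_all add: zero)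
qed

lemma polynomial_function_diff:
  assumes "\<phi> \<in> polynomial_functions n d" "\<psi> \<in> polynomial_functions n d"
  shows "(\<lambda>fs. \<phi> fs - \<psi> fs) \<in> polynomial_functions n d"
proof -
  have "(\<lambda>fs. \<phi> fs + (- 1) * \<psi> fs) \<in> polynomial_functions n d"
    by (intro polynomial_functions.add assms polynomial_functions.mult polynomial_functions.const)
  thus ?thesis by simp
qed

lemma polynomial_function_sum:
  "(\<And>i. i \<in> I \<Longrightarrow> \<phi> i \<in> polynomial_functions n d) \<Longrightarrow> (\<lambda>fs. \<Sum>i\<in>I. \<phi> i fs) \<in> polynomial_functions n d"
  by (induction I rule: infinite_finite_induct) (auto intro: polynomial_functions.intros)

lemma polynomial_function_prod:
  "(\<And>i. i \<in> I \<Longrightarrow> \<phi> i \<in> polynomial_functions n d) \<Longrightarrow> (\<lambda>fs. \<Prod>i\<in>I. \<phi> i fs) \<in> polynomial_functions n d"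
  by (induction I rule: infinite_finite_induct) (auto intro: polynomial_functions.intros)

text \<open>The Leibniz formula writes the determinant as a sum of products of entries, each of
  which is a coefficient of some \<open>fs ! r\<close> or a constant.\<close>

lemma polynomial_function_polar: "(\<lambda>fs. polar fs m) \<in> polynomial_functions 5 2"
proof -
  have entry: "(\<lambda>fs. quadric_mat fs (\<lambda>c. if c = m then 1 else 0) $$ (r, c)) \<in> polynomial_functions 5 2"
    if "r < 6" "c < 6" for r c
  proof (cases "r < 5")
    case True
    have "(\<lambda>fs. quadric_coeff (fs ! r) c) \<in> polynomial_functions 5 2"
      unfolding quadric_coeff_def using True
      by (cases "c = 0"; cases "c = 1"; cases "c = 2"; cases "c = 3"; cases "c = 4")
        (simp_all add: polynomial_functions.coordinate)
    thus ?thesis using True that by (simp add: quadric_mat_def)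
  next
    case False
    thus ?thesis using that by (simp add: quadric_mat_def polynomial_functions.const)
  qed
  have "(\<lambda>fs. \<Sum>\<pi> | \<pi> permutes {0..<6}. signof \<pi> *
      (\<Prod>i = 0..<6. quadric_mat fs (\<lambda>c. if c = m then 1 else 0) $$ (i, \<pi> i))) \<in> polynomial_functions 5 2"
  proof (rule polynomial_function_sum)
    fix \<pi> :: "nat \<Rightarrow> nat" assume "\<pi> \<in> {\<pi>. \<pi> permutes {0..<6}}"
    hence "\<pi> i < 6" if "i < 6" for i using that permutes_in_image[of \<pi> "{0..<6}" i] by simp
    thus "(\<lambda>fs. signof \<pi> * (\<Prod>i = 0..<6. quadric_mat fs (\<lambda>c. if c = m then 1 else 0) $$ (i, \<pi> i)))
        \<in> polynomial_functions 5 2"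
      by (intro polynomial_functions.mult polynomial_functions.const polynomial_function_prod entry) auto
  qed
  thus ?thesis unfolding polar_def det_def'[OF quadric_mat_carrier] .
qed

lemma polynomial_function_discriminant: "discriminant \<in> polynomial_functions 5 2"
proof -
  have "(\<lambda>fs. discriminant fs) \<in> polynomial_functions 5 2"
    unfolding discriminant_def Let_def
    by (intro polynomial_functions.mult polynomial_function_diff polynomial_function_polar)
  thus ?thesis by simp
qed

section \<open>Radical ideals\<close>

lemma vars_ideal: "ideal_of {vX, vY, vZ} = {h :: 'k::field poly3. coeff3 h 0 0 0 = 0}"
proof
  have "ideal {h :: 'k poly3. coeff3 h 0 0 0 = 0} ring_of_type_algebra"
    by (rule ideal_ringI) (auto simp: coeff3_mult)
  thus "ideal_of {vX, vY, vZ} \<subseteq> {h :: 'k poly3. coeff3 h 0 0 0 = 0}"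
    by (rule ideal_of_minimal) (auto simp: coeff3_def vX_def vY_def vZ_def)
next
  show "{h :: 'k poly3. coeff3 h 0 0 0 = 0} \<subseteq> ideal_of {vX, vY, vZ}"
  proof
    fix h :: "'k poly3" assume "h \<in> {h. coeff3 h 0 0 0 = 0}"
    hence h: "coeff3 h 0 0 0 = 0" by simp
    obtain h0 h1 where h1: "h = pCons h0 h1" by (cases h)
    obtain k0 k1 where k1: "h0 = pCons k0 k1" by (cases h0)
    obtain l0 l1 where l1: "k0 = pCons l0 l1" by (cases k0)
    have "l0 = 0" using h by (simp add: coeff3_def h1 k1 l1)
    hence "h = [:[:l1:]:] * vX + [:k1:] * vY + h1 * vZ"
      by (simp add: h1 k1 l1 vX_def vY_def vZ_def)
    moreover have "vX \<in> ideal_of {vX, vY, vZ}" "vY \<in> ideal_of {vX, vY, vZ}" "vZ \<in> ideal_of {vX, vY, vZ :: 'k poly3}"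
      using ideal_of_superset[of "{vX, vY, vZ}"] by auto
    ultimately show "h \<in> ideal_of {vX, vY, vZ}"
      using ideal_ringD(2,3)[OF ideal_ideal_of] by metis
  qed
qed

context coordinates begin

text \<open>Mixed products are generators, and a cube is a combination of generators, for instance
  \<open>cst q * x ^ 3 = x * g 0 + cst p * y * g 2\<close>. A product of three coordinates is a cube
  or has two distinct neighbouring factors.\<close>

lemma cubics_in_ideal:
  assumes I: "ideal I ring_of_type_algebra" and g: "\<And>i. i < 5 \<Longrightarrow> g i \<in> I"
    and u: "u \<in> {x, y, z}" and v: "v \<in> {x, y, z}" and w: "w \<in> {x, y, z}"
  shows "u * v * w \<in> I"
proof -
  note id = ideal_ringD[OF I]
  have mixed: "x * y \<in> I" "x * z \<in> I" "y * z \<in> I"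
    using g[of 2] g[of 3] g[of 4] by (simp_all add: g_simps)
  have g01: "cst q * x ^ 2 - cst p * y ^ 2 \<in> I" "cst s * x ^ 2 - cst p * z ^ 2 \<in> I"
    using g[of 0] g[of 1] by (simp_all only: g_simps)
  have "x * (cst q * x ^ 2 - cst p * y ^ 2) + (cst p * y) * (x * y) \<in> I"
    by (intro id(2,3) g01 mixed)
  also have "x * (cst q * x ^ 2 - cst p * y ^ 2) + (cst p * y) * (x * y) = cst q * (x * x * x)"
    by (simp only: ring_expand power2_eq_square)
  finally have "cst (1 / q) * (cst q * (x * x * x)) \<in> I" by (rule id(3))
  hence xxx: "x * x * x \<in> I" using pqs by (simp only: mult.assoc[symmetric] cst_ring(4)[symmetric]) (simp add: cst_ring(6))
  have "(cst q * x) * (x * y) - y * (cst q * x ^ 2 - cst p * y ^ 2) \<in> I"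
    by (intro id(5,3) g01 mixed)
  also have "(cst q * x) * (x * y) - y * (cst q * x ^ 2 - cst p * y ^ 2) = cst p * (y * y * y)"
    by (simp only: ring_expand power2_eq_square)
  finally have "cst (1 / p) * (cst p * (y * y * y)) \<in> I" by (rule id(3))
  hence yyy: "y * y * y \<in> I" using pqs by (simp only: mult.assoc[symmetric] cst_ring(4)[symmetric]) (simp add: cst_ring(6))
  have "(cst s * x) * (x * z) - z * (cst s * x ^ 2 - cst p * z ^ 2) \<in> I"
    by (intro id(5,3) g01 mixed)
  also have "(cst s * x) * (x * z) - z * (cst s * x ^ 2 - cst p * z ^ 2) = cst p * (z * z * z)"
    by (simp only: ring_expand power2_eq_square)
  finally have "cst (1 / p) * (cst p * (z * z * z)) \<in> I" by (rule id(3))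
  hence zzz: "z * z * z \<in> I" using pqs by (simp only: mult.assoc[symmetric] cst_ring(4)[symmetric]) (simp add: cst_ring(6))
  have distinct: "u * v \<in> I" if "u \<noteq> v" "u \<in> {x, y, z}" "v \<in> {x, y, z}" for u v
    using that mixed by (auto simp: mult.commute)
  show ?thesis
  proof (cases "u = v \<and> v = w")
    case True
    thus ?thesis using u xxx yyy zzz by auto
  next
    case False
    hence "u * v \<in> I \<or> v * w \<in> I" using distinct u v w by blast
    thus ?thesis using id(4)[of "u * v" w] id(3)[of "v * w" u] by (auto simp: mult.assoc)
  qed
qed

text \<open>One inclusion compares constant terms, which are multiplicative. For the other, the cube
  of any combination of \<open>x\<close>, \<open>y\<close>, \<open>z\<close> is a combination of
  products of three coordinates.\<close>

lemma radical_eq_vars: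
  assumes homogeneous: "\<And>h. h \<in> S \<Longrightarrow> coeff3 h 0 0 0 = 0" and g: "\<And>i. i < 5 \<Longrightarrow> g i \<in> ideal_of S"
  shows "radical (ideal_of S) = ideal_of {vX, vY, vZ}"
proof
  have "ideal_of S \<subseteq> ideal_of {vX, vY, vZ}"
    using homogeneous by (intro ideal_of_minimal ideal_ideal_of) (auto simp: vars_ideal)
  show "radical (ideal_of S) \<subseteq> ideal_of {vX, vY, vZ}"
  proof
    fix h assume "h \<in> radical (ideal_of S)"
    then obtain m where "h ^ m \<in> ideal_of {vX, vY, vZ}"
      using \<open>ideal_of S \<subseteq> _\<close> unfolding radical_def by blast
    hence "coeff3 (h ^ m) 0 0 0 = 0" by (simp add: vars_ideal)
    moreover have "coeff3 (h ^ m) 0 0 0 = coeff3 h 0 0 0 ^ m"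
      by (induction m) (simp_all add: coeff3_1 coeff3_mult)
    ultimately show "h \<in> ideal_of {vX, vY, vZ}" by (simp add: vars_ideal)
  qed
  note I = ideal_ideal_of[of S]
  note id = ideal_ringD[OF I]
  show "ideal_of {vX, vY, vZ} \<subseteq> radical (ideal_of S)"
  proof
    let ?J = "{\<alpha> * x + \<beta> * y + \<gamma> * z | \<alpha> \<beta> \<gamma>. True}"
    fix h :: "'k poly3" assume h: "h \<in> ideal_of {vX, vY, vZ}"
    have "ideal ?J ring_of_type_algebra"
    proof (rule ideal_ringI)
      have "0 = 0 * x + 0 * y + 0 * z" by simp
      thus "0 \<in> ?J" by blast
    next
      fix k l assume "k \<in> ?J" "l \<in> ?J"
      then obtain \<alpha> \<beta> \<gamma> \<alpha>' \<beta>' \<gamma>' where "k = \<alpha> * x + \<beta> * y + \<gamma> * z" "l = \<alpha>' * x + \<beta>' * y + \<gamma>' * z" by blast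
      hence "k + l = (\<alpha> + \<alpha>') * x + (\<beta> + \<beta>') * y + (\<gamma> + \<gamma>') * z" by (simp only: ring_expand)
      thus "k + l \<in> ?J" by blast
    next
      fix k l assume "l \<in> ?J"
      then obtain \<alpha> \<beta> \<gamma> where "l = \<alpha> * x + \<beta> * y + \<gamma> * z" by blast
      hence "k * l = (k * \<alpha>) * x + (k * \<beta>) * y + (k * \<gamma>) * z" by (simp only: ring_expand)
      thus "k * l \<in> ?J" by blast
    qed
    moreover have "vX = 1 * x + 0 * y + 0 * z" unfolding vars_xyz(1) by simp
    moreover have "vY = - cst a * x + 1 * y + 0 * z"
      unfolding vars_xyz(2) mult_1_left mult_zero_left add_0_right by (simp only: ring_expand)
    moreover have "vZ = (cst c * cst a - cst b) * x + (- cst c) * y + 1 * z"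
      unfolding vars_xyz(3) mult_1_left by (simp only: ring_expand)
    ultimately have "ideal ?J ring_of_type_algebra" and "{vX, vY, vZ} \<subseteq> ?J" by blast+
    hence "h \<in> ?J" using h ideal_of_minimal by blast
    then obtain \<alpha> \<beta> \<gamma> where h_eq: "h = \<alpha> * x + \<beta> * y + \<gamma> * z" by blast
    \<comment> \<open>Replaces one coordinate factor by \<open>h\<close>. Three applications lead
      from \<open>u * v * w\<close> to \<open>h * h * h\<close>.\<close>
    have step: "k * h \<in> ideal_of S" if "k * x \<in> ideal_of S" "k * y \<in> ideal_of S" "k * z \<in> ideal_of S" for k
    proof -
      have "\<alpha> * (k * x) + \<beta> * (k * y) + \<gamma> * (k * z) \<in> ideal_of S" by (intro id(2,3) that)
      moreover have "k * h = \<alpha> * (k * x) + \<beta> * (k * y) + \<gamma> * (k * z)"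
        unfolding h_eq by (simp only: ring_expand)
      ultimately show ?thesis by simp
    qed
    have 1: "u * v * h \<in> ideal_of S" if "u \<in> {x, y, z}" "v \<in> {x, y, z}" for u v
    proof (rule step)
      show "u * v * x \<in> ideal_of S" "u * v * y \<in> ideal_of S" "u * v * z \<in> ideal_of S"
        by (rule cubics_in_ideal[OF I g that]; simp)+
    qed
    have 2: "u * h * h \<in> ideal_of S" if "u \<in> {x, y, z}" for u
    proof (rule step)
      have "u * h * v \<in> ideal_of S" if "v \<in> {x, y, z}" for v
        using 1[OF \<open>u \<in> _\<close> that] by (simp only: ac_simps)
      thus "u * h * x \<in> ideal_of S" "u * h * y \<in> ideal_of S" "u * h * z \<in> ideal_of S" by blast+
    qed
    have "h * h * h \<in> ideal_of S"
    proof (rule step)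
      have "h * h * v \<in> ideal_of S" if "v \<in> {x, y, z}" for v
        using 2[OF that] by (simp only: ac_simps)
      thus "h * h * x \<in> ideal_of S" "h * h * y \<in> ideal_of S" "h * h * z \<in> ideal_of S" by blast+
    qed
    thus "h \<in> radical (ideal_of S)" unfolding radical_def power3_eq_cube[symmetric] by blast
  qed
qed

end

lemma no_common_zero_if_radical:
  assumes "radical (ideal_of (set fs)) = ideal_of {vX, vY, vZ}" "P \<in> Proj"
  shows "\<exists>i<length fs. fs ! i \<notin> P"
proof (rule ccontr)
  assume "\<not> ?thesis"
  hence "set fs \<subseteq> P" unfolding in_set_conv_nth subset_iff by blast
  hence sub: "ideal_of (set fs) \<subseteq> P" by (rule ideal_of_minimal[OF ProjD(1)[OF assms(2)]])
  have "t \<in> P" if "t \<in> {vX, vY, vZ}" for t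
  proof -
    have "t \<in> radical (ideal_of (set fs))"
      unfolding assms(1) using ideal_of_superset[of "{vX, vY, vZ}"] that by (rule subsetD)
    then obtain m where "t ^ m \<in> ideal_of (set fs)" unfolding radical_def by blast
    with sub have "t ^ m \<in> P" by (rule subsetD)
    thus ?thesis using Proj_power[OF assms(2)] by simp
  qed
  thus False using ProjD(6)[OF assms(2)] by blast
qed

section \<open>Stability of the generic syzygy bundle\<close>

text \<open>The radical and the two conditions on skew matrices are known for the normal form
  \<open>g\<close>; they are carried over to \<open>fs\<close> by the invertible matrix between the
  two. Constant syzygies are excluded by the independence of \<open>fs\<close>.\<close>

lemma stable_if_discriminant:
  fixes fs :: "'k::field_char_0 poly3 list"
  assumes fs: "fs \<in> form_tuples 5 2" and disc: "discriminant fs \<noteq> 0"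
  shows "radical (ideal_of (set fs)) = ideal_of {vX, vY, vZ} \<and> stable 5 (Syz [2, 2, 2, 2, 2] fs)"
proof -
  have len: "length fs = 5" and hom: "\<And>r. r < 5 \<Longrightarrow> homogeneous 2 (fs ! r)"
    using fs unfolding form_tuples_def by auto
  \<comment> \<open>The values of the linear form \<theta> on X^2, XY, XZ, Y^2, YZ, Z^2, in this
    order. Gram-Schmidt starts with x = X and y = Y + a x, where \<open>a\<close> makes \<theta>(xy)
    = 0 and \<open>q\<close> is then \<theta>(y^2); next come z = Z - e x + c y, with
    \<open>e\<close> from \<theta>(xz) = 0 and \<open>c\<close> from \<theta>(yz) = 0, and finally s
    = \<theta>(z^2).\<close>
  define \<theta> where "\<theta> = polar fs"
  define a where "a = - \<theta> 1 / \<theta> 0"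
  define e where "e = \<theta> 2 / \<theta> 0"
  define q where "q = \<theta> 3 + a * \<theta> 1"
  define c where "c = (e * \<theta> 1 - \<theta> 4) / q"
  \<comment> \<open>The coefficient of X in Z - e x + c y after y = Y + a x is inserted.\<close>
  define b where "b = c * a - e"
  define s where "s = \<theta> 5 - e * \<theta> 2 - c * c * q"
  define p where "p = \<theta> 0"
  define \<delta> where "\<delta> = \<theta> 0 * \<theta> 3 - \<theta> 1 * \<theta> 1"
  have p0: "p \<noteq> 0" and \<delta>0: "\<delta> \<noteq> 0"
    and last0: "\<theta> 0 * (\<delta> * \<theta> 5) - \<delta> * (\<theta> 2 * \<theta> 2) - (\<theta> 1 * \<theta> 2 - \<theta> 0 * \<theta> 4) * (\<theta> 1 * \<theta> 2 - \<theta> 0 * \<theta> 4) \<noteq> 0"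
    using disc unfolding discriminant_def Let_def \<theta>_def[symmetric] \<delta>_def p_def by auto
  have a_rel: "a * p = - \<theta> 1" and e_rel: "e * p = \<theta> 2" using p0 unfolding a_def e_def p_def by simp_all
  have pq: "p * q = \<delta>" 
  proof -
    have "p * q = \<theta> 0 * \<theta> 3 + (a * p) * \<theta> 1" unfolding q_def p_def by (simp only: ring_expand)
    thus ?thesis unfolding a_rel \<delta>_def by simp
  qed
  hence q0: "q \<noteq> 0" using \<delta>0 by auto
  have c_rel: "c * q = e * \<theta> 1 - \<theta> 4" using q0 unfolding c_def by simp
  \<comment> \<open>The leading principal minors of the Gram matrix of \<theta> are p, \<delta> = pq
    and pqs; the right-hand side is p times the last of them.\<close>
  have "p * \<delta> * s = \<theta> 0 * (\<delta> * \<theta> 5) - \<delta> * (\<theta> 2 * \<theta> 2) - (\<theta> 1 * \<theta> 2 - \<theta> 0 * \<theta> 4) * (\<theta> 1 * \<theta> 2 - \<theta> 0 * \<theta> 4)"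
  proof -
    have "p * (c * q) = \<theta> 1 * (e * p) - p * \<theta> 4" unfolding c_rel by (simp only: ring_expand)
    hence pcq: "p * (c * q) = \<theta> 1 * \<theta> 2 - \<theta> 0 * \<theta> 4" unfolding e_rel unfolding p_def .
    have "p * \<delta> * s = \<theta> 0 * (\<delta> * \<theta> 5) - \<delta> * ((e * p) * \<theta> 2) - (p * (c * q)) * (p * (c * q))"
      unfolding s_def pq[symmetric] p_def[symmetric] by (simp add: algebra_simps)
    thus ?thesis unfolding e_rel pcq .
  qed
  hence s0: "s \<noteq> 0" using last0 by auto
  define x y z :: "'k poly3" where "x = vX" and "y = vY + cst a * vX" and "z = vZ + cst b * vX + cst c * vY"
  interpret coordinates a b c p q s x y z
    by unfold_locales (simp_all add: p0 q0 s0 x_def y_def z_def)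
  define k where "k r = quadric_coeff (fs ! r)" for r
  \<comment> \<open>Coordinates of \<open>fs ! r\<close> with respect to \<open>g\<close>, found by
    inserting X = x, Y = y - a x and Z = z - c y + e x. The mixed terms give columns 2, 3, 4;
    columns 0 and 1 are fixed by the coefficients \<eta> of y^2 and \<open>k r 5\<close> of
    z^2.\<close>
  define A where "A r m = (let \<eta> = k r 3 - c * k r 4 + c * c * k r 5 in
      if m = 0 then - (\<eta> / p) else if m = 1 then - (k r 5 / p)
      else if m = 2 then k r 1 - c * k r 2 - a * k r 3 - a * k r 3 + (e + a * c) * k r 4 - c * e * k r 5 - c * e * k r 5
      else if m = 3 then k r 2 - a * k r 4 + e * k r 5 + e * k r 5 else k r 4 - c * k r 5 - c * k r 5)" for r m :: nat
  have expand: "fs ! r = (\<Sum>m<5. cst (A r m) * g m)" if r: "r < 5" for r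
  proof -
    define \<eta> where "\<eta> = k r 3 - c * k r 4 + c * c * k r 5"
    define \<alpha> where "\<alpha> = k r 0 - a * k r 1 + e * k r 2 + a * a * k r 3 - a * e * k r 4 + e * e * k r 5"
    have "(\<Sum>m<6. k r m * \<theta> m) = 0" unfolding k_def \<theta>_def by (rule polar_vanishes[OF r])
    hence pol: "k r 0 * \<theta> 0 + k r 1 * \<theta> 1 + k r 2 * \<theta> 2 + k r 3 * \<theta> 3 + k r 4 * \<theta> 4 + k r 5 * \<theta> 5 = 0"
      by (simp add: eval_nat_numeral)
    have "\<alpha> * p + \<eta> * q + k r 5 * s =
        k r 0 * p - k r 1 * (a * p) + k r 2 * (e * p) + k r 3 * (a * (a * p) + q) - k r 4 * (e * (a * p) + c * q) +
        k r 5 * (e * (e * p) + c * c * q + s)"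
      unfolding \<alpha>_def \<eta>_def by (simp only: ring_expand)
    also have "\<dots> = k r 0 * \<theta> 0 + k r 1 * \<theta> 1 + k r 2 * \<theta> 2 + k r 3 * \<theta> 3 + k r 4 * \<theta> 4 + k r 5 * \<theta> 5"
      unfolding a_rel e_rel c_rel unfolding s_def unfolding q_def p_def by (simp add: algebra_simps)
    \<comment> \<open>The vanishing of \<theta> on \<open>fs ! r\<close>, written in orthogonal
      coordinates. It forces the x^2-coefficient \<alpha> to be the one that \<open>g 0\<close> and
      \<open>g 1\<close> bring along.\<close>
    finally have orth: "\<alpha> * p + \<eta> * q + k r 5 * s = 0" unfolding pol .
    have \<alpha>: "\<alpha> = - (\<eta> / p) * q - (k r 5 / p) * s"
      using orth p0 by (simp add: field_simps eq_neg_iff_add_eq_0)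
    have \<eta>': "cst (- (\<eta> / p)) * cst p = - cst \<eta>" "cst (- (k r 5 / p)) * cst p = - cst (k r 5)"
      unfolding cst_ring(4)[symmetric] cst_ring(3)[symmetric] using p0 by simp_all
    have kr: "k r 0 = coeff3 (fs ! r) 2 0 0" "k r 1 = coeff3 (fs ! r) 1 1 0" "k r 2 = coeff3 (fs ! r) 1 0 1"
      "k r 3 = coeff3 (fs ! r) 0 2 0" "k r 4 = coeff3 (fs ! r) 0 1 1" "k r 5 = coeff3 (fs ! r) 0 0 2"
      by (simp_all add: k_def quadric_coeff_def)
    have Z: "vZ = z - cst c * y + cst e * x"
      unfolding vars_xyz(3) b_def cst_ring by (simp only: ring_expand)
    have "fs ! r = cst (k r 0) * vX ^ 2 + cst (k r 1) * (vX * vY) + cst (k r 2) * (vX * vZ) +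
        cst (k r 3) * vY ^ 2 + cst (k r 4) * (vY * vZ) + cst (k r 5) * vZ ^ 2"
      unfolding kr by (rule quadric_expand[OF hom[OF r]])
    also have "\<dots> = cst \<alpha> * x ^ 2 + cst \<eta> * y ^ 2 + cst (k r 5) * z ^ 2 + cst (A r 2) * (x * y) + cst (A r 3) * (x * z) +
        cst (A r 4) * (y * z)"
    proof -
      have A: "A r 2 = k r 1 - c * k r 2 - a * k r 3 - a * k r 3 + (e + a * c) * k r 4 - c * e * k r 5 - c * e * k r 5"
        "A r 3 = k r 2 - a * k r 4 + e * k r 5 + e * k r 5" "A r 4 = k r 4 - c * k r 5 - c * k r 5"
        by (simp_all add: A_def Let_def)
      show ?thesis unfolding Z vars_xyz(1,2) A \<alpha>_def \<eta>_def cst_ring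
        by (simp only: ring_expand power2_eq_square)
    qed
    also have "\<dots> = cst (A r 0) * g 0 + cst (A r 1) * g 1 + cst (A r 2) * g 2 + cst (A r 3) * g 3 + cst (A r 4) * g 4"
    proof -
      have A: "A r 0 = - (\<eta> / p)" "A r 1 = - (k r 5 / p)" by (simp_all add: A_def \<eta>_def Let_def)
      have "cst \<alpha> = cst (- (\<eta> / p)) * cst q + cst (- (k r 5 / p)) * cst s"
        unfolding \<alpha> cst_ring(4)[symmetric] cst_ring(1)[symmetric] by simp
      moreover have "cst (- (\<eta> / p)) * (cst q * x ^ 2 - cst p * y ^ 2) = cst (- (\<eta> / p)) * cst q * x ^ 2 + cst \<eta> * y ^ 2"
        using \<eta>'(1) by (simp only: right_diff_distrib mult.assoc[symmetric] mult_minus_left diff_minus_eq_add)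
      moreover have "cst (- (k r 5 / p)) * (cst s * x ^ 2 - cst p * z ^ 2) = cst (- (k r 5 / p)) * cst s * x ^ 2 + cst (k r 5) * z ^ 2"
        using \<eta>'(2) by (simp only: right_diff_distrib mult.assoc[symmetric] mult_minus_left diff_minus_eq_add)
      ultimately show ?thesis unfolding g_simps A by (simp only: distrib_right add.assoc add.left_commute add.commute)
    qed
    also have "\<dots> = (\<Sum>m<5. cst (A r m) * g m)" by (simp add: eval_nat_numeral)
    finally show ?thesis .
  qed
  have polar0: "polar fs 0 \<noteq> 0" using p0 unfolding p_def \<theta>_def .
  have indep: "d r = 0" if "(\<Sum>r<5. cst (d r) * fs ! r) = 0" "r < 5" for d r
    by (rule independent_if_polar[OF quadric_coeff_sum[OF that(1)] polar0 that(2)])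
  define M where "M = mat 5 5 (\<lambda>(r, m). A r m)"
  have M: "M \<in> carrier_mat 5 5" by (simp add: M_def)
  \<comment> \<open>A vector annihilated by the transpose of \<open>M\<close> would be a linear
    relation among the quadrics \<open>fs\<close>.\<close>
  have det: "det M \<noteq> 0"
  proof
    assume "det M = 0"
    hence "det (M\<^sup>T) = 0" using det_transpose[OF M] by simp
    then obtain v where v: "v \<in> carrier_vec 5" "v \<noteq> 0\<^sub>v 5" "M\<^sup>T *\<^sub>v v = 0\<^sub>v 5"
      using det_0_iff_vec_prod_zero_field[of "M\<^sup>T" 5] M by auto
    have col: "(\<Sum>r<5. v $ r * A r m) = 0" if "m < 5" for m
    proof -
      have "(M\<^sup>T *\<^sub>v v) $ m = (\<Sum>r<5. v $ r * A r m)"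
        using that v(1) by (simp add: M_def scalar_prod_def atLeast0LessThan mult.commute)
      thus ?thesis using v(3) that by simp
    qed
    have "(\<Sum>r<5. cst (v $ r) * fs ! r) = (\<Sum>r<5. \<Sum>m<5. cst (v $ r * A r m) * g m)"
      by (rule sum.cong[OF refl]) (simp only: expand lessThan_iff sum_distrib_left cst_ring(4) mult.assoc)
    also have "\<dots> = (\<Sum>m<5. \<Sum>r<5. cst (v $ r * A r m) * g m)" by (rule sum.swap)
    also have "\<dots> = (\<Sum>m<5. cst (\<Sum>r<5. v $ r * A r m) * g m)" by (simp only: cst_sum sum_distrib_right)
    also have "\<dots> = 0" using col by (simp add: cst_ring(5))
    finally have "v $ r = 0" if "r < 5" for r using indep that by blast
    hence "v = 0\<^sub>v 5" using v(1) by (intro eq_vecI) auto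
    with v(2) show False ..
  qed
  \<comment> \<open>The inverse matrix, from the adjugate. \<open>AC\<close> makes the change of
    generators injective on syzygies, and \<open>CA\<close> puts the \<open>g m\<close> into the
    ideal of \<open>fs\<close>.\<close>
  define C where "C m r = inverse (det M) * adj_mat M $$ (m, r)" for m r
  note adj = adj_mat[OF M]
  have AC: "(\<Sum>m<5. A r m * C m r') = (if r = r' then 1 else 0)" if "r < 5" "r' < 5" for r r'
  proof -
    have h1: "(M * adj_mat M) $$ (r, r') = (\<Sum>m<5. A r m * adj_mat M $$ (m, r'))"
      using that adj(1) by (simp add: M_def scalar_prod_def atLeast0LessThan)
    have h2: "(M * adj_mat M) $$ (r, r') = (if r = r' then det M else 0)" unfolding adj(2) using that by simp
    have h3: "(\<Sum>m<5. A r m * C m r') = inverse (det M) * (\<Sum>m<5. A r m * adj_mat M $$ (m, r'))"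
      unfolding C_def sum_distrib_left by (simp only: mult.left_commute)
    show ?thesis unfolding h3 h1[symmetric] h2 using det by simp
  qed
  have CA: "(\<Sum>r<5. C m r * A r m') = (if m = m' then 1 else 0)" if "m < 5" "m' < 5" for m m'
  proof -
    have h1: "(adj_mat M * M) $$ (m, m') = (\<Sum>r<5. adj_mat M $$ (m, r) * A r m')"
      using that adj(1) by (simp add: M_def scalar_prod_def atLeast0LessThan)
    have h2: "(adj_mat M * M) $$ (m, m') = (if m = m' then det M else 0)" unfolding adj(3) using that by simp
    have h3: "(\<Sum>r<5. C m r * A r m') = inverse (det M) * (\<Sum>r<5. adj_mat M $$ (m, r) * A r m')"
      unfolding C_def sum_distrib_left by (simp only: mult.assoc)
    show ?thesis unfolding h3 h1[symmetric] h2 using det by simp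
  qed
  interpret generator_change fs g A C by unfold_locales (fact expand, fact AC)
  have g_mem: "g m \<in> ideal_of (set fs)" if m: "m < 5" for m
  proof -
    have "(\<Sum>r<5. cst (C m r) * fs ! r) = (\<Sum>r<5. \<Sum>m'<5. cst (C m r * A r m') * g m')"
      by (rule sum.cong[OF refl]) (simp only: expand lessThan_iff sum_distrib_left cst_ring(4) mult.assoc)
    also have "\<dots> = (\<Sum>m'<5. \<Sum>r<5. cst (C m r * A r m') * g m')" by (rule sum.swap)
    also have "\<dots> = (\<Sum>m'<5. cst (\<Sum>r<5. C m r * A r m') * g m')" by (simp only: cst_sum sum_distrib_right)
    also have "\<dots> = (\<Sum>m'<5. if m' = m then g m' else 0)"
      using CA[OF m] by (intro sum.cong) (auto simp: cst_ring(5,6))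
    also have "\<dots> = g m" using m by simp
    finally have "g m = (\<Sum>r<5. cst (C m r) * fs ! r)" by simp
    also have "\<dots> \<in> ideal_of (set fs)"
      using len ideal_of_superset[of "set fs"]
      by (intro ideal_ring_sum[OF ideal_ideal_of] ideal_ringD(3)[OF ideal_ideal_of]) auto
    finally show ?thesis .
  qed
  have "coeff3 h 0 0 0 = 0" if "h \<in> set fs" for h
  proof -
    have "homogeneous 2 h" using that fs unfolding form_tuples_def by blast
    thus ?thesis unfolding homogeneous_def by force
  qed
  hence rad: "radical (ideal_of (set fs)) = ideal_of {vX, vY, vZ}" using g_mem by (rule radical_eq_vars)
  have "stable 5 (Syz [2, 2, 2, 2, 2] fs)"
  proof (rule stable_Syz_quadrics)
    show "syzygies fs 5 2"
      using len hom no_common_zero_if_radical[OF rad] by unfold_locales auto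
  next
    fix w :: "nat \<Rightarrow> 'k poly3"
    assume w: "\<And>i. i < 5 \<Longrightarrow> homogeneous 0 (w i)" "(\<Sum>i<5. fs ! i * w i) = 0"
    have "\<exists>d. w i = cst d" if "i < 5" for i using homogeneous_0_cst[OF w(1)[OF that]] .
    then obtain d where d: "\<And>i. i < 5 \<Longrightarrow> w i = cst (d i)" by metis
    have "(\<Sum>r<5. cst (d r) * fs ! r) = (\<Sum>i<5. fs ! i * w i)"
      using d by (intro sum.cong) (simp_all only: lessThan_iff mult.commute)
    hence "d i = 0" if "i < 5" for i using indep w(2) that by simp
    thus "\<forall>i<5. w i = 0" using d by (simp add: cst_ring(5))
  next
    fix W :: "nat \<Rightarrow> nat \<Rightarrow> 'k poly3" and u v
    assume W: "skew_syzygy fs W" and dec: "\<And>i j. i < 5 \<Longrightarrow> j < 5 \<Longrightarrow> to_frac (W i j) = u i * v j - u j * v i"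
    have "\<forall>a<5. \<forall>b<5. transform2 A W a b = 0"
      by (rule skew_syzygy_decomposable[OF transform2_skew_syzygy[OF W] transform2_decomposable[OF dec]])
    thus "\<forall>i<5. \<forall>j<5. W i j = 0" using transform2_eq_0[of W] by blast
  next
    fix W :: "nat \<Rightarrow> nat \<Rightarrow> nat \<Rightarrow> 'k poly3"
    assume W: "\<And>i. i < 5 \<Longrightarrow> skew_syzygy fs (W i)"
      and anti: "\<And>i j k. i < 5 \<Longrightarrow> j < 5 \<Longrightarrow> k < 5 \<Longrightarrow> W j i k = - W i j k"
    \<comment> \<open>The generators are changed in all three indices of the tensor: in the last two
      for each fixed \<open>i\<close>, then in the first.\<close>
    define V where "V i m n = transform2 A (W i) m n" for i m n
    define W' where "W' l m n = transform A (\<lambda>i. V i m n) l" for l m n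
    have V: "skew_syzygy (map g [0..<5]) (V i)" if "i < 5" for i
      unfolding V_def by (rule transform2_skew_syzygy[OF W[OF that]])
    have "skew_syzygy (map g [0..<5]) (W' l)" for l
      unfolding skew_syzygy_def
    proof (intro conjI allI impI)
      fix m n :: nat assume mn: "m < 5" "n < 5"
      have "homogeneous 1 (V i m n)" if "i < 5" for i using V[OF that] mn unfolding skew_syzygy_def by blast
      thus "homogeneous 1 (W' l m n)" unfolding W'_def by (rule homogeneous_transform)
      have "cst (A i l) * V i n m = - (cst (A i l) * V i m n)" if "i < 5" for i
        using V[OF that] mn unfolding skew_syzygy_def by (metis mult_minus_right)
      thus "W' l n m = - W' l m n" unfolding W'_def transform_def sum_negf[symmetric] by (intro sum.cong) auto
    next
      fix m :: nat assume m: "m < 5"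
      show "W' l m m = 0" unfolding W'_def transform_def using V m unfolding skew_syzygy_def by (intro sum.neutral) auto
      have "(\<Sum>n<5. map g [0..<5] ! n * W' l m n) = (\<Sum>n<5. \<Sum>i<5. cst (A i l) * (map g [0..<5] ! n * V i m n))"
        unfolding W'_def transform_def sum_distrib_left by (simp only: mult.left_commute)
      also have "\<dots> = (\<Sum>i<5. \<Sum>n<5. cst (A i l) * (map g [0..<5] ! n * V i m n))" by (rule sum.swap)
      also have "\<dots> = (\<Sum>i<5. cst (A i l) * (\<Sum>n<5. map g [0..<5] ! n * V i m n))" by (simp only: sum_distrib_left)
      also have "\<dots> = 0"
      proof (rule sum.neutral, rule ballI)
        fix i :: nat assume "i \<in> {..<5}"
        hence i: "i < 5" by simp
        have "(\<Sum>n<5. map g [0..<5] ! n * V i m n) = 0" using V[OF i] m unfolding skew_syzygy_def by blast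
        thus "cst (A i l) * (\<Sum>n<5. map g [0..<5] ! n * V i m n) = 0" by (simp only: mult_zero_right)
      qed
      finally show "(\<Sum>n<5. map g [0..<5] ! n * W' l m n) = 0" .
    qed
    \<comment> \<open>Skew symmetry in the first two indices survives the change of the last index;
      the remaining change in the first two is a \<open>transform2\<close>, so its diagonal
      vanishes.\<close>
    moreover have "W' l l n = 0" if n: "n < 5" for l n
    proof -
      have skew: "transform A (W j i) n = - transform A (W i j) n" if ij: "i < 5" "j < 5" for i j
      proof -
        have "cst (A k n) * W j i k = - (cst (A k n) * W i j k)" if "k < 5" for k
          using anti[OF ij that] by (metis mult_minus_right)
        thus ?thesis unfolding transform_def sum_negf[symmetric] by (intro sum.cong) auto
      qed
      have "transform2 A (\<lambda>i j. transform A (W i j) n) l l = - transform2 A (\<lambda>i j. transform A (W i j) n) l l"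
        by (rule transform2_skew[OF skew])
      thus ?thesis unfolding W'_def V_def by (rule eq_uminus_self)
    qed
    ultimately have "\<forall>l<5. \<forall>m<5. \<forall>n<5. W' l m n = 0" by (intro skew_syzygy_triple)
    hence "V i m n = 0" if "i < 5" "m < 5" "n < 5" for i m n
      using transform_eq_0[of "\<lambda>i. V i m n" i] that unfolding W'_def by blast
    hence "W i j k = 0" if "i < 5" "j < 5" "k < 5" for i j k
      using transform2_eq_0[of "W i" j k] that unfolding V_def by blast
    thus "\<forall>i<5. \<forall>j<5. \<forall>k<5. W i j k = 0" by blast
  qed
  with rad show ?thesis by blast
qed

text \<open>For these quadrics the bilinear form is a nonzero multiple of the standard one, for
  which the variables are already orthogonal with equal values p = q = s.\<close>

lemma special_tuple:
  fixes fs :: "'k::field_char_0 poly3 list"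
  assumes fs: "fs = [vX ^ 2 - vY ^ 2, vX ^ 2 - vZ ^ 2, vX * vY, vX * vZ, vY * vZ]"
  shows "fs \<in> form_tuples 5 2 \<and> discriminant fs \<noteq> 0"
proof
  have hom2: "homogeneous 2 (u * v)" if "homogeneous 1 u" "homogeneous 1 v" for u v :: "'k poly3"
    using homogeneous_mult[OF that] by (simp add: numeral_2_eq_2)
  show "fs \<in> form_tuples 5 2"
    unfolding form_tuples_def fs power2_eq_square by (auto intro!: hom2 homogeneous_diff homogeneous_vars[unfolded One_nat_def])
  have coeffs: "quadric_coeff (fs ! 0) c = (if c = 0 then 1 else if c = 3 then - 1 else 0)"
    "quadric_coeff (fs ! 1) c = (if c = 0 then 1 else if c = 5 then - 1 else 0)"
    "quadric_coeff (fs ! 2) c = (if c = 1 then 1 else 0)"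
    "quadric_coeff (fs ! 3) c = (if c = 2 then 1 else 0)"
    "quadric_coeff (fs ! 4) c = (if c = 4 then 1 else 0)" if "c < 6" for c
  proof -
    have "c = 0 \<or> c = 1 \<or> c = 2 \<or> c = 3 \<or> c = 4 \<or> c = 5" using that by presburger
    thus "quadric_coeff (fs ! 0) c = (if c = 0 then 1 else if c = 3 then - 1 else 0)"
      "quadric_coeff (fs ! 1) c = (if c = 0 then 1 else if c = 5 then - 1 else 0)"
      "quadric_coeff (fs ! 2) c = (if c = 1 then 1 else 0)"
      "quadric_coeff (fs ! 3) c = (if c = 2 then 1 else 0)"
      "quadric_coeff (fs ! 4) c = (if c = 4 then 1 else 0)"
      unfolding fs by (elim disjE; simp add: quadric_coeff_def coeff3_def vX_def vY_def vZ_def power2_eq_square numeral_2_eq_2)+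
  qed
  note coeffs = coeffs coeffs(2)[unfolded One_nat_def]
  have sum6: "(\<Sum>c<6. h c) = h 0 + h 1 + h 2 + h 3 + h 4 + h 5" for h :: "nat \<Rightarrow> 'k"
    by (simp add: eval_nat_numeral)
  \<comment> \<open>Each of the five quadrics gives one of the equations, since \<theta> vanishes on
    it.\<close>
  have rel: "polar fs 3 = polar fs 0" "polar fs 5 = polar fs 0" "polar fs 1 = 0" "polar fs 2 = 0" "polar fs 4 = 0"
    using polar_vanishes[of 0 fs] polar_vanishes[of 1 fs] polar_vanishes[of 2 fs] polar_vanishes[of 3 fs] polar_vanishes[of 4 fs]
    unfolding sum6 by (simp_all add: coeffs)
  \<comment> \<open>The five quadrics together with X^2 span all quadrics; in the proof, the six
    rows leave no nonzero kernel vector.\<close>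
  have "polar fs 0 \<noteq> 0"
  proof
    let ?M = "quadric_mat fs (\<lambda>c. if c = 0 then 1 else 0)"
    assume "polar fs 0 = 0"
    hence "det ?M = 0" by (simp add: polar_def)
    then obtain v where v: "v \<in> carrier_vec 6" "v \<noteq> 0\<^sub>v 6" "?M *\<^sub>v v = 0\<^sub>v 6"
      using det_0_iff_vec_prod_zero_field[OF quadric_mat_carrier] by blast
    have row: "(\<Sum>c<6. (if r < 5 then quadric_coeff (fs ! r) c else if c = 0 then 1 else 0) * v $ c) = 0" if "r < 6" for r
    proof -
      have "(?M *\<^sub>v v) $ r = (\<Sum>c<6. (if r < 5 then quadric_coeff (fs ! r) c else if c = 0 then 1 else 0) * v $ c)"
        using that v(1) by (simp add: quadric_mat_def scalar_prod_def atLeast0LessThan)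
      thus ?thesis using v(3) that by simp
    qed
    have "v $ 0 = 0 \<and> v $ 1 = 0 \<and> v $ 2 = 0 \<and> v $ 3 = 0 \<and> v $ 4 = 0 \<and> v $ 5 = 0"
      using row[of 0] row[of 1] row[of 2] row[of 3] row[of 4] row[of 5] unfolding sum6 by (simp add: coeffs)
    hence "v $ c = 0" if "c < 6" for c
    proof -
      have "c = 0 \<or> c = 1 \<or> c = 2 \<or> c = 3 \<or> c = 4 \<or> c = 5" using that by presburger
      with \<open>v $ 0 = 0 \<and> _\<close> show ?thesis by blast
    qed
    hence "v = 0\<^sub>v 6" using v(1) by (intro eq_vecI) auto
    with v(2) show False ..
  qed
  \<comment> \<open>With these values the discriminant is the seventh power of
    \<open>polar fs 0\<close>.\<close>
  thus "discriminant fs \<noteq> 0" unfolding discriminant_def Let_def rel by simp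
qed

theorem proposition8p2:
  shows "stable 5 (Syz [2, 2, 2, 2, 2]
            [vX ^ 2 - vY ^ 2, vX ^ 2 - vZ ^ 2, vX * vY, vX * vZ, vY * vZ]
            :: 'k::{alg_closed_field, field_char_0} sheaf) \<and>
         (\<exists>U :: 'k poly3 list set. zariski_open 5 2 U \<and> U \<noteq> {} \<and>
            (\<forall>fs\<in>U. radical (ideal_of (set fs)) = ideal_of {vX, vY, vZ} \<and>
                      stable 5 (Syz [2, 2, 2, 2, 2] fs)))"
proof -
  \<comment> \<open>A principal open set. The special tuple lies in it, which gives both its
    nonemptiness and the first claim.\<close>
  define U :: "'k poly3 list set" where "U = {fs \<in> form_tuples 5 2. \<exists>\<phi>\<in>{discriminant}. \<phi> fs \<noteq> 0}"
  have "zariski_open 5 2 U"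
    unfolding zariski_open_def U_def using polynomial_function_discriminant by blast
  moreover have good: "radical (ideal_of (set fs)) = ideal_of {vX, vY, vZ} \<and> stable 5 (Syz [2, 2, 2, 2, 2] fs)"
    if "fs \<in> U" for fs
    using that unfolding U_def by (intro stable_if_discriminant) auto
  moreover have "[vX ^ 2 - vY ^ 2, vX ^ 2 - vZ ^ 2, vX * vY, vX * vZ, vY * vZ] \<in> U"
    using special_tuple[OF refl] unfolding U_def by blast
  ultimately show ?thesis by blast
qed

end
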